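(* Let $F=\alpha\,\phi(\beta/\alpha)$ be an $(\alpha,\beta)$-metric on a conic subbundle $\mathcal A\subset TM$ such that the set $\{\phi'=0\}=\{(x,y)\in\mathcal A:\phi'(\beta/\alpha)=0\}\subset\mathcal A$ has empty interior. Then the following are equivalent: (i) $F$ is of Berwald type; (ii) there exists a smooth tensor field $T^j{}_{ik}(x)=T^j{}_{ki}(x)$ on $M$ such that $$y^j\mathring\nabla_ib_j=T^j{}_{ik}y^k\left[b_j+\frac{\epsilon}{\alpha}\left(\frac{\phi}{\phi'}-\frac{\beta}{\alpha}\right)y_j\right]$$ holds at all points of $\mathcal A$ where $\phi'\ne0$. In that case, the affine connection of $F$ is given by $\Gamma^j_{ik}=\mathring\Gamma^j_{ik}+T^j{}_{ik}$, where $\mathring\Gamma^j_{ik}$ are the Levi-Civita Christoffel symbols of $a_{ij}$.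
   Context: $M$ is a smooth manifold; coordinates $x^i$ induce coordinates $(x^i,y^i)$ on $TM$; $\partial_i=\partial/\partial x^i$, $\bar\partial_i=\partial/\partial y^i$. A conic subbundle $\mathcal A\subset TM$ is an open subset projecting onto $M$ and closed under $(x,y)\mapsto(x,\lambda y)$, $\lambda>0$. A Finsler metric on $\mathcal A$ is a smooth $F:\mathcal A\to\mathbb R$ with $F(x,\lambda y)=\lambda F(x,y)$ for $\lambda>0$ and $g_{ij}=\tfrac12\bar\partial_i\bar\partial_jF^2$ nondegenerate; put $L=F^2$. Its canonical nonlinear connection is $N^j_i=\tfrac14\bar\partial_i[g^{jk}(y^m\partial_m\bar\partial_kL-\partial_kL)]$; $F$ is of Berwald type if $N^k_i=\Gamma^k_{ij}(x)y^j$ on $\mathcal A$, and then $\Gamma^k_{ij}$ are the Christoffel symbols of a torsion-free affine connection on $M$, called the affine connection of $F$. $(\alpha,\beta)$-metrics: $a_{ij}$ is a pseudo-Riemannian metric on $M$, $b=b_i\,dx^i$ a smooth 1-form, $A=a_{ij}y^iy^j$, $\alpha=\sqrt{|A|}$, $\beta=b_iy^i$, $s=\beta/\alpha$, $\epsilon=\operatorname{sgn}(A)$, $\mathring\nabla$ the Levi-Civita connection of $a_{ij}$; indices are raised and lowered with $a_{ij}$ (so $y_j=a_{jk}y^k$). An $(\alpha,\beta)$-metric is a Finsler metric, on a conic subbundle $\mathcal A$ on which $\alpha\ne0$, that can be written as $F=\alpha\phi(\beta/\alpha)$ with $\phi$ a function of one real variable, smooth on its domain. $\phi,\phi'$ are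 evaluated at $s=\beta/\alpha$. *)

theory Defs
  imports "HOL-Analysis.Analysis"
begin

section \<open>Smooth maps between Euclidean spaces\<close>

text \<open>Only used on open sets of finite-dimensional spaces, where continuity of all directional
  derivatives up to order \<open>k\<close> is the usual notion of class \<open>C\<close>-\<open>k\<close>.\<close>

primrec Ck_on :: "nat \<Rightarrow> 'a::real_normed_vector set \<Rightarrow> ('a \<Rightarrow> 'b::real_normed_vector) \<Rightarrow> bool" where
  "Ck_on 0 S f \<longleftrightarrow> continuous_on S f"
| "Ck_on (Suc k) S f \<longleftrightarrow>
     (\<forall>x\<in>S. f differentiable (at x)) \<and> (\<forall>v. Ck_on k S (\<lambda>x. frechet_derivative f (at x) v))"

definition smooth_on :: "'a::real_normed_vector set \<Rightarrow> ('a \<Rightarrow> 'b::real_normed_vector) \<Rightarrow> bool" where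
  "smooth_on S f \<longleftrightarrow> (\<forall>k. Ck_on k S f)"

definition pd :: "'n::finite \<Rightarrow> (real^'n \<Rightarrow> real) \<Rightarrow> real^'n \<Rightarrow> real" where
  "pd i f x = frechet_derivative f (at x) (axis i 1)"


section \<open>Smooth manifolds and their tangent bundles\<close>

text \<open>A chart is a domain together with a coordinate map; the values of the coordinate map outside
  the domain are irrelevant.\<close>

type_synonym ('a, 'n) chart = "'a set \<times> ('a \<Rightarrow> real^'n)"

definition chart_image :: "('a, 'n::finite) chart \<Rightarrow> (real^'n) set" where
  "chart_image c = snd c ` fst c"

definition transition :: "('a, 'n::finite) chart \<Rightarrow> ('a, 'n) chart \<Rightarrow> real^'n \<Rightarrow> real^'n" where
  "transition c d = snd d \<circ> inv_into (fst c) (snd c)"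

text \<open>The atlas need not be maximal, but it may be.\<close>

definition smooth_manifold :: "'a topology \<Rightarrow> ('a, 'n::finite) chart set \<Rightarrow> bool" where
  "smooth_manifold M Atl \<longleftrightarrow>
     Hausdorff_space M \<and> second_countable M \<and>
     (\<Union>c\<in>Atl. fst c) = topspace M \<and>
     (\<forall>c\<in>Atl. openin M (fst c) \<and> open (chart_image c) \<and>
        homeomorphic_map (subtopology M (fst c)) (top_of_set (chart_image c)) (snd c)) \<and>
     (\<forall>c\<in>Atl. \<forall>d\<in>Atl. smooth_on (snd c ` (fst c \<inter> fst d)) (transition c d))"

text \<open>A tangent vector at \<open>p\<close> is the family of its component vectors in all charts around \<open>p\<close>,
  related by the Jacobians of the coordinate changes. The value \<open>0\<close> at all other charts is a
  convention that makes the representation unique, and each tangent space a linear subspace.\<close>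

type_synonym ('a, 'n) tangent = "'a \<times> (('a, 'n) chart \<Rightarrow> real^'n)"

definition tangent_bundle :: "'a topology \<Rightarrow> ('a, 'n::finite) chart set \<Rightarrow> ('a, 'n) tangent set" where
  "tangent_bundle M Atl = {(p, v). p \<in> topspace M \<and>
     (\<forall>c\<in>Atl. \<forall>d\<in>Atl. p \<in> fst c \<inter> fst d \<longrightarrow> v d = jacobian (transition c d) (at (snd c p)) *v v c) \<and>
     (\<forall>c. \<not> (c \<in> Atl \<and> p \<in> fst c) \<longrightarrow> v c = 0)}"

definition tangent_scale :: "real \<Rightarrow> ('a, 'n::finite) tangent \<Rightarrow> ('a, 'n) tangent" where
  "tangent_scale r w = (fst w, \<lambda>c. r *\<^sub>R snd w c)"

text \<open>The induced coordinates \<open>(x, y)\<close>.\<close>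

definition tangent_coords :: "('a, 'n::finite) chart \<Rightarrow> ('a, 'n) tangent \<Rightarrow> (real^'n) \<times> (real^'n)" where
  "tangent_coords c w = (snd c (fst w), snd w c)"

text \<open>\<open>coord_set\<close> and \<open>coord_fun\<close> are the coordinate expressions of sets and functions on the
  tangent bundle.\<close>

definition coord_set :: "('a, 'n::finite) chart \<Rightarrow> ('a, 'n) tangent set \<Rightarrow> ((real^'n) \<times> (real^'n)) set" where
  "coord_set c W = tangent_coords c ` {w\<in>W. fst w \<in> fst c}"

definition coord_fun :: "'a topology \<Rightarrow> ('a, 'n::finite) chart set \<Rightarrow> (('a, 'n) tangent \<Rightarrow> real)
    \<Rightarrow> ('a, 'n) chart \<Rightarrow> (real^'n) \<times> (real^'n) \<Rightarrow> real" where
  "coord_fun M Atl F c =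
     F \<circ> inv_into {w \<in> tangent_bundle M Atl. fst w \<in> fst c} (tangent_coords c)"

definition tangent_topology :: "'a topology \<Rightarrow> ('a, 'n::finite) chart set \<Rightarrow> ('a, 'n) tangent topology" where
  "tangent_topology M Atl = topology (\<lambda>W. W \<subseteq> tangent_bundle M Atl \<and> (\<forall>c\<in>Atl. open (coord_set c W)))"

lemma inj_on_tangent_coords:
  assumes M: "smooth_manifold M Atl" and c: "c \<in> Atl"
  shows "inj_on (tangent_coords c) {w \<in> tangent_bundle M Atl. fst w \<in> fst c}"
proof (rule inj_onI)
  fix w w' :: "('a, 'b) tangent"
  assume w: "w \<in> {w \<in> tangent_bundle M Atl. fst w \<in> fst c}"
    and w': "w' \<in> {w \<in> tangent_bundle M Atl. fst w \<in> fst c}"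
    and eq: "tangent_coords c w = tangent_coords c w'"
  obtain p v p' v' where pv: "w = (p, v)" "w' = (p', v')"
    by (cases w, cases w') auto
  have hom: "homeomorphic_map (subtopology M (fst c)) (top_of_set (chart_image c)) (snd c)"
    and "openin M (fst c)"
    using M c by (auto simp: smooth_manifold_def)
  from this(2) have "topspace (subtopology M (fst c)) = fst c"
    by (rule topspace_subtopology_subset[OF openin_subset])
  then have "inj_on (snd c) (fst c)"
    using homeomorphic_imp_injective_map[OF hom] by simp
  then have pp: "p' = p"
    using w w' eq pv by (auto simp: tangent_coords_def inj_on_def)
  have vc: "v c = v' c" and p: "p \<in> fst c"
    and tw: "(p, v) \<in> tangent_bundle M Atl" "(p, v') \<in> tangent_bundle M Atl"
    using w w' eq pv pp by (simp_all add: tangent_coords_def)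
  have "v d = v' d" for d
  proof (cases "d \<in> Atl \<and> p \<in> fst d")
    case True
    then have "u d = jacobian (transition c d) (at (snd c p)) *v u c"
      if "(p, u) \<in> tangent_bundle M Atl" for u
      using that c p unfolding tangent_bundle_def by blast
    from this[OF tw(1)] this[OF tw(2)] vc show ?thesis
      by metis
  next
    case False
    then have "u d = 0" if "(p, u) \<in> tangent_bundle M Atl" for u
      using that unfolding tangent_bundle_def by blast
    from this[OF tw(1)] this[OF tw(2)] show ?thesis
      by metis
  qed
  then show "w = w'"
    using pv pp by auto
qed

lemma openin_tangent_topology:
  assumes "smooth_manifold M Atl"
  shows "openin (tangent_topology M Atl) W \<longleftrightarrow>
     W \<subseteq> tangent_bundle M Atl \<and> (\<forall>c\<in>Atl. open (coord_set c W))"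
proof -
  let ?P = "\<lambda>W. W \<subseteq> tangent_bundle M Atl \<and> (\<forall>c\<in>Atl. open (coord_set c W))"
  have int: "?P (S \<inter> T)" if "?P S" "?P T" for S T
  proof -
    have "coord_set c (S \<inter> T) = coord_set c S \<inter> coord_set c T" if "c \<in> Atl" for c
    proof -
      have "coord_set c (S \<inter> T)
          = tangent_coords c ` ({w\<in>S. fst w \<in> fst c} \<inter> {w\<in>T. fst w \<in> fst c})"
        unfolding coord_set_def by (rule arg_cong[where f = "image _"]) auto
      also have "\<dots> = coord_set c S \<inter> coord_set c T"
        unfolding coord_set_def
        by (rule inj_on_image_Int[OF inj_on_tangent_coords[OF assms that]])
          (use \<open>?P S\<close> \<open>?P T\<close> in auto)
      finally show ?thesis .
    qed
    then show ?thesis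
      using that by (auto intro: open_Int)
  qed
  have un: "?P (\<Union>K)" if "\<forall>S\<in>K. ?P S" for K
  proof -
    have "coord_set c (\<Union>K) = (\<Union>S\<in>K. coord_set c S)" for c :: "('a, 'b) chart"
      unfolding coord_set_def by auto
    then show ?thesis
      using that by (auto intro!: open_UN)
  qed
  have "istopology ?P"
    unfolding istopology_def using int un by blast
  then show ?thesis
    by (simp add: tangent_topology_def topology_inverse')
qed


section \<open>Tensor fields and affine connections\<close>

text \<open>Fields are given by their components in each chart, as functions of the coordinates
  on \<^term>\<open>chart_image c\<close>. The components of a field with upper index \<open>j\<close> and lower
  indices \<open>i\<close>, \<open>k\<close> are written \<open>T c x $ j $ i $ k\<close>.\<close>

definition one_form :: "('a, 'n::finite) chart set \<Rightarrow> (('a, 'n) chart \<Rightarrow> real^'n \<Rightarrow> real^'n) \<Rightarrow> bool" where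
  "one_form Atl b \<longleftrightarrow>
     (\<forall>c\<in>Atl. smooth_on (chart_image c) (b c)) \<and>
     (\<forall>c\<in>Atl. \<forall>d\<in>Atl. \<forall>p \<in> fst c \<inter> fst d. \<forall>i.
        let J = jacobian (transition c d) (at (snd c p)) in
        b c (snd c p) $ i = (\<Sum>k\<in>UNIV. J $ k $ i * b d (snd d p) $ k))"

definition pseudo_riemannian_metric ::
  "('a, 'n::finite) chart set \<Rightarrow> (('a, 'n) chart \<Rightarrow> real^'n \<Rightarrow> real^'n^'n) \<Rightarrow> bool" where
  "pseudo_riemannian_metric Atl a \<longleftrightarrow>
     (\<forall>c\<in>Atl. smooth_on (chart_image c) (a c)) \<and>
     (\<forall>c\<in>Atl. \<forall>x\<in>chart_image c. transpose (a c x) = a c x \<and> invertible (a c x)) \<and>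
     (\<forall>c\<in>Atl. \<forall>d\<in>Atl. \<forall>p \<in> fst c \<inter> fst d. \<forall>i j.
        let J = jacobian (transition c d) (at (snd c p)) in
        a c (snd c p) $ i $ j =
          (\<Sum>k\<in>UNIV. \<Sum>l\<in>UNIV. J $ k $ i * J $ l $ j * a d (snd d p) $ k $ l))"

definition tensor_1_2 ::
  "('a, 'n::finite) chart set \<Rightarrow> (('a, 'n) chart \<Rightarrow> real^'n \<Rightarrow> real^'n^'n^'n) \<Rightarrow> bool" where
  "tensor_1_2 Atl T \<longleftrightarrow>
     (\<forall>c\<in>Atl. smooth_on (chart_image c) (T c)) \<and>
     (\<forall>c\<in>Atl. \<forall>d\<in>Atl. \<forall>p \<in> fst c \<inter> fst d. \<forall>l i k.
        let J = jacobian (transition c d) (at (snd c p)) in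
        (\<Sum>j\<in>UNIV. J $ l $ j * T c (snd c p) $ j $ i $ k) =
          (\<Sum>m\<in>UNIV. \<Sum>n\<in>UNIV. T d (snd d p) $ l $ m $ n * J $ m $ i * J $ n $ k))"

definition torsion_free_affine_connection ::
  "('a, 'n::finite) chart set \<Rightarrow> (('a, 'n) chart \<Rightarrow> real^'n \<Rightarrow> real^'n^'n^'n) \<Rightarrow> bool" where
  "torsion_free_affine_connection Atl \<Gamma> \<longleftrightarrow>
     (\<forall>c\<in>Atl. smooth_on (chart_image c) (\<Gamma> c)) \<and>
     (\<forall>c\<in>Atl. \<forall>x\<in>chart_image c. \<forall>j i k. \<Gamma> c x $ j $ i $ k = \<Gamma> c x $ j $ k $ i) \<and>
     (\<forall>c\<in>Atl. \<forall>d\<in>Atl. \<forall>p \<in> fst c \<inter> fst d. \<forall>l i k.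
        let J = jacobian (transition c d) (at (snd c p)) in
        (\<Sum>j\<in>UNIV. J $ l $ j * \<Gamma> c (snd c p) $ j $ i $ k) =
          (\<Sum>m\<in>UNIV. \<Sum>n\<in>UNIV. \<Gamma> d (snd d p) $ l $ m $ n * J $ m $ i * J $ n $ k)
          + pd i (pd k (\<lambda>x. transition c d x $ l)) (snd c p))"

text \<open>The Levi-Civita Christoffel symbols, as a function of the components of the metric in
  one chart.\<close>

definition levi_civita :: "(real^'n \<Rightarrow> real^'n^'n::finite) \<Rightarrow> real^'n \<Rightarrow> real^'n^'n^'n" where
  "levi_civita a x = (\<chi> j i k. 1/2 * (\<Sum>l\<in>UNIV. matrix_inv (a x) $ j $ l *
     (pd i (\<lambda>x. a x $ l $ k) x + pd k (\<lambda>x. a x $ i $ l) x - pd l (\<lambda>x. a x $ i $ k) x)))"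

text \<open>\<open>cov_deriv a b i j\<close> is the component with derivative index \<open>i\<close> and form index \<open>j\<close>.\<close>

definition cov_deriv :: "(real^'n \<Rightarrow> real^'n^'n::finite) \<Rightarrow> (real^'n \<Rightarrow> real^'n) \<Rightarrow> 'n \<Rightarrow> 'n \<Rightarrow> real^'n \<Rightarrow> real" where
  "cov_deriv a b i j x = pd i (\<lambda>x. b x $ j) x - (\<Sum>l\<in>UNIV. levi_civita a x $ l $ i $ j * b x $ l)"


section \<open>Finsler metrics\<close>

definition pdx :: "'n::finite \<Rightarrow> ((real^'n) \<times> (real^'n) \<Rightarrow> real) \<Rightarrow> (real^'n) \<times> (real^'n) \<Rightarrow> real" where
  "pdx i f z = frechet_derivative f (at z) (axis i 1, 0)"

definition pdy :: "'n::finite \<Rightarrow> ((real^'n) \<times> (real^'n) \<Rightarrow> real) \<Rightarrow> (real^'n) \<times> (real^'n) \<Rightarrow> real" where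
  "pdy i f z = frechet_derivative f (at z) (0, axis i 1)"

definition conic_subbundle :: "'a topology \<Rightarrow> ('a, 'n::finite) chart set \<Rightarrow> ('a, 'n) tangent set \<Rightarrow> bool" where
  "conic_subbundle M Atl A \<longleftrightarrow>
     openin (tangent_topology M Atl) A \<and> fst ` A = topspace M \<and>
     (\<forall>w\<in>A. \<forall>r>0. tangent_scale r w \<in> A)"

text \<open>In the next two definitions \<open>f\<close> is the coordinate expression of the Finsler metric in one
  chart.\<close>

definition fundamental_tensor :: "((real^'n) \<times> (real^'n) \<Rightarrow> real) \<Rightarrow> (real^'n) \<times> (real^'n) \<Rightarrow> real^'n^'n::finite" where
  "fundamental_tensor f z = (\<chi> i j. 1/2 * pdy i (pdy j (\<lambda>z. (f z)\<^sup>2)) z)"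

definition nonlinear_connection ::
  "((real^'n) \<times> (real^'n) \<Rightarrow> real) \<Rightarrow> 'n::finite \<Rightarrow> 'n \<Rightarrow> (real^'n) \<times> (real^'n) \<Rightarrow> real" where
  "nonlinear_connection f j i z = (let L = (\<lambda>z. (f z)\<^sup>2) in
     1/4 * pdy i (\<lambda>z. \<Sum>k\<in>UNIV. matrix_inv (fundamental_tensor f z) $ j $ k *
       ((\<Sum>m\<in>UNIV. snd z $ m * pdx m (pdy k L) z) - pdx k L z)) z)"

definition finsler_metric :: "'a topology \<Rightarrow> ('a, 'n::finite) chart set \<Rightarrow> ('a, 'n) tangent set
    \<Rightarrow> (('a, 'n) tangent \<Rightarrow> real) \<Rightarrow> bool" where
  "finsler_metric M Atl A F \<longleftrightarrow>
     conic_subbundle M Atl A \<and>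
     (\<forall>c\<in>Atl. smooth_on (coord_set c A) (coord_fun M Atl F c)) \<and>
     (\<forall>w\<in>A. \<forall>r>0. F (tangent_scale r w) = r * F w) \<and>
     (\<forall>c\<in>Atl. \<forall>z\<in>coord_set c A. invertible (fundamental_tensor (coord_fun M Atl F c) z))"

definition berwald_type :: "'a topology \<Rightarrow> ('a, 'n::finite) chart set \<Rightarrow> ('a, 'n) tangent set
    \<Rightarrow> (('a, 'n) tangent \<Rightarrow> real) \<Rightarrow> bool" where
  "berwald_type M Atl A F \<longleftrightarrow>
     (\<forall>c\<in>Atl. \<exists>\<Gamma> :: real^'n \<Rightarrow> real^'n^'n^'n. \<forall>z\<in>coord_set c A. \<forall>k i.
        nonlinear_connection (coord_fun M Atl F c) k i z =
          (\<Sum>j\<in>UNIV. \<Gamma> (fst z) $ k $ i $ j * snd z $ j))"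

text \<open>\<open>\<Gamma>\<close> are the Christoffel symbols of the affine connection of \<open>F\<close>; since \<open>A\<close> is open and
  projects onto \<open>M\<close>, this determines \<open>\<Gamma> c\<close> on \<^term>\<open>chart_image c\<close>.\<close>

definition affine_connection_of :: "'a topology \<Rightarrow> ('a, 'n::finite) chart set \<Rightarrow> ('a, 'n) tangent set
    \<Rightarrow> (('a, 'n) tangent \<Rightarrow> real) \<Rightarrow> (('a, 'n) chart \<Rightarrow> real^'n \<Rightarrow> real^'n^'n^'n) \<Rightarrow> bool" where
  "affine_connection_of M Atl A F \<Gamma> \<longleftrightarrow>
     torsion_free_affine_connection Atl \<Gamma> \<and>
     (\<forall>c\<in>Atl. \<forall>z\<in>coord_set c A. \<forall>k i.
        nonlinear_connection (coord_fun M Atl F c) k i z =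
          (\<Sum>j\<in>UNIV. \<Gamma> c (fst z) $ k $ i $ j * snd z $ j))"


section \<open>Metrics built from a pseudo-Riemannian metric and a 1-form\<close>

text \<open>Coordinate expressions at \<open>z = (x, y)\<close> in one chart, where \<open>a\<close> and \<open>b\<close> are the component
  functions in that chart.\<close>

definition ab_quad :: "(real^'n \<Rightarrow> real^'n^'n::finite) \<Rightarrow> (real^'n) \<times> (real^'n) \<Rightarrow> real" where
  "ab_quad a z = (\<Sum>i\<in>UNIV. \<Sum>j\<in>UNIV. a (fst z) $ i $ j * snd z $ i * snd z $ j)"

definition ab_alpha :: "(real^'n \<Rightarrow> real^'n^'n::finite) \<Rightarrow> (real^'n) \<times> (real^'n) \<Rightarrow> real" where
  "ab_alpha a z = sqrt \<bar>ab_quad a z\<bar>"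

definition ab_beta :: "(real^'n::finite \<Rightarrow> real^'n) \<Rightarrow> (real^'n) \<times> (real^'n) \<Rightarrow> real" where
  "ab_beta b z = (\<Sum>i\<in>UNIV. b (fst z) $ i * snd z $ i)"

definition ab_s :: "(real^'n \<Rightarrow> real^'n^'n::finite) \<Rightarrow> (real^'n \<Rightarrow> real^'n) \<Rightarrow> (real^'n) \<times> (real^'n) \<Rightarrow> real" where
  "ab_s a b z = ab_beta b z / ab_alpha a z"

definition ab_lower :: "(real^'n \<Rightarrow> real^'n^'n::finite) \<Rightarrow> (real^'n) \<times> (real^'n) \<Rightarrow> 'n \<Rightarrow> real" where
  "ab_lower a z j = (\<Sum>k\<in>UNIV. a (fst z) $ j $ k * snd z $ k)"

text \<open>\<open>F = \<alpha> \<phi>(\<beta>/\<alpha>)\<close> on \<open>A\<close>, where \<open>D\<close> is the domain of \<open>\<phi>\<close>.\<close>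

definition alpha_beta_metric :: "'a topology \<Rightarrow> ('a, 'n::finite) chart set \<Rightarrow> ('a, 'n) tangent set
    \<Rightarrow> (('a, 'n) tangent \<Rightarrow> real) \<Rightarrow> (('a, 'n) chart \<Rightarrow> real^'n \<Rightarrow> real^'n^'n)
    \<Rightarrow> (('a, 'n) chart \<Rightarrow> real^'n \<Rightarrow> real^'n) \<Rightarrow> real set \<Rightarrow> (real \<Rightarrow> real) \<Rightarrow> bool" where
  "alpha_beta_metric M Atl A F a b D \<phi> \<longleftrightarrow>
     finsler_metric M Atl A F \<and> pseudo_riemannian_metric Atl a \<and> one_form Atl b \<and>
     open D \<and> smooth_on D \<phi> \<and>
     (\<forall>c\<in>Atl. \<forall>w\<in>A. fst w \<in> fst c \<longrightarrow>
        (let z = tangent_coords c w in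
           ab_alpha (a c) z \<noteq> 0 \<and> ab_s (a c) (b c) z \<in> D \<and>
           F w = ab_alpha (a c) z * \<phi> (ab_s (a c) (b c) z)))"

text \<open>The value of \<open>\<beta>/\<alpha>\<close> at \<open>w\<close> does not depend on the chart around \<open>w\<close>, so the existential
  quantifier could equally be universal.\<close>

definition phi_crit_set :: "('a, 'n::finite) chart set \<Rightarrow> ('a, 'n) tangent set
    \<Rightarrow> (('a, 'n) chart \<Rightarrow> real^'n \<Rightarrow> real^'n^'n)
    \<Rightarrow> (('a, 'n) chart \<Rightarrow> real^'n \<Rightarrow> real^'n) \<Rightarrow> (real \<Rightarrow> real) \<Rightarrow> ('a, 'n) tangent set" where
  "phi_crit_set Atl A a b \<phi> =
     {w\<in>A. \<exists>c\<in>Atl. fst w \<in> fst c \<and> deriv \<phi> (ab_s (a c) (b c) (tangent_coords c w)) = 0}"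

definition berwald_tensor :: "('a, 'n::finite) chart set \<Rightarrow> ('a, 'n) tangent set
    \<Rightarrow> (('a, 'n) chart \<Rightarrow> real^'n \<Rightarrow> real^'n^'n)
    \<Rightarrow> (('a, 'n) chart \<Rightarrow> real^'n \<Rightarrow> real^'n) \<Rightarrow> (real \<Rightarrow> real)
    \<Rightarrow> (('a, 'n) chart \<Rightarrow> real^'n \<Rightarrow> real^'n^'n^'n) \<Rightarrow> bool" where
  "berwald_tensor Atl A a b \<phi> T \<longleftrightarrow>
     tensor_1_2 Atl T \<and>
     (\<forall>c\<in>Atl. \<forall>x\<in>chart_image c. \<forall>j i k. T c x $ j $ i $ k = T c x $ j $ k $ i) \<and>
     (\<forall>c\<in>Atl. \<forall>z\<in>coord_set c A.
        (let x = fst z; y = snd z; \<alpha> = ab_alpha (a c) z; \<beta> = ab_beta (b c) z;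
             \<epsilon> = sgn (ab_quad (a c) z) in
         deriv \<phi> (\<beta> / \<alpha>) \<noteq> 0 \<longrightarrow>
         (\<forall>i. (\<Sum>j\<in>UNIV. y $ j * cov_deriv (a c) (b c) i j x) =
            (\<Sum>j\<in>UNIV. \<Sum>k\<in>UNIV. T c x $ j $ i $ k * y $ k *
               (b c x $ j + \<epsilon> / \<alpha> * (\<phi> (\<beta> / \<alpha>) / deriv \<phi> (\<beta> / \<alpha>) - \<beta> / \<alpha>) * ab_lower (a c) z j)))))"

end

theory Submission
  imports Defs
begin

text \<open>Write \<open>\<delta>\<^sub>i = \<partial>/\<partial>x\<^sup>i - \<Gamma>\<^sup>k\<^sub>i\<^sub>j y\<^sup>j \<partial>/\<partial>y\<^sup>k\<close> for the horizontal derivatives of a symmetric \<open>\<Gamma>\<close>. The key fact is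
  that the canonical nonlinear connection of \<open>F\<close> equals \<open>\<Gamma>\<^sup>k\<^sub>i\<^sub>j y\<^sup>j\<close> if and only if \<open>\<delta>\<^sub>i F\<^sup>2 = 0\<close>. If
  \<open>\<delta>\<^sub>i F\<^sup>2 = 0\<close>, differentiating along the fibre and contracting with \<open>y\<close> shows that the spray is
  \<open>2 \<Gamma>\<^sup>k\<^sub>i\<^sub>j y\<^sup>i y\<^sup>j\<close>. Conversely, if the spray has this form, then \<open>E\<^sub>i = \<delta>\<^sub>i F\<^sup>2\<close> satisfies
  \<open>\<partial>(y\<^sup>i E\<^sub>i)/\<partial>y\<^sup>l = 2 E\<^sub>l\<close> while \<open>y\<^sup>i E\<^sub>i\<close> is homogeneous of degree 3, so that \<open>E = 0\<close>.

  For \<open>\<Gamma> = \<Gamma>\<degree> + T\<close> with \<open>\<Gamma>\<degree>\<close> the Levi-Civita symbols, \<open>\<delta>\<degree>\<^sub>i \<alpha> = 0\<close> and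
  \<open>\<delta>\<degree>\<^sub>i \<beta> = y\<^sup>j \<nabla>\<^sub>i b\<^sub>j\<close>, so where \<open>\<phi>' \<noteq> 0\<close> the equation \<open>\<delta>\<^sub>i F = 0\<close> is the one in (ii); where
  \<open>\<phi>' = 0\<close> it follows by density. A symmetric \<open>\<Gamma>\<close> with \<open>\<delta>\<^sub>i L = 0\<close> is unique when the fibre Hessian of
  \<open>L\<close> is nondegenerate. Applied to \<open>L = F\<^sup>2\<close> and to \<open>L = a\<^sub>i\<^sub>j y\<^sup>i y\<^sup>j\<close>, this gives the transformation law
  of both connections, hence the tensoriality of \<open>T\<close>.\<close>


section \<open>Smooth functions\<close>

text \<open>Near a point of the open set \<open>S\<close> the two functions agree, so they share all
  derivatives there. The closure lemmas below rely on this: a derivative formula valid only on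
  \<open>S\<close> may replace \<open>frechet_derivative\<close> inside
  \<open>Ck_on\<close>.\<close>

lemma Ck_on_cong:
  assumes "open S" "\<And>x. x \<in> S \<Longrightarrow> f x = g x" "Ck_on k S f"
  shows "Ck_on k S g"
  using assms(2,3)
proof (induction k arbitrary: f g)
  case 0
  then show ?case by (metis Ck_on.simps(1) continuous_on_cong)
next
  case (Suc k)
  have d: "g differentiable (at x)" if "x \<in> S" for x
    using Suc.prems that assms(1)
    by (metis Ck_on.simps(2) differentiable_def has_derivative_transform_within_open)
  have "frechet_derivative f (at x) = frechet_derivative g (at x)" if "x \<in> S" for x
    by (rule frechet_derivative_transform_within_open[OF _ assms(1) that])
      (use Suc.prems that in auto)
  then show ?case
    using Suc.prems(2) d Suc.IH[of "\<lambda>x. frechet_derivative f (at x) v" "\<lambda>x. frechet_derivative g (at x) v" for v]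
    by simp
qed

text \<open>Derivatives are taken \<open>at x\<close> rather than within \<open>S\<close>, so
  regularity can be checked on a neighbourhood of each point.\<close>

lemma Ck_on_locally:
  assumes "\<And>x. x \<in> S \<Longrightarrow> \<exists>U. x \<in> U \<and> open U \<and> Ck_on k U f"
  shows "Ck_on k S f"
  using assms
proof (induction k arbitrary: f)
  case 0
  have "isCont f x" if "x \<in> S" for x
    using 0[OF that] by (auto simp: continuous_on_eq_continuous_at)
  then show ?case by (simp add: continuous_at_imp_continuous_on)
next
  case (Suc k)
  then show ?case by (simp, meson)
qed

lemma Ck_on_SucD: "Ck_on (Suc k) S f \<Longrightarrow> Ck_on k S f"
proof (induction k arbitrary: f)
  case 0
  then have "isCont f x" if "x \<in> S" for x
    using that by (simp add: differentiable_imp_continuous_within)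
  then show ?case by (simp add: continuous_at_imp_continuous_on)
qed simp

lemma smooth_onD_differentiable: "smooth_on S f \<Longrightarrow> x \<in> S \<Longrightarrow> f differentiable (at x)"
  unfolding smooth_on_def by (metis Ck_on.simps(2))

lemma smooth_onD_continuous: "smooth_on S f \<Longrightarrow> continuous_on S f"
  unfolding smooth_on_def by (metis Ck_on.simps(1))

lemma smooth_on_frechet: "smooth_on S f \<Longrightarrow> smooth_on S (\<lambda>x. frechet_derivative f (at x) v)"
  unfolding smooth_on_def by (metis Ck_on.simps(2))

lemma smooth_on_has_derivative:
  "smooth_on S f \<Longrightarrow> x \<in> S \<Longrightarrow> (f has_derivative frechet_derivative f (at x)) (at x)"
  using frechet_derivative_works smooth_onD_differentiable by blast

lemma smooth_on_cong:
  "smooth_on S f \<Longrightarrow> open S \<Longrightarrow> (\<And>x. x \<in> S \<Longrightarrow> f x = g x) \<Longrightarrow> smooth_on S g"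
  unfolding smooth_on_def using Ck_on_cong by blast

lemma smooth_on_locally:
  "(\<And>x. x \<in> S \<Longrightarrow> \<exists>U. x \<in> U \<and> open U \<and> smooth_on U f) \<Longrightarrow> smooth_on S f"
  unfolding smooth_on_def by (meson Ck_on_locally)

section \<open>Closure of smoothness under linear maps and arithmetic\<close>

lemma Ck_on_const: "Ck_on k S (\<lambda>x. c)"
  by (induction k arbitrary: c) auto

lemma Ck_on_add:
  assumes "open S" "Ck_on k S f" "Ck_on k S g" shows "Ck_on k S (\<lambda>x. f x + g x)"
  using assms(2,3)
proof (induction k arbitrary: f g)
  case 0
  then show ?case by (simp add: continuous_on_add)
next
  case (Suc k)
  have d: "((\<lambda>x. f x + g x) has_derivative (\<lambda>v. frechet_derivative f (at x) v + frechet_derivative g (at x) v)) (at x)"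
    if "x \<in> S" for x
    using Suc.prems that by (auto intro!: has_derivative_add simp: frechet_derivative_works[symmetric])
  have "Ck_on k S (\<lambda>x. frechet_derivative (\<lambda>x. f x + g x) (at x) v)" for v
    by (rule Ck_on_cong[OF assms(1) _ Suc.IH[of "\<lambda>x. frechet_derivative f (at x) v" "\<lambda>x. frechet_derivative g (at x) v"]])
      (use Suc.prems frechet_derivative_at[OF d] in \<open>auto simp: fun_eq_iff\<close>)
  then show ?case using d by (auto simp: differentiable_def)
qed

lemma Ck_on_bounded_linear_compose:
  assumes "open S" "bounded_linear h" "Ck_on k S f" shows "Ck_on k S (\<lambda>x. h (f x))"
  using assms(3)
proof (induction k arbitrary: f)
  case 0
  then show ?case using assms(2) by (simp add: bounded_linear.continuous_on)
next
  case (Suc k)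
  have d: "((\<lambda>x. h (f x)) has_derivative (\<lambda>v. h (frechet_derivative f (at x) v))) (at x)"
    if "x \<in> S" for x
    by (rule bounded_linear.has_derivative[OF assms(2)])
      (use Suc.prems that in \<open>simp add: frechet_derivative_works[symmetric]\<close>)
  have "Ck_on k S (\<lambda>x. frechet_derivative (\<lambda>x. h (f x)) (at x) v)" for v
    by (rule Ck_on_cong[OF assms(1) _ Suc.IH[of "\<lambda>x. frechet_derivative f (at x) v"]])
      (use Suc.prems frechet_derivative_at[OF d] in \<open>auto simp: fun_eq_iff\<close>)
  then show ?case using d by (auto simp: differentiable_def)
qed

lemma Ck_on_bounded_linear: "bounded_linear h \<Longrightarrow> Ck_on k S h"
proof (induction k)
  case 0
  then show ?case by (simp add: linear_continuous_on)
next
  case (Suc k)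
  have "(h has_derivative h) (at x)" for x
    using Suc.prems by (rule bounded_linear_imp_has_derivative)
  then have "h differentiable (at x)" "frechet_derivative h (at x) = h" for x
    using differentiable_def frechet_derivative_at by (blast, metis)
  then show ?case by (simp add: Ck_on_const)
qed

lemma Ck_on_mult:
  fixes f g :: "'a::real_normed_vector \<Rightarrow> real"
  assumes "open S" "Ck_on k S f" "Ck_on k S g" shows "Ck_on k S (\<lambda>x. f x * g x)"
  using assms(2,3)
proof (induction k arbitrary: f g)
  case 0
  then show ?case by (simp add: continuous_on_mult)
next
  case (Suc k)
  have d: "((\<lambda>x. f x * g x) has_derivative (\<lambda>v. f x * frechet_derivative g (at x) v + frechet_derivative f (at x) v * g x)) (at x)"
    if "x \<in> S" for x
    using Suc.prems that by (auto intro!: has_derivative_mult simp: frechet_derivative_works[symmetric])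
  have "Ck_on k S (\<lambda>x. f x * frechet_derivative g (at x) v + frechet_derivative f (at x) v * g x)" for v
    using Suc.prems by (intro Ck_on_add assms(1) Suc.IH) (auto intro: Ck_on_SucD)
  then have "Ck_on k S (\<lambda>x. frechet_derivative (\<lambda>x. f x * g x) (at x) v)" for v
    by (rule Ck_on_cong[OF assms(1), rotated])
      (use frechet_derivative_at[OF d] in \<open>auto simp: fun_eq_iff\<close>)
  then show ?case using d by (auto simp: differentiable_def)
qed

text \<open>The derivative \<open>- f' / f^2\<close> contains \<open>inverse f\<close> itself, which
  the induction hypothesis for the lower order covers; hence \<open>f\<close> stays fixed in the
  induction.\<close>

lemma Ck_on_inverse:
  fixes f :: "'a::real_normed_vector \<Rightarrow> real"
  assumes "open S" "\<And>x. x \<in> S \<Longrightarrow> f x \<noteq> 0" "Ck_on k S f" shows "Ck_on k S (\<lambda>x. inverse (f x))"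
  using assms(3)
proof (induction k)
  case 0
  then show ?case using assms by (auto intro: continuous_on_inverse)
next
  case (Suc k)
  have d: "((\<lambda>x. inverse (f x)) has_derivative
      (\<lambda>v. - (inverse (f x) * frechet_derivative f (at x) v * inverse (f x)))) (at x)"
    if "x \<in> S" for x
    using Suc.prems that assms(2) by (auto intro!: has_derivative_inverse simp: frechet_derivative_works[symmetric])
  have "Ck_on k S (\<lambda>x. - 1 * (inverse (f x) * frechet_derivative f (at x) v * inverse (f x)))" for v
    using Suc.prems Suc.IH[OF Ck_on_SucD]
    by (intro Ck_on_mult assms(1) Ck_on_const) auto
  then have "Ck_on k S (\<lambda>x. frechet_derivative (\<lambda>x. inverse (f x)) (at x) v)" for v
    by (rule Ck_on_cong[OF assms(1), rotated])
      (use frechet_derivative_at[OF d] in \<open>auto simp: fun_eq_iff\<close>)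
  then show ?case using d by (auto simp: differentiable_def)
qed

lemma smooth_on_const: "smooth_on S (\<lambda>x. c)"
  by (simp add: smooth_on_def Ck_on_const)

lemma smooth_on_add: "open S \<Longrightarrow> smooth_on S f \<Longrightarrow> smooth_on S g \<Longrightarrow> smooth_on S (\<lambda>x. f x + g x)"
  by (simp add: smooth_on_def Ck_on_add)

lemma smooth_on_mult:
  fixes f g :: "'a::real_normed_vector \<Rightarrow> real"
  shows "open S \<Longrightarrow> smooth_on S f \<Longrightarrow> smooth_on S g \<Longrightarrow> smooth_on S (\<lambda>x. f x * g x)"
  by (simp add: smooth_on_def Ck_on_mult)

lemma smooth_on_divide:
  fixes f g :: "'a::real_normed_vector \<Rightarrow> real"
  shows "open S \<Longrightarrow> smooth_on S f \<Longrightarrow> smooth_on S g \<Longrightarrow> (\<And>x. x \<in> S \<Longrightarrow> g x \<noteq> 0) \<Longrightarrow> smooth_on S (\<lambda>x. f x / g x)"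
  by (simp add: smooth_on_def Ck_on_mult Ck_on_inverse divide_inverse)

lemma smooth_on_bounded_linear_compose:
  "open S \<Longrightarrow> bounded_linear h \<Longrightarrow> smooth_on S f \<Longrightarrow> smooth_on S (\<lambda>x. h (f x))"
  by (simp add: smooth_on_def Ck_on_bounded_linear_compose)

lemma smooth_on_bounded_linear: "bounded_linear h \<Longrightarrow> smooth_on S h"
  by (simp add: smooth_on_def Ck_on_bounded_linear)

lemma smooth_on_minus:
  "open S \<Longrightarrow> smooth_on S f \<Longrightarrow> smooth_on S (\<lambda>x. - f x)"
  by (rule smooth_on_bounded_linear_compose[OF _ bounded_linear_minus[OF bounded_linear_ident]])

lemma smooth_on_diff: "open S \<Longrightarrow> smooth_on S f \<Longrightarrow> smooth_on S g \<Longrightarrow> smooth_on S (\<lambda>x. f x - g x)"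
  using smooth_on_add[OF _ _ smooth_on_minus, of S f g] by simp

lemma smooth_on_sum:
  "open S \<Longrightarrow> (\<And>i. i \<in> I \<Longrightarrow> smooth_on S (f i)) \<Longrightarrow> smooth_on S (\<lambda>x. \<Sum>i\<in>I. f i x)"
  by (induction I rule: infinite_finite_induct) (simp_all add: smooth_on_const smooth_on_add)

lemma smooth_on_prod:
  fixes f :: "'i \<Rightarrow> 'a::real_normed_vector \<Rightarrow> real"
  shows "open S \<Longrightarrow> (\<And>i. i \<in> I \<Longrightarrow> smooth_on S (f i)) \<Longrightarrow> smooth_on S (\<lambda>x. \<Prod>i\<in>I. f i x)"
  by (induction I rule: infinite_finite_induct) (simp_all add: smooth_on_const smooth_on_mult)

section \<open>Smoothness of vector-valued functions and of matrix inverses\<close>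

lemma smooth_on_vec_nth: "open S \<Longrightarrow> smooth_on S f \<Longrightarrow> smooth_on S (\<lambda>x. f x $ i)"
  by (rule smooth_on_bounded_linear_compose[OF _ bounded_linear_vec_nth])

lemma bounded_linear_axis: "bounded_linear (\<lambda>r::'b::euclidean_space. axis i r :: 'b^'n::finite)"
  by (rule linear_conv_bounded_linear[THEN iffD1])
    (auto intro!: linearI simp: vec_eq_iff axis_def)

text \<open>The function is the sum of its components along the axes. Entries may lie in any
  Euclidean space, so the lemma iterates to matrices and three-index arrays.\<close>

lemma smooth_on_vec:
  fixes f :: "'a::real_normed_vector \<Rightarrow> 'b::euclidean_space^'n::finite"
  assumes "open S" "\<And>i. smooth_on S (\<lambda>x. f x $ i)"
  shows "smooth_on S f"
proof -
  have "smooth_on S (\<lambda>x. \<Sum>i\<in>UNIV. axis i (f x $ i))"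
    by (intro smooth_on_sum assms(1) smooth_on_bounded_linear_compose[OF _ bounded_linear_axis] assms(2))
  moreover have "(\<Sum>i\<in>UNIV. axis i (v $ i)) = v" for v :: "'b^'n"
    by (simp add: vec_eq_iff axis_def if_distrib cong: if_cong)
  ultimately show ?thesis by simp
qed

lemma smooth_on_det:
  fixes f :: "'a::real_normed_vector \<Rightarrow> real^'n^'n"
  assumes "open S" "\<And>i j. smooth_on S (\<lambda>x. f x $ i $ j)"
  shows "smooth_on S (\<lambda>x. det (f x))"
  unfolding det_def by (intro smooth_on_sum smooth_on_mult smooth_on_prod smooth_on_const assms)

lemma matrix_inv_right_left:
  fixes A :: "real^'n^'n"
  assumes "invertible A" shows "A ** matrix_inv A = mat 1" "matrix_inv A ** A = mat 1"
  using assms unfolding invertible_def matrix_inv_def by (metis (mono_tags, lifting) someI_ex)+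

text \<open>Column \<open>k\<close> of the inverse solves \<open>A v = axis k 1\<close>, so Cramer's
  rule applies. The quotient of determinants makes smoothness of the inverse visible.\<close>

lemma matrix_inv_cramer:
  fixes A :: "real^'n^'n"
  assumes "invertible A"
  shows "matrix_inv A $ j $ k = det (\<chi> i l. if l = j then axis k 1 $ i else A $ i $ l) / det A"
proof -
  have "A *v (matrix_inv A *v axis k 1) = axis k 1"
    by (simp add: matrix_vector_mul_assoc matrix_inv_right_left[OF assms])
  then have "(matrix_inv A *v axis k 1) $ j = det (\<chi> i l. if l = j then axis k 1 $ i else A $ i $ l) / det A"
    using cramer[of A] assms by (simp add: invertible_det_nz)
  then show ?thesis by (simp add: matrix_vector_mul_component inner_axis)
qed

lemma smooth_on_matrix_inv:
  fixes f :: "'a::real_normed_vector \<Rightarrow> real^'n^'n"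
  assumes S: "open S" and f: "\<And>i j. smooth_on S (\<lambda>x. f x $ i $ j)" and inv: "\<And>x. x \<in> S \<Longrightarrow> invertible (f x)"
  shows "smooth_on S (\<lambda>x. matrix_inv (f x) $ j $ k)"
proof -
  have "smooth_on S (\<lambda>x. (\<chi> i l. if l = j then axis k 1 $ i else f x $ i $ l) $ p $ q)" for p q
    using f by (cases "q = j") (simp_all add: smooth_on_const)
  then have "smooth_on S (\<lambda>x. det (\<chi> i l. if l = j then axis k 1 $ i else f x $ i $ l) / det (f x))"
    using inv by (intro smooth_on_divide smooth_on_det S f) (auto simp: invertible_det_nz)
  then show ?thesis
    by (rule smooth_on_cong[OF _ S]) (simp add: matrix_inv_cramer inv)
qed

section \<open>Restriction to slices of a product\<close>

lemma open_slice_x: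
  fixes W :: "('a::topological_space \<times> 'b::topological_space) set"
  assumes "open W" shows "open {x. (x, y) \<in> W}"
proof -
  have "open ((\<lambda>x. (x, y)) -` W)"
    by (rule open_vimage[OF assms]) (auto intro!: continuous_intros)
  then show ?thesis by (simp add: vimage_def)
qed

lemma open_slice_y:
  fixes W :: "('a::topological_space \<times> 'b::topological_space) set"
  assumes "open W" shows "open {y. (x, y) \<in> W}"
proof -
  have "open ((\<lambda>y. (x, y)) -` W)"
    by (rule open_vimage[OF assms]) (auto intro!: continuous_intros)
  then show ?thesis by (simp add: vimage_def)
qed

text \<open>By the chain rule, the derivative of the restriction in direction \<open>v\<close> is
  the derivative of \<open>f\<close> in direction \<open>(v, 0)\<close>, again restricted to the
  slice, so the induction goes through.\<close>

lemma Ck_on_slice: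
  assumes "open W" "Ck_on k W f"
  shows "Ck_on k {x. (x, y) \<in> W} (\<lambda>x. f (x, y))"
  using assms(2)
proof (induction k arbitrary: f)
  case 0
  have "continuous_on {x. (x, y) \<in> W} (f \<circ> (\<lambda>x. (x, y)))"
  proof (rule continuous_on_compose)
    show "continuous_on {x. (x, y) \<in> W} (\<lambda>x. (x, y))" by (intro continuous_intros)
    show "continuous_on ((\<lambda>x. (x, y)) ` {x. (x, y) \<in> W}) f"
      using 0 by (auto intro: continuous_on_subset)
  qed
  then show ?case by (simp add: o_def)
next
  case (Suc k)
  note o = open_slice_x[OF assms(1)]
  have d: "((\<lambda>x. f (x, y)) has_derivative (\<lambda>v. frechet_derivative f (at (x, y)) (v, 0))) (at x)"
    if "(x, y) \<in> W" for x
  proof -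
    have "(f has_derivative frechet_derivative f (at (x, y))) (at (x, y))"
      using Suc.prems that by (auto simp: frechet_derivative_works[symmetric])
    moreover have "((\<lambda>x. (x, y)) has_derivative (\<lambda>v. (v, 0))) (at x)"
      by (auto intro!: derivative_eq_intros)
    ultimately show ?thesis
      using has_derivative_compose[of "\<lambda>x. (x, y)"] by blast
  qed
  have "Ck_on k {x. (x, y) \<in> W} (\<lambda>x. frechet_derivative f (at (x, y)) (v, 0))" for v
    using Suc.IH[of "\<lambda>x. frechet_derivative f (at x) (v, 0)"] Suc.prems by simp
  then have "Ck_on k {x. (x, y) \<in> W} (\<lambda>x. frechet_derivative (\<lambda>x. f (x, y)) (at x) v)" for v
    by (rule Ck_on_cong[OF o, rotated])
      (use frechet_derivative_at[OF d] in \<open>auto simp: fun_eq_iff\<close>)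
  then show ?case using d by (auto simp: differentiable_def)
qed

lemma smooth_on_slice: "open W \<Longrightarrow> smooth_on W f \<Longrightarrow> smooth_on {x. (x, y) \<in> W} (\<lambda>x. f (x, y))"
  by (simp add: smooth_on_def Ck_on_slice)


section \<open>Symmetry of second derivatives\<close>

text \<open>The mean value theorem is applied twice: first along \<open>u\<close> to the difference
  of \<open>f\<close> on two parallel segments, then along \<open>v\<close> to the resulting
  difference of directional derivatives.\<close>

lemma second_difference_mvt:
  fixes f :: "'a::real_normed_vector \<Rightarrow> real"
  assumes f: "smooth_on S f" and h: "h > 0"
    and S: "\<And>s t. s \<in> {0..h} \<Longrightarrow> t \<in> {0..h} \<Longrightarrow> z + s *\<^sub>R u + t *\<^sub>R v \<in> S"
  obtains s t where "s \<in> {0..h}" "t \<in> {0..h}"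
    "f (z + h *\<^sub>R u + h *\<^sub>R v) - f (z + h *\<^sub>R u) - f (z + h *\<^sub>R v) + f z =
      h * h * frechet_derivative (\<lambda>x. frechet_derivative f (at x) u) (at (z + s *\<^sub>R u + t *\<^sub>R v)) v"
proof -
  let ?Du = "\<lambda>x. frechet_derivative f (at x) u"
  have Du: "smooth_on S ?Du" by (rule smooth_on_frechet[OF f])
  have line: "((\<lambda>s. k (w + s *\<^sub>R d)) has_real_derivative frechet_derivative k (at (w + s *\<^sub>R d)) d) (at s)"
    if "smooth_on S k" "w + s *\<^sub>R d \<in> S" for k :: "'a \<Rightarrow> real" and w d s
  proof -
    have k: "(k has_derivative frechet_derivative k (at (w + s *\<^sub>R d))) (at (w + s *\<^sub>R d))"
      by (rule smooth_on_has_derivative[OF that])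
    have "((\<lambda>s. w + s *\<^sub>R d) has_derivative (\<lambda>r. r *\<^sub>R d)) (at s)"
      by (auto intro!: derivative_eq_intros)
    from has_derivative_compose[OF this k]
    have "((\<lambda>s. k (w + s *\<^sub>R d)) has_derivative (\<lambda>r. frechet_derivative k (at (w + s *\<^sub>R d)) (r *\<^sub>R d))) (at s)" .
    moreover have "frechet_derivative k (at (w + s *\<^sub>R d)) (r *\<^sub>R d) = frechet_derivative k (at (w + s *\<^sub>R d)) d * r" for r
      using linear_scale[OF has_derivative_linear[OF k]] by (simp add: mult.commute)
    ultimately show ?thesis by (simp add: has_field_derivative_def)
  qed
  \<comment> \<open>\<open>?g h - ?g 0\<close> is the second difference over the parallelogram
    spanned by \<open>h u\<close> and \<open>h v\<close>.\<close>
  let ?g = "\<lambda>s. f ((z + h *\<^sub>R v) + s *\<^sub>R u) - f (z + s *\<^sub>R u)"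
  have "(?g has_real_derivative ?Du ((z + h *\<^sub>R v) + s *\<^sub>R u) - ?Du (z + s *\<^sub>R u)) (at s)"
    if "0 \<le> s" "s \<le> h" for s
    using S[of s h] S[of s 0] that h
    by (intro DERIV_diff line f) (auto simp: algebra_simps)
  from MVT2[OF h this] obtain s where s: "0 < s" "s < h"
    and 1: "?g h - ?g 0 = (h - 0) * (?Du ((z + h *\<^sub>R v) + s *\<^sub>R u) - ?Du (z + s *\<^sub>R u))" by blast
  have "((\<lambda>t. ?Du ((z + s *\<^sub>R u) + t *\<^sub>R v)) has_real_derivative
      frechet_derivative ?Du (at ((z + s *\<^sub>R u) + t *\<^sub>R v)) v) (at t)"
    if "0 \<le> t" "t \<le> h" for t
    using S[of s t] that s by (intro line Du) auto
  from MVT2[OF h this] obtain t where t: "0 < t" "t < h"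
    and 2: "?Du ((z + s *\<^sub>R u) + h *\<^sub>R v) - ?Du ((z + s *\<^sub>R u) + 0 *\<^sub>R v) =
      (h - 0) * frechet_derivative ?Du (at ((z + s *\<^sub>R u) + t *\<^sub>R v)) v" by blast
  show thesis
    by (rule that[of s t]) (use s t 1 2 in \<open>auto simp: algebra_simps\<close>)
qed

text \<open>The second difference is symmetric in \<open>u\<close> and \<open>v\<close>. Divided by
  \<open>h^2\<close> it equals each mixed derivative at some nearby point, and continuity of both
  forces equality at \<open>z\<close>.\<close>

lemma frechet_derivative_commute:
  fixes f :: "'a::real_normed_vector \<Rightarrow> real"
  assumes S: "open S" and f: "smooth_on S f" and z: "z \<in> S"
  shows "frechet_derivative (\<lambda>x. frechet_derivative f (at x) u) (at z) v =
    frechet_derivative (\<lambda>x. frechet_derivative f (at x) v) (at z) u"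
proof (rule ccontr)
  let ?a = "\<lambda>x. frechet_derivative (\<lambda>x. frechet_derivative f (at x) u) (at x) v"
  let ?b = "\<lambda>x. frechet_derivative (\<lambda>x. frechet_derivative f (at x) v) (at x) u"
  assume ne: "?a z \<noteq> ?b z"
  \<comment> \<open>Half the gap: if both mixed derivatives vary by less than \<open>e\<close>,
    equal nearby values would make the gap smaller than \<open>2 * e\<close>, that is, than
    itself.\<close>
  define e where "e = \<bar>?a z - ?b z\<bar> / 2"
  have e: "e > 0" using ne by (simp add: e_def)
  have "isCont ?a z" "isCont ?b z"
    using smooth_onD_continuous[OF smooth_on_frechet[OF smooth_on_frechet[OF f]]] S z
    by (auto simp: continuous_on_eq_continuous_at)
  then obtain d1 d2 where d1: "d1 > 0" "\<And>x. dist x z < d1 \<Longrightarrow> dist (?a x) (?a z) < e"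
    and d2: "d2 > 0" "\<And>x. dist x z < d2 \<Longrightarrow> dist (?b x) (?b z) < e"
    using e unfolding continuous_at_eps_delta by metis
  obtain d3 where d3: "d3 > 0" "ball z d3 \<subseteq> S"
    using S z openE by blast
  define d where "d = min d1 (min d2 d3)"
  \<comment> \<open>Keeps the whole parallelogram within distance \<open>d\<close> of
    \<open>z\<close>; the summand 1 keeps the denominator positive even if \<open>u\<close> and
    \<open>v\<close> vanish.\<close>
  define h where "h = d / (2 * (norm u + norm v + 1))"
  have d: "d > 0" using d1 d2 d3 by (simp add: d_def)
  have h: "h > 0" using d unfolding h_def by (intro divide_pos_pos) (auto intro: add_nonneg_pos)
  have near: "dist (z + s *\<^sub>R u + t *\<^sub>R v) z < d" if "s \<in> {0..h}" "t \<in> {0..h}" for s t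
  proof -
    have "norm (s *\<^sub>R u + t *\<^sub>R v) \<le> s * norm u + t * norm v"
      using norm_triangle_ineq[of "s *\<^sub>R u" "t *\<^sub>R v"] that by simp
    also have "\<dots> \<le> h * norm u + h * norm v"
      using that by (intro add_mono mult_right_mono) auto
    also have "\<dots> \<le> h * (norm u + norm v + 1)" using h by (simp add: algebra_simps)
    also have "\<dots> = d / 2"
    proof -
      have "norm u + norm v + 1 \<noteq> 0" by (smt (verit) norm_ge_zero)
      then show ?thesis unfolding h_def by (simp add: field_simps)
    qed
    also have "\<dots> < d" using d by simp
    finally show ?thesis by (simp add: dist_norm algebra_simps)
  qed
  have inS: "z + s *\<^sub>R u + t *\<^sub>R v \<in> S" if "s \<in> {0..h}" "t \<in> {0..h}" for s t
    using near[OF that] d3(2) by (auto simp: d_def dist_commute)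
  have inS': "z + s *\<^sub>R v + t *\<^sub>R u \<in> S" if "s \<in> {0..h}" "t \<in> {0..h}" for s t
    using inS[OF that(2,1)] by (simp add: algebra_simps)
  obtain s t where st: "s \<in> {0..h}" "t \<in> {0..h}" and 1:
    "f (z + h *\<^sub>R u + h *\<^sub>R v) - f (z + h *\<^sub>R u) - f (z + h *\<^sub>R v) + f z = h * h * ?a (z + s *\<^sub>R u + t *\<^sub>R v)"
    using second_difference_mvt[OF f h inS] .
  obtain s' t' where st': "s' \<in> {0..h}" "t' \<in> {0..h}" and 2:
    "f (z + h *\<^sub>R v + h *\<^sub>R u) - f (z + h *\<^sub>R v) - f (z + h *\<^sub>R u) + f z = h * h * ?b (z + s' *\<^sub>R v + t' *\<^sub>R u)"
    using second_difference_mvt[OF f h inS'] .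
  have "z + h *\<^sub>R v + h *\<^sub>R u = z + h *\<^sub>R u + h *\<^sub>R v" by simp
  then have "h * h * ?a (z + s *\<^sub>R u + t *\<^sub>R v) = h * h * ?b (z + s' *\<^sub>R v + t' *\<^sub>R u)"
    using 1 2 by (metis add.commute diff_diff_eq)
  then have "?a (z + s *\<^sub>R u + t *\<^sub>R v) = ?b (z + t' *\<^sub>R u + s' *\<^sub>R v)"
    using h by (simp add: algebra_simps)
  moreover have "dist (?a (z + s *\<^sub>R u + t *\<^sub>R v)) (?a z) < e"
    by (rule d1) (use near[OF st] in \<open>simp add: d_def\<close>)
  moreover have "dist (?b (z + t' *\<^sub>R u + s' *\<^sub>R v)) (?b z) < e"
    by (rule d2) (use near[OF st'(2,1)] in \<open>simp add: d_def\<close>)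
  ultimately have "\<bar>?a z - ?b z\<bar> < 2 * e"
    unfolding dist_real_def by linarith
  then show False by (simp add: e_def)
qed


section \<open>Parallel Lagrangians on a fibre\<close>

text \<open>Below, \<open>p\<close> and \<open>q\<close> are the gradients of a Lagrangian in the fibre and base directions at a fixed
  base point, as functions of the fibre coordinate, and \<open>B u v\<close> stands for \<open>\<Gamma>\<^sup>k\<^sub>i\<^sub>j u\<^sup>i v\<^sup>j\<close>.\<close>

lemma has_derivative_bilinear_apply:
  fixes B :: "'v::euclidean_space \<Rightarrow> 'v \<Rightarrow> 'v"
  assumes "bilinear B" shows "(B u has_derivative B u) (at y)" "((\<lambda>y. B y y) has_derivative (\<lambda>v. B y v + B v y)) (at y)"
proof -
  have bb: "bounded_bilinear B" using assms by (simp add: bilinear_conv_bounded_bilinear)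
  show "(B u has_derivative B u) (at y)"
    by (rule bounded_linear_imp_has_derivative[OF bounded_bilinear.bounded_linear_right[OF bb]])
  show "((\<lambda>y. B y y) has_derivative (\<lambda>v. B y v + B v y)) (at y)"
    by (rule bounded_bilinear.FDERIV[OF bb has_derivative_ident has_derivative_ident])
qed

text \<open>Used throughout to differentiate an identity that holds on an open set: the derivatives
  of its two sides may be equated.\<close>

lemma has_derivative_unique_on_open:
  assumes "(f has_derivative f') (at x)" "(g has_derivative g') (at x)"
    "open S" "x \<in> S" "\<And>x. x \<in> S \<Longrightarrow> f x = g x"
  shows "f' = g'"
  using has_derivative_transform_within_open[OF assms(1,3,4,5)] assms(2) has_derivative_unique by blast

text \<open>Differentiate \<open>eq\<close> along the fibre with \<open>u\<close> frozen at
  \<open>y\<close>. The product rule gives \<open>p y \<bullet> B y v + P v \<bullet> B y y\<close>,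
  and by symmetry and \<open>eq\<close> the first term is \<open>q y \<bullet> v\<close>.\<close>

lemma spray_of_parallel:
  fixes p q :: "'v::euclidean_space \<Rightarrow> 'v"
  assumes V: "open V" "y \<in> V" and B: "bilinear B" and sym: "\<And>u v. B u v = B v u"
    and P: "(p has_derivative P) (at y)" and Q: "(q has_derivative Q) (at y)"
    and eq: "\<And>y u. y \<in> V \<Longrightarrow> q y \<bullet> u = p y \<bullet> B u y"
  shows "Q v \<bullet> y - q y \<bullet> v = P v \<bullet> B y y"
proof -
  have "((\<lambda>y'. q y' \<bullet> y) has_derivative (\<lambda>v. Q v \<bullet> y)) (at y)"
    by (rule has_derivative_inner_left[OF Q])
  moreover have "((\<lambda>y'. p y' \<bullet> B y y') has_derivative (\<lambda>v. p y \<bullet> B y v + P v \<bullet> B y y)) (at y)"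
    by (rule has_derivative_inner[OF P has_derivative_bilinear_apply(1)[OF B]])
  ultimately have "(\<lambda>v. Q v \<bullet> y) = (\<lambda>v. p y \<bullet> B y v + P v \<bullet> B y y)"
    by (rule has_derivative_unique_on_open[OF _ _ V]) (rule eq)
  then have "Q v \<bullet> y = p y \<bullet> B y v + P v \<bullet> B y y" by metis
  then show ?thesis using eq[OF V(2), of v] sym[of y v] by simp
qed

text \<open>Contracting the defect \<open>q y \<bullet> u - p y \<bullet> B u y\<close> with
  \<open>u = y\<close> gives \<open>W\<close>. By the spray equation the derivative of
  \<open>W\<close> is twice the defect, while at \<open>v = y\<close> the Euler identities
  \<open>homP\<close> and \<open>homQ\<close> turn the same equation into
  \<open>W = 0\<close>.\<close>

lemma parallel_of_spray:
  fixes p q :: "'v::euclidean_space \<Rightarrow> 'v"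
  assumes V: "open V" and B: "bilinear B" and sym: "\<And>u v. B u v = B v u"
    and P: "\<And>y. y \<in> V \<Longrightarrow> (p has_derivative P y) (at y)" and Q: "\<And>y. y \<in> V \<Longrightarrow> (q has_derivative Q y) (at y)"
    and homP: "\<And>y. y \<in> V \<Longrightarrow> P y y = p y" and homQ: "\<And>y. y \<in> V \<Longrightarrow> Q y y = 2 *\<^sub>R q y"
    and eq: "\<And>y v. y \<in> V \<Longrightarrow> Q y v \<bullet> y - q y \<bullet> v = P y v \<bullet> B y y"
    and y: "y \<in> V"
  shows "q y \<bullet> u = p y \<bullet> B u y"
proof -
  define W where "W y = q y \<bullet> y - p y \<bullet> B y y" for y
  have D: "(W has_derivative (\<lambda>v. 2 * (q y \<bullet> v - p y \<bullet> B v y))) (at y)" if y: "y \<in> V" for y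
  proof -
    have "(W has_derivative (\<lambda>v. (q y \<bullet> v + Q y v \<bullet> y) - (p y \<bullet> (B y v + B v y) + P y v \<bullet> B y y))) (at y)"
      unfolding W_def
      by (intro has_derivative_diff has_derivative_inner Q[OF y] P[OF y] has_derivative_ident has_derivative_bilinear_apply(2)[OF B])
    moreover have "(q y \<bullet> v + Q y v \<bullet> y) - (p y \<bullet> (B y v + B v y) + P y v \<bullet> B y y) = 2 * (q y \<bullet> v - p y \<bullet> B v y)" for v
      using eq[OF y, of v] sym[of y v] by (simp add: inner_right_distrib)
    ultimately show ?thesis by simp
  qed
  have W0: "W y = 0" if y: "y \<in> V" for y
    using eq[OF y, of y] by (simp add: W_def homP[OF y] homQ[OF y])
  have "(\<lambda>v. 2 * (q y \<bullet> v - p y \<bullet> B v y)) = (\<lambda>v. 0)"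
    by (rule has_derivative_unique_on_open[OF D[OF y] has_derivative_const V y]) (simp add: W0)
  then have "2 * (q y \<bullet> u - p y \<bullet> B u y) = 0" by metis
  then show ?thesis by simp
qed

text \<open>Polarisation by derivatives: differentiating \<open>B y y = 0\<close> gives
  \<open>B w y = 0\<close> for \<open>y\<close> in \<open>V\<close>, and differentiating once more
  in \<open>y\<close> frees the second argument.\<close>

lemma symmetric_bilinear_eq_0:
  fixes B :: "'v::euclidean_space \<Rightarrow> 'v \<Rightarrow> 'v"
  assumes B: "bilinear B" and sym: "\<And>u v. B u v = B v u"
    and V: "open V" "y \<in> V" and 0: "\<And>y. y \<in> V \<Longrightarrow> B y y = 0"
  shows "B u v = 0"
proof -
  interpret bounded_bilinear B using B by (simp add: bilinear_conv_bounded_bilinear)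
  have D: "(\<lambda>v. B y v + B v y) = (\<lambda>v. 0)" if "y \<in> V" for y
    by (rule has_derivative_unique_on_open[OF has_derivative_bilinear_apply(2)[OF B] has_derivative_const V(1) that]) (rule 0)
  have E: "B w y = 0" if "y \<in> V" for w y
  proof -
    have "B y w + B w y = 0" using D[OF that] by meson
    then have "2 *\<^sub>R B w y = 0" by (simp add: sym[of y w] scaleR_2)
    then show ?thesis by simp
  qed
  have "B u = (\<lambda>v. 0)"
    by (rule has_derivative_unique_on_open[OF has_derivative_bilinear_apply(1)[OF B] has_derivative_const V]) (rule E)
  then show ?thesis by metis
qed

text \<open>\<open>B\<close> stands for the difference of two symmetric connections compatible with
  one Lagrangian. Then \<open>spray_of_parallel\<close> with zero base gradient makes
  \<open>B y y\<close> orthogonal to the range of the fibre Hessian \<open>P y\<close>, which is the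
  whole space.\<close>

lemma parallel_unique:
  fixes p :: "'v::euclidean_space \<Rightarrow> 'v"
  assumes V: "open V" "y0 \<in> V" and B: "bilinear B" and sym: "\<And>u v. B u v = B v u"
    and P: "\<And>y. y \<in> V \<Longrightarrow> (p has_derivative P y) (at y)" and surj: "\<And>y. y \<in> V \<Longrightarrow> surj (P y)"
    and eq: "\<And>y u. y \<in> V \<Longrightarrow> p y \<bullet> B u y = 0"
  shows "B u v = 0"
proof (rule symmetric_bilinear_eq_0[OF B sym V])
  fix y assume y: "y \<in> V"
  \<comment> \<open>For this \<open>v\<close> the orthogonality relation reads
    \<open>B y y \<bullet> B y y = 0\<close>.\<close>
  obtain v where v: "P y v = B y y" using surj[OF y] by (metis surjD)
  have "(0::'v) \<bullet> y - 0 \<bullet> v = P y v \<bullet> B y y"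
    by (rule spray_of_parallel[where q = "\<lambda>_. 0" and Q = "\<lambda>_. 0", OF V(1) y B sym P[OF y] has_derivative_const])
      (simp add: eq)
  then show "B y y = 0" by (simp add: v)
qed


section \<open>Finsler metrics in one chart\<close>

definition conn :: "real^'n^'n^'n \<Rightarrow> real^'n \<Rightarrow> real^'n \<Rightarrow> real^'n::finite" where
  "conn G u v = (\<chi> k. \<Sum>i\<in>UNIV. \<Sum>j\<in>UNIV. G $ k $ i $ j * u $ i * v $ j)"

definition gradx :: "((real^'n) \<times> (real^'n) \<Rightarrow> real) \<Rightarrow> (real^'n) \<times> (real^'n) \<Rightarrow> real^'n::finite" where
  "gradx L z = (\<chi> i. pdx i L z)"

definition grady :: "((real^'n) \<times> (real^'n) \<Rightarrow> real) \<Rightarrow> (real^'n) \<times> (real^'n) \<Rightarrow> real^'n::finite" where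
  "grady L z = (\<chi> i. pdy i L z)"

text \<open>The horizontal derivatives \<open>\<partial>\<^sub>i L - G\<^sup>k\<^sub>i\<^sub>j y\<^sup>j \<partial>L/\<partial>y\<^sup>k\<close> vanish at \<open>z = (x, y)\<close>.\<close>

definition parallel_at :: "real^'n^'n^'n \<Rightarrow> ((real^'n) \<times> (real^'n) \<Rightarrow> real) \<Rightarrow> (real^'n) \<times> (real^'n::finite) \<Rightarrow> bool" where
  "parallel_at G L z \<longleftrightarrow> (\<forall>u. frechet_derivative L (at z) (u, - conn G u (snd z)) = 0)"

definition symmetric_conn :: "real^'n^'n^'n::finite \<Rightarrow> bool" where
  "symmetric_conn G \<longleftrightarrow> (\<forall>k i j. G $ k $ i $ j = G $ k $ j $ i)"

lemma bilinear_conn: "bilinear (conn G)"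
  unfolding bilinear_def
  by (intro conjI allI linearI)
    (simp_all add: conn_def vec_eq_iff algebra_simps sum.distrib sum_distrib_left)

lemma conn_commute: "symmetric_conn G \<Longrightarrow> conn G u v = conn G v u"
  unfolding conn_def symmetric_conn_def vec_eq_iff
  by (subst sum.swap) (simp add: ac_simps)

lemma conn_axis: "conn G (axis i 1) v $ k = (\<Sum>j\<in>UNIV. G $ k $ i $ j * v $ j)"
proof -
  have "conn G (axis i 1) v $ k = (\<Sum>i'\<in>UNIV. if i' = i then \<Sum>j\<in>UNIV. G $ k $ i' $ j * v $ j else 0)"
    unfolding conn_def vec_lambda_beta by (rule sum.cong[OF refl]) (simp add: axis_def)
  then show ?thesis by simp
qed

lemma conn_axis_axis: "conn G (axis i 1) (axis j 1) $ k = G $ k $ i $ j"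
  unfolding conn_axis by (simp add: axis_def if_distrib cong: if_cong)

lemma linear_expand_axis:
  fixes h :: "real^'n \<Rightarrow> 'b::real_vector"
  assumes "linear h" shows "h u = (\<Sum>i\<in>UNIV. u $ i *\<^sub>R h (axis i 1))"
proof -
  have "h u = h (\<Sum>i\<in>UNIV. u $ i *s axis i 1)" by (simp add: basis_expansion)
  also have "\<dots> = (\<Sum>i\<in>UNIV. u $ i *\<^sub>R h (axis i 1))"
    by (simp add: linear_sum[OF assms] linear_scale[OF assms] scalar_mult_eq_scaleR)
  finally show ?thesis .
qed

lemma frechet_derivative_linear: "f differentiable (at x) \<Longrightarrow> linear (frechet_derivative f (at x))"
  using frechet_derivative_works has_derivative_linear by blast

lemma frechet_x_grad:
  assumes "L differentiable (at z)" shows "frechet_derivative L (at z) (u, 0) = gradx L z \<bullet> u"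
proof -
  note l = frechet_derivative_linear[OF assms]
  have "linear (\<lambda>u. frechet_derivative L (at z) (u, 0))"
    using linear_compose[of "\<lambda>u. (u, 0)", OF linearI l] by (simp add: o_def)
  from linear_expand_axis[OF this, of u] show ?thesis
    by (simp add: gradx_def pdx_def inner_vec_def mult.commute)
qed

lemma frechet_y_grad:
  assumes "L differentiable (at z)" shows "frechet_derivative L (at z) (0, w) = grady L z \<bullet> w"
proof -
  note l = frechet_derivative_linear[OF assms]
  have "linear (\<lambda>u. frechet_derivative L (at z) (0, u))"
    using linear_compose[of "\<lambda>u. (0, u)", OF linearI l] by (simp add: o_def)
  from linear_expand_axis[OF this, of w] show ?thesis
    by (simp add: grady_def pdy_def inner_vec_def mult.commute)
qed

lemma frechet_split:
  assumes "L differentiable (at z)"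
  shows "frechet_derivative L (at z) (u, w) = frechet_derivative L (at z) (u, 0) + frechet_derivative L (at z) (0, w)"
  using linear_add[OF frechet_derivative_linear[OF assms], of "(u, 0)" "(0, w)"] by simp

lemma parallel_at_iff:
  assumes "L differentiable (at z)"
  shows "parallel_at G L z \<longleftrightarrow> (\<forall>u. gradx L z \<bullet> u = grady L z \<bullet> conn G u (snd z))"
proof -
  have "frechet_derivative L (at z) (u, - w) = gradx L z \<bullet> u - grady L z \<bullet> w" for u w
    using frechet_split[OF assms, of u "- w"] frechet_x_grad[OF assms, of u] frechet_y_grad[OF assms, of "- w"]
    by simp
  then show ?thesis unfolding parallel_at_def by simp
qed

lemma has_derivative_y_slice:
  assumes "k differentiable (at (x, y))"
  shows "((\<lambda>y. k (x, y)) has_derivative (\<lambda>v. frechet_derivative k (at (x, y)) (0, v))) (at y)"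
proof -
  have "((\<lambda>y. (x, y)) has_derivative (\<lambda>v. (0, v))) (at y)"
    by (auto intro!: derivative_eq_intros)
  moreover have "(k has_derivative frechet_derivative k (at (x, y))) (at (x, y))"
    using assms frechet_derivative_works by blast
  ultimately show ?thesis using has_derivative_compose[of "\<lambda>y. (x, y)"] by blast
qed

lemma has_derivative_x_slice:
  assumes "k differentiable (at (x, y))"
  shows "((\<lambda>x. k (x, y)) has_derivative (\<lambda>v. frechet_derivative k (at (x, y)) (v, 0))) (at x)"
proof -
  have "((\<lambda>x. (x, y)) has_derivative (\<lambda>v. (v, 0))) (at x)"
    by (auto intro!: derivative_eq_intros)
  moreover have "(k has_derivative frechet_derivative k (at (x, y))) (at (x, y))"
    using assms frechet_derivative_works by blast
  ultimately show ?thesis using has_derivative_compose[of "\<lambda>x. (x, y)"] by blast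
qed

lemma has_derivative_vec_lambda:
  fixes f :: "'n::finite \<Rightarrow> 'a::real_normed_vector \<Rightarrow> real"
  assumes "\<And>i. (f i has_derivative f' i) (at x)"
  shows "((\<lambda>x. \<chi> i. f i x) has_derivative (\<lambda>v. \<chi> i. f' i v)) (at x)"
proof -
  have e: "(\<Sum>i\<in>UNIV. axis i (h i)) = (\<chi> i. h i)" for h :: "'n \<Rightarrow> real"
    by (simp add: vec_eq_iff axis_def if_distrib cong: if_cong)
  have "((\<lambda>x. \<Sum>i\<in>UNIV. axis i (f i x)) has_derivative (\<lambda>v. \<Sum>i\<in>UNIV. axis i (f' i v) :: real^'n)) (at x)"
    by (intro has_derivative_sum bounded_linear.has_derivative[OF bounded_linear_axis] assms)
  then show ?thesis by (simp add: e)
qed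

lemma smooth_on_pdx: "smooth_on W L \<Longrightarrow> smooth_on W (pdx i L)"
  using smooth_on_frechet[of W L "(axis i 1, 0)"] by (simp add: pdx_def[abs_def])

lemma smooth_on_pdy: "smooth_on W L \<Longrightarrow> smooth_on W (pdy i L)"
  using smooth_on_frechet[of W L "(0, axis i 1)"] by (simp add: pdy_def[abs_def])

lemma pdx_pdy_commute: "open W \<Longrightarrow> smooth_on W L \<Longrightarrow> z \<in> W \<Longrightarrow> pdx i (pdy j L) z = pdy j (pdx i L) z"
  unfolding pdx_def[abs_def] pdy_def[abs_def] by (rule frechet_derivative_commute)

lemma pdy_pdy_commute: "open W \<Longrightarrow> smooth_on W L \<Longrightarrow> z \<in> W \<Longrightarrow> pdy i (pdy j L) z = pdy j (pdy i L) z"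
  unfolding pdx_def[abs_def] pdy_def[abs_def] by (rule frechet_derivative_commute)

section \<open>Homogeneity in the fibre coordinates and Euler's identity\<close>

definition pos_homogeneous :: "((real^'n) \<times> (real^'n)) set \<Rightarrow> nat \<Rightarrow> ((real^'n) \<times> (real^'n::finite) \<Rightarrow> real) \<Rightarrow> bool" where
  "pos_homogeneous W n k \<longleftrightarrow>
     (\<forall>x y r. (x, y) \<in> W \<longrightarrow> r > 0 \<longrightarrow> (x, r *\<^sub>R y) \<in> W \<and> k (x, r *\<^sub>R y) = r ^ n * k (x, y))"

text \<open>Both sides are derivatives at \<open>r = 1\<close> of \<open>k\<close> along the ray
  through \<open>y\<close>, one by the chain rule and one by homogeneity.\<close>

lemma euler_homogeneous:
  assumes "pos_homogeneous W n k" and xy: "(x, y) \<in> W" and d: "k differentiable (at (x, y))"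
  shows "frechet_derivative k (at (x, y)) (0, y) = real n * k (x, y)"
proof -
  have "((\<lambda>r. r *\<^sub>R y) has_derivative (\<lambda>r. r *\<^sub>R y)) (at 1)"
    by (auto intro!: derivative_eq_intros)
  moreover have "((\<lambda>y. k (x, y)) has_derivative (\<lambda>v. frechet_derivative k (at (x, y)) (0, v))) (at (1 *\<^sub>R y))"
    using has_derivative_y_slice[OF d] by simp
  ultimately have 1: "((\<lambda>r. k (x, r *\<^sub>R y)) has_derivative (\<lambda>r. frechet_derivative k (at (x, y)) (0, r *\<^sub>R y))) (at 1)"
    by (rule has_derivative_compose)
  have 2: "((\<lambda>r::real. r ^ n * k (x, y)) has_derivative (\<lambda>r. r * (real n * k (x, y)))) (at 1)"
    by (auto intro!: derivative_eq_intros)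
  have "(\<lambda>r. frechet_derivative k (at (x, y)) (0, r *\<^sub>R y)) = (\<lambda>r. r * (real n * k (x, y)))"
    by (rule has_derivative_unique_on_open[OF 1 2, of "{0<..}"])
      (use assms in \<open>auto simp: pos_homogeneous_def\<close>)
  from fun_cong[OF this, of 1] show ?thesis by simp
qed

text \<open>Chain rule through the dilation of the fibre by \<open>r\<close>. Base directions keep
  the degree, while fibre directions, being dilated too, lose one; the next two lemmas read this
  off.\<close>

lemma frechet_homogeneous:
  assumes W: "open W" and h: "pos_homogeneous W n k" and k: "smooth_on W k" and xy: "(x, y) \<in> W" and r: "r > 0"
  shows "frechet_derivative k (at (x, r *\<^sub>R y)) (u, r *\<^sub>R v) = r ^ n * frechet_derivative k (at (x, y)) (u, v)"
proof -
  let ?s = "\<lambda>z::(real^'n)\<times>(real^'n). (fst z, r *\<^sub>R snd z)"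
  have "(?s has_derivative ?s) (at (x, y))" by (auto intro!: derivative_eq_intros)
  moreover have "(k has_derivative frechet_derivative k (at (x, r *\<^sub>R y))) (at (?s (x, y)))"
    using smooth_on_has_derivative[OF k] h xy r by (auto simp: pos_homogeneous_def)
  ultimately have 1: "((\<lambda>z. k (?s z)) has_derivative (\<lambda>v. frechet_derivative k (at (x, r *\<^sub>R y)) (?s v))) (at (x, y))"
    by (rule has_derivative_compose)
  have 2: "((\<lambda>z. r ^ n * k z) has_derivative (\<lambda>v. r ^ n * frechet_derivative k (at (x, y)) v)) (at (x, y))"
    by (intro has_derivative_mult_right smooth_on_has_derivative[OF k xy])
  have "(\<lambda>v. frechet_derivative k (at (x, r *\<^sub>R y)) (?s v)) = (\<lambda>v. r ^ n * frechet_derivative k (at (x, y)) v)"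
    by (rule has_derivative_unique_on_open[OF 1 2 W xy]) (use h r in \<open>auto simp: pos_homogeneous_def\<close>)
  from fun_cong[OF this, of "(u, v)"] show ?thesis by simp
qed

lemma pos_homogeneous_pdx:
  assumes "open W" "smooth_on W k" "pos_homogeneous W n k"
  shows "pos_homogeneous W n (pdx i k)"
  using frechet_homogeneous[OF assms(1,3,2), where v = 0] assms(3)
  by (simp add: pos_homogeneous_def pdx_def)

lemma pos_homogeneous_pdy:
  assumes "open W" "smooth_on W k" "pos_homogeneous W (Suc n) k"
  shows "pos_homogeneous W n (pdy i k)"
  unfolding pos_homogeneous_def
proof (intro allI impI conjI)
  fix x y and r :: real assume xy: "(x, y) \<in> W" and r: "r > 0"
  show W: "(x, r *\<^sub>R y) \<in> W" using assms(3) xy r by (simp add: pos_homogeneous_def)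
  have "r * frechet_derivative k (at (x, r *\<^sub>R y)) (0, axis i 1) = frechet_derivative k (at (x, r *\<^sub>R y)) (r *\<^sub>R (0, axis i 1))"
    using linear_scale[OF frechet_derivative_linear[OF smooth_onD_differentiable[OF assms(2) W]], of r "(0, axis i 1)"]
    by simp
  also have "\<dots> = r ^ Suc n * frechet_derivative k (at (x, y)) (0, axis i 1)"
    using frechet_homogeneous[OF assms(1,3,2) xy r, of 0 "axis i 1"] by simp
  finally show "pdy i k (x, r *\<^sub>R y) = r ^ n * pdy i k (x, y)"
    using r by (simp add: pdy_def)
qed

section \<open>The spray and the nonlinear connection of a Finsler metric in a chart\<close>

locale finsler_chart =
  fixes W :: "((real^'n) \<times> (real^'n::finite)) set" and f :: "(real^'n) \<times> (real^'n) \<Rightarrow> real"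
  assumes open_W: "open W" and smooth_f: "smooth_on W f" and hom_f: "pos_homogeneous W 1 f"
    and inv_g: "z \<in> W \<Longrightarrow> invertible (fundamental_tensor f z)"
begin

definition L where "L z = (f z)\<^sup>2"

text \<open>The Euler-Lagrange expression of \<open>L\<close> without its acceleration term
  \<open>2 g x''\<close>, that is, the spray with its index lowered.\<close>

definition H where "H z = (\<chi> k. (\<Sum>m\<in>UNIV. snd z $ m * pdx m (pdy k L) z) - pdx k L z)"

text \<open>Four times the usual geodesic coefficients \<open>G\<close>, for which geodesics satisfy
  \<open>x'' + 2 G = 0\<close>.\<close>

definition spray where "spray k z = (\<Sum>l\<in>UNIV. matrix_inv (fundamental_tensor f z) $ k $ l * H z $ l)"

lemma smooth_L: "smooth_on W L"
proof -
  have "smooth_on W (\<lambda>z. f z * f z)" by (intro smooth_on_mult open_W smooth_f)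
  then show ?thesis by (simp add: L_def[abs_def] power2_eq_square)
qed

lemma diff_L: "z \<in> W \<Longrightarrow> L differentiable (at z)"
  by (rule smooth_onD_differentiable[OF smooth_L])

lemma hom_L: "pos_homogeneous W 2 L"
  using hom_f by (simp add: pos_homogeneous_def L_def power_mult_distrib)

lemma g_nth: "fundamental_tensor f z $ i $ j = 1/2 * pdy i (pdy j L) z"
  by (simp add: fundamental_tensor_def L_def[abs_def])

lemma nonlinear_connection_spray: "nonlinear_connection f k i z = 1/4 * pdy i (spray k) z"
  by (simp add: nonlinear_connection_def spray_def[abs_def] H_def L_def[abs_def] Let_def)

lemmas open_slice = open_slice_y[OF open_W]

lemma frechet_pdy_L:
  assumes z: "z \<in> W"
  shows "(\<chi> k. frechet_derivative (pdy k L) (at z) (0, v)) = 2 *\<^sub>R (fundamental_tensor f z *v v)"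
proof -
  have "frechet_derivative (pdy k L) (at z) (0, v) = (\<Sum>j\<in>UNIV. pdy k (pdy j L) z * v $ j)" for k
    using frechet_y_grad[OF smooth_onD_differentiable[OF smooth_on_pdy[OF smooth_L] z], of k v]
    by (simp add: grady_def inner_vec_def pdy_pdy_commute[OF open_W smooth_L z, of _ k])
  then show ?thesis
    by (simp add: vec_eq_iff matrix_vector_mult_def g_nth sum_distrib_left mult.assoc)
qed

lemma grady_L_derivative:
  assumes z: "(x, y) \<in> W"
  shows "((\<lambda>y. grady L (x, y)) has_derivative (\<lambda>v. 2 *\<^sub>R (fundamental_tensor f (x, y) *v v))) (at y)"
proof -
  have "((\<lambda>y. grady L (x, y)) has_derivative (\<lambda>v. \<chi> k. frechet_derivative (pdy k L) (at (x, y)) (0, v))) (at y)"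
    unfolding grady_def
    by (intro has_derivative_vec_lambda has_derivative_y_slice smooth_onD_differentiable[OF smooth_on_pdy[OF smooth_L] z])
  then show ?thesis by (simp add: frechet_pdy_L[OF z])
qed

lemma gradx_L_derivative:
  assumes z: "(x, y) \<in> W"
  shows "((\<lambda>y. gradx L (x, y)) has_derivative (\<lambda>v. \<chi> k. frechet_derivative (pdx k L) (at (x, y)) (0, v))) (at y)"
  unfolding gradx_def
  by (intro has_derivative_vec_lambda has_derivative_y_slice smooth_onD_differentiable[OF smooth_on_pdx[OF smooth_L] z])

text \<open>Nondegeneracy of the fibre Hessian \<open>2 g\<close>, in the form that
  \<open>parallel_unique\<close> takes.\<close>

lemma surj_g:
  assumes "z \<in> W" shows "surj (\<lambda>v. 2 *\<^sub>R (fundamental_tensor f z *v v))"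
proof (rule surjI)
  fix w
  have "2 *\<^sub>R (fundamental_tensor f z *v ((1/2) *\<^sub>R (matrix_inv (fundamental_tensor f z) *v w))) = 
     fundamental_tensor f z *v (matrix_inv (fundamental_tensor f z) *v w)"
    by (simp add: matrix_vector_mult_scaleR)
  then show "2 *\<^sub>R (fundamental_tensor f z *v ((1/2) *\<^sub>R (matrix_inv (fundamental_tensor f z) *v w))) = w"
    by (simp add: matrix_vector_mul_assoc matrix_inv_right_left[OF inv_g[OF assms]])
qed

text \<open>Exchanging base and fibre derivatives turns the sum in \<open>H\<close> into a fibre
  derivative of \<open>gradx L\<close>. This links \<open>H\<close> to the spray equation of the two
  fibre lemmas.\<close>

lemma H_inner:
  assumes z: "(x, y) \<in> W"
  shows "H (x, y) \<bullet> v = (\<chi> k. frechet_derivative (pdx k L) (at (x, y)) (0, v)) \<bullet> y - gradx L (x, y) \<bullet> v"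
proof -
  have "(\<chi> k. frechet_derivative (pdx k L) (at (x, y)) (0, v)) \<bullet> y
      = (\<Sum>m\<in>UNIV. \<Sum>k\<in>UNIV. pdx m (pdy k L) (x, y) * v $ k * y $ m)"
    using frechet_y_grad[OF smooth_onD_differentiable[OF smooth_on_pdx[OF smooth_L] z]]
    by (simp add: inner_vec_def grady_def pdx_pdy_commute[OF open_W smooth_L z] sum_distrib_right)
  also have "\<dots> = (\<Sum>k\<in>UNIV. (\<Sum>m\<in>UNIV. y $ m * pdx m (pdy k L) (x, y)) * v $ k)"
    by (subst sum.swap) (simp add: sum_distrib_left sum_distrib_right ac_simps)
  finally show ?thesis
    by (simp add: H_def gradx_def inner_vec_def left_diff_distrib sum_subtractf)
qed

lemma g_symmetric:
  assumes z: "z \<in> W" shows "(fundamental_tensor f z *v v) \<bullet> w = v \<bullet> (fundamental_tensor f z *v w)"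
proof -
  have "transpose (fundamental_tensor f z) = fundamental_tensor f z"
    by (simp add: vec_eq_iff transpose_def g_nth pdy_pdy_commute[OF open_W smooth_L z])
  then show ?thesis by (metis dot_lmul_matrix inner_commute transpose_matrix_vector)
qed

lemma spray_eq_mult: "(\<chi> k. spray k z) = matrix_inv (fundamental_tensor f z) *v H z"
  by (simp add: spray_def vec_eq_iff matrix_vector_mult_def)

text \<open>Since \<open>g\<close> is symmetric, \<open>v\<close> can be moved to the outside; being
  arbitrary, it leaves \<open>H z = 2 g w\<close>, and inverting \<open>g\<close> turns
  \<open>H\<close> into the spray.\<close>

lemma H_iff_spray:
  assumes z: "z \<in> W"
  shows "(\<forall>v. H z \<bullet> v = (2 *\<^sub>R (fundamental_tensor f z *v v)) \<bullet> w) \<longleftrightarrow> (\<forall>k. spray k z = 2 * w $ k)"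
proof -
  let ?g = "fundamental_tensor f z"
  have "(2 *\<^sub>R (?g *v v)) \<bullet> w = (2 *\<^sub>R (?g *v w)) \<bullet> v" for v
    using g_symmetric[OF z, of v w] by (simp add: inner_commute)
  then have "(\<forall>v. H z \<bullet> v = (2 *\<^sub>R (?g *v v)) \<bullet> w) \<longleftrightarrow> (\<forall>v. H z \<bullet> v = (2 *\<^sub>R (?g *v w)) \<bullet> v)"
    by simp
  also have "\<dots> \<longleftrightarrow> H z = 2 *\<^sub>R (?g *v w)" by (metis vector_eq_rdot)
  also have "\<dots> \<longleftrightarrow> matrix_inv ?g *v H z = 2 *\<^sub>R w"
  proof
    assume "H z = 2 *\<^sub>R (?g *v w)"
    then show "matrix_inv ?g *v H z = 2 *\<^sub>R w"
      by (simp add: matrix_vector_mult_scaleR matrix_vector_mul_assoc matrix_inv_right_left[OF inv_g[OF z]])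
  next
    assume "matrix_inv ?g *v H z = 2 *\<^sub>R w"
    then have "?g *v (matrix_inv ?g *v H z) = ?g *v (2 *\<^sub>R w)" by simp
    then show "H z = 2 *\<^sub>R (?g *v w)"
      by (simp add: matrix_vector_mult_scaleR matrix_vector_mul_assoc matrix_inv_right_left[OF inv_g[OF z]])
  qed
  also have "\<dots> \<longleftrightarrow> (\<forall>k. spray k z = 2 * w $ k)"
    unfolding spray_eq_mult[symmetric] by (simp add: vec_eq_iff)
  finally show ?thesis .
qed

lemma smooth_H: "smooth_on W (\<lambda>z. H z $ k)"
proof -
  have "bounded_linear (\<lambda>z::(real^'n)\<times>(real^'n). snd z $ m)" for m
    using bounded_linear_compose[OF bounded_linear_vec_nth bounded_linear_snd] .
  then show ?thesis
    unfolding H_def vec_lambda_beta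
    by (intro smooth_on_diff smooth_on_sum smooth_on_mult open_W smooth_on_pdx smooth_on_pdy smooth_L smooth_on_bounded_linear)
qed

lemma smooth_spray: "smooth_on W (spray k)"
proof -
  have "smooth_on W (\<lambda>z. fundamental_tensor f z $ i $ j)" for i j
    unfolding g_nth by (intro smooth_on_mult open_W smooth_on_const smooth_on_pdy smooth_L)
  then show ?thesis
    unfolding spray_def[abs_def]
    by (intro smooth_on_sum smooth_on_mult open_W smooth_on_matrix_inv smooth_H inv_g)
qed

text \<open>Degree count: \<open>L\<close> has degree two, so \<open>g\<close> has degree zero and
  both terms of \<open>H\<close> have degree two.\<close>

lemma hom_spray: "pos_homogeneous W 2 (spray k)"
proof -
  have hp: "pos_homogeneous W 1 (pdy k L)" for k
    using pos_homogeneous_pdy[OF open_W smooth_L, of 1] hom_L by (simp add: numeral_2_eq_2)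
  have hpp: "pos_homogeneous W 0 (pdy j (pdy k L))" for j k
    using pos_homogeneous_pdy[OF open_W smooth_on_pdy[OF smooth_L], of 0] hp by simp
  have hpx: "pos_homogeneous W 1 (pdx j (pdy k L))" for j k
    using pos_homogeneous_pdx[OF open_W smooth_on_pdy[OF smooth_L] hp] .
  have hx: "pos_homogeneous W 2 (pdx k L)" for k
    using pos_homogeneous_pdx[OF open_W smooth_L hom_L] .
  show ?thesis
    unfolding pos_homogeneous_def
  proof (intro allI impI conjI)
    fix x y and r :: real assume xy: "(x, y) \<in> W" and r: "r > 0"
    show W: "(x, r *\<^sub>R y) \<in> W" using hom_f xy r by (simp add: pos_homogeneous_def)
    have g: "fundamental_tensor f (x, r *\<^sub>R y) = fundamental_tensor f (x, y)"
      using hpp xy r by (simp add: vec_eq_iff g_nth pos_homogeneous_def)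
    have "H (x, r *\<^sub>R y) $ l = r\<^sup>2 * H (x, y) $ l" for l
      using hpx hx xy r
      by (simp add: H_def pos_homogeneous_def sum_distrib_left right_diff_distrib power2_eq_square algebra_simps)
    then show "spray k (x, r *\<^sub>R y) = r\<^sup>2 * spray k (x, y)"
      by (simp add: spray_def g sum_distrib_left algebra_simps)
  qed
qed

lemma spray_of_parallel_at:
  assumes sym: "symmetric_conn G" and par: "\<And>y. (x, y) \<in> W \<Longrightarrow> parallel_at G L (x, y)" and z: "(x, y) \<in> W"
  shows "spray k (x, y) = 2 * conn G y y $ k"
proof -
  have "(\<chi> k. frechet_derivative (pdx k L) (at (x, y)) (0, v)) \<bullet> y - gradx L (x, y) \<bullet> v
      = (2 *\<^sub>R (fundamental_tensor f (x, y) *v v)) \<bullet> conn G y y" for v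
    by (rule spray_of_parallel[OF open_slice[of x] _ bilinear_conn conn_commute[OF sym] grady_L_derivative[OF z] gradx_L_derivative[OF z]])
      (use par z in \<open>auto simp: parallel_at_iff diff_L\<close>)
  then show ?thesis
    using H_iff_spray[OF z, of "conn G y y"] H_inner[OF z] by simp
qed

text \<open>By symmetry of \<open>G\<close>, the fibre derivative of the spray
  \<open>2 * conn G y y\<close> along \<open>axis i 1\<close> is
  \<open>4 * conn G (axis i 1) y\<close>; the 4 cancels the normalising factor 1/4.\<close>

lemma nonlinear_connection_of_parallel_at:
  assumes sym: "symmetric_conn G" and par: "\<And>y. (x, y) \<in> W \<Longrightarrow> parallel_at G L (x, y)" and z: "(x, y) \<in> W"
  shows "nonlinear_connection f k i (x, y) = (\<Sum>j\<in>UNIV. G $ k $ i $ j * y $ j)"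
proof -
  have "((\<lambda>y. 2 * (conn G y y $ k)) has_derivative (\<lambda>v. 2 * ((conn G y v + conn G v y) $ k))) (at y)"
    using has_derivative_mult_right[OF bounded_linear.has_derivative[OF bounded_linear_vec_nth[of k]
        has_derivative_bilinear_apply(2)[OF bilinear_conn, of G y]], of 2] .
  with has_derivative_y_slice[OF smooth_onD_differentiable[OF smooth_spray z]]
  have "(\<lambda>v. frechet_derivative (spray k) (at (x, y)) (0, v)) = (\<lambda>v. 2 * ((conn G y v + conn G v y) $ k))"
    by (rule has_derivative_unique_on_open[OF _ _ open_slice[of x]])
      (use spray_of_parallel_at[OF sym par] z in auto)
  from fun_cong[OF this, of "axis i 1"] show ?thesis
    by (simp add: nonlinear_connection_spray pdy_def conn_commute[OF sym, of y] conn_axis)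
qed

section \<open>From a fibrewise linear nonlinear connection to a parallel Lagrangian\<close>

context
  fixes x :: "real^'n" and G :: "real^'n^'n^'n"
  assumes N: "\<And>y k i. (x, y) \<in> W \<Longrightarrow> nonlinear_connection f k i (x, y) = (\<Sum>j\<in>UNIV. G $ k $ i $ j * y $ j)"
begin

text \<open>First fibre derivatives of the spray are four times the nonlinear connection, hence
  linear in \<open>y\<close> by \<open>N\<close>; one more derivative reads off the
  coefficients.\<close>

lemma pdy_pdy_spray:
  assumes z: "(x, y) \<in> W" shows "pdy j (pdy i (spray k)) (x, y) = 4 * G $ k $ i $ j"
proof -
  have "((\<lambda>y. 4 * (conn G (axis i 1) y $ k)) has_derivative (\<lambda>v. 4 * (conn G (axis i 1) v $ k))) (at y)"
    using has_derivative_mult_right[OF bounded_linear.has_derivative[OF bounded_linear_vec_nth[of k]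
        has_derivative_bilinear_apply(1)[OF bilinear_conn, of G "axis i 1" y]], of 4] .
  with has_derivative_y_slice[OF smooth_onD_differentiable[OF smooth_on_pdy[OF smooth_spray] z]]
  have "(\<lambda>v. frechet_derivative (pdy i (spray k)) (at (x, y)) (0, v)) = (\<lambda>v. 4 * (conn G (axis i 1) v $ k))"
    by (rule has_derivative_unique_on_open[OF _ _ open_slice[of x]])
      (use N z in \<open>auto simp: conn_axis nonlinear_connection_spray\<close>)
  from fun_cong[OF this, of "axis j 1"] show ?thesis
    by (simp add: pdy_def conn_axis_axis)
qed

text \<open>The entries of \<open>4 G\<close> are second fibre derivatives of the spray, and these
  commute.\<close>

lemma symmetric_conn_of_nonlinear_connection:
  assumes z: "(x, y) \<in> W" shows "symmetric_conn G"
  unfolding symmetric_conn_def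
proof (intro allI)
  fix k i j
  show "G $ k $ i $ j = G $ k $ j $ i"
    using pdy_pdy_commute[OF open_W smooth_spray z, of j i k] by (simp add: pdy_pdy_spray[OF z])
qed

lemma parallel_at_of_nonlinear_connection:
  assumes z: "(x, y) \<in> W" shows "parallel_at G L (x, y)"
proof -
  note sym = symmetric_conn_of_nonlinear_connection[OF z]
  \<comment> \<open>Euler's identity in degree two recovers the spray from its fibre gradient, which
    \<open>N\<close> describes.\<close>
  have s: "spray k (x, y) = 2 * conn G y y $ k" if z: "(x, y) \<in> W" for k y
  proof -
    have "grady (spray k) (x, y) \<bullet> y = 2 * spray k (x, y)"
      using euler_homogeneous[OF hom_spray z smooth_onD_differentiable[OF smooth_spray z]]
        frechet_y_grad[OF smooth_onD_differentiable[OF smooth_spray z]] by simp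
    moreover have "pdy i (spray k) (x, y) = 4 * (\<Sum>j\<in>UNIV. G $ k $ i $ j * y $ j)" for i
      using N[OF z, of k i] by (simp add: nonlinear_connection_spray)
    then have "grady (spray k) (x, y) \<bullet> y = 4 * conn G y y $ k"
      by (simp add: grady_def inner_vec_def conn_def sum_distrib_left sum_distrib_right ac_simps)
    ultimately show ?thesis by simp
  qed
  have "gradx L (x, y) \<bullet> u = grady L (x, y) \<bullet> conn G u y" for u
  proof (rule parallel_of_spray[OF open_slice[of x] bilinear_conn conn_commute[OF sym],
        where P = "\<lambda>y v. 2 *\<^sub>R (fundamental_tensor f (x, y) *v v)"
          and Q = "\<lambda>y v. \<chi> k. frechet_derivative (pdx k L) (at (x, y)) (0, v)"])
    fix y assume y: "y \<in> {y. (x, y) \<in> W}"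
    then have z: "(x, y) \<in> W" by simp
    show "((\<lambda>y. grady L (x, y)) has_derivative (\<lambda>v. 2 *\<^sub>R (fundamental_tensor f (x, y) *v v))) (at y)"
      by (rule grady_L_derivative[OF z])
    show "((\<lambda>y. gradx L (x, y)) has_derivative (\<lambda>v. \<chi> k. frechet_derivative (pdx k L) (at (x, y)) (0, v))) (at y)"
      by (rule gradx_L_derivative[OF z])
    \<comment> \<open>Euler's identity, in degree one for the fibre gradient and in degree two for
      the base gradient, supplies \<open>homP\<close> and \<open>homQ\<close>.\<close>
    have "pos_homogeneous W 1 (pdy k L)" for k
      using pos_homogeneous_pdy[OF open_W smooth_L, of 1] hom_L by (simp add: numeral_2_eq_2)
    from euler_homogeneous[OF this z smooth_onD_differentiable[OF smooth_on_pdy[OF smooth_L] z]]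
    show "2 *\<^sub>R (fundamental_tensor f (x, y) *v y) = grady L (x, y)"
      unfolding frechet_pdy_L[OF z, symmetric] by (simp add: grady_def)
    from euler_homogeneous[OF pos_homogeneous_pdx[OF open_W smooth_L hom_L] z smooth_onD_differentiable[OF smooth_on_pdx[OF smooth_L] z]]
    show "(\<chi> k. frechet_derivative (pdx k L) (at (x, y)) (0, y)) = 2 *\<^sub>R gradx L (x, y)"
      by (simp add: gradx_def vec_eq_iff)
    fix v
    show "(\<chi> k. frechet_derivative (pdx k L) (at (x, y)) (0, v)) \<bullet> y - gradx L (x, y) \<bullet> v
        = (2 *\<^sub>R (fundamental_tensor f (x, y) *v v)) \<bullet> conn G y y"
      using H_iff_spray[OF z, of "conn G y y"] H_inner[OF z] s[OF z] by simp
  qed (use z in auto)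
  then show ?thesis using z by (simp add: parallel_at_iff diff_L)
qed

end

text \<open>\<open>N\<close> by itself says nothing on how \<open>G\<close> depends on
  \<open>x\<close>. But for a fixed fibre vector \<open>y\<close> the entries are second fibre
  derivatives of the smooth spray, restricted to the slice at \<open>y\<close>, which is open and
  contains the given point.\<close>

lemma smooth_of_nonlinear_connection:
  assumes N: "\<And>x y k i. (x, y) \<in> W \<Longrightarrow> nonlinear_connection f k i (x, y) = (\<Sum>j\<in>UNIV. G x $ k $ i $ j * y $ j)"
  shows "smooth_on (fst ` W) G"
proof (rule smooth_on_locally)
  fix x assume "x \<in> fst ` W"
  then obtain y where z: "(x, y) \<in> W" by auto
  let ?U = "{x. (x, y) \<in> W}"
  have U: "open ?U" by (rule open_slice_x[OF open_W])
  have "smooth_on ?U (\<lambda>x. G x $ k $ i $ j)" for k i j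
  proof -
    have "smooth_on ?U (\<lambda>x. 1/4 * pdy j (pdy i (spray k)) (x, y))"
      by (intro smooth_on_mult U smooth_on_const smooth_on_slice open_W smooth_on_pdy smooth_spray)
    then show ?thesis
      by (rule smooth_on_cong[OF _ U]) (simp add: pdy_pdy_spray[OF N])
  qed
  then have "smooth_on ?U G" by (intro smooth_on_vec U)
  then show "\<exists>U. x \<in> U \<and> open U \<and> smooth_on U G" using U z by (intro exI[of _ ?U]) simp
qed

text \<open>A zero of \<open>f\<close> is a critical point of its square \<open>L\<close>. By
  Euler's identity the fibre gradient of \<open>L\<close> is \<open>2 g y\<close>, so nondegeneracy
  would give \<open>y = 0\<close>.\<close>

lemma f_nonzero:
  assumes z: "(x, y) \<in> W" and "y \<noteq> 0" shows "f (x, y) \<noteq> 0"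
proof
  assume 0: "f (x, y) = 0"
  have "(L has_derivative (\<lambda>v. 2 * frechet_derivative f (at (x, y)) v * f (x, y))) (at (x, y))"
    unfolding L_def[abs_def]
    by (auto intro!: derivative_eq_intros smooth_on_has_derivative[OF smooth_f z])
  then have "frechet_derivative L (at (x, y)) = (\<lambda>v. 0)"
    using 0 frechet_derivative_at by fastforce
  then have p: "pdy k L (x, y) = 0" for k by (simp add: pdy_def)
  have "pos_homogeneous W 1 (pdy k L)" for k
    using pos_homogeneous_pdy[OF open_W smooth_L, of 1] hom_L by (simp add: numeral_2_eq_2)
  from euler_homogeneous[OF this z smooth_onD_differentiable[OF smooth_on_pdy[OF smooth_L] z]]
  have "2 *\<^sub>R (fundamental_tensor f (x, y) *v y) = 0"
    unfolding frechet_pdy_L[OF z, symmetric] by (simp add: p vec_eq_iff)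
  then have "matrix_inv (fundamental_tensor f (x, y)) *v (fundamental_tensor f (x, y) *v y) = 0" by simp
  then show False using \<open>y \<noteq> 0\<close>
    by (simp add: matrix_vector_mul_assoc matrix_inv_right_left[OF inv_g[OF z]])
qed

end


section \<open>Transformation of connections\<close>

lemma frechet_derivative_vec_nth:
  assumes "f differentiable (at x)"
  shows "frechet_derivative (\<lambda>x. f x $ l) (at x) v = frechet_derivative f (at x) v $ l"
proof -
  have "((\<lambda>x. f x $ l) has_derivative (\<lambda>v. frechet_derivative f (at x) v $ l)) (at x)"
    using assms frechet_derivative_works bounded_linear.has_derivative[OF bounded_linear_vec_nth] by blast
  then show ?thesis using frechet_derivative_at by metis
qed

lemma frechet_derivative_vec_nth2:
  assumes S: "open S" and f: "smooth_on S f" and x: "x \<in> S"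
  shows "frechet_derivative (\<lambda>x. frechet_derivative (\<lambda>x. f x $ l) (at x) v) (at x) u
    = frechet_derivative (\<lambda>x. frechet_derivative f (at x) v) (at x) u $ l"
proof -
  have "frechet_derivative (\<lambda>x. frechet_derivative (\<lambda>x. f x $ l) (at x) v) (at x) =
      frechet_derivative (\<lambda>x. frechet_derivative f (at x) v $ l) (at x)"
    by (rule frechet_derivative_transform_within_open[OF _ S x])
      (use smooth_onD_differentiable[OF smooth_on_frechet[OF smooth_on_vec_nth[OF S f]] x]
        frechet_derivative_vec_nth[OF smooth_onD_differentiable[OF f]] in auto)
  then show ?thesis
    using frechet_derivative_vec_nth[OF smooth_onD_differentiable[OF smooth_on_frechet[OF f] x]] by metis
qed

lemma frechet_derivative_commute_vec:
  fixes f :: "'a::real_normed_vector \<Rightarrow> real^'n::finite"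
  assumes S: "open S" and f: "smooth_on S f" and x: "x \<in> S"
  shows "frechet_derivative (\<lambda>x. frechet_derivative f (at x) v) (at x) u
    = frechet_derivative (\<lambda>x. frechet_derivative f (at x) u) (at x) v"
  using frechet_derivative_commute[OF S smooth_on_vec_nth[OF S f] x]
  by (simp add: vec_eq_iff frechet_derivative_vec_nth2[OF assms])

text \<open>The outer direction is linear as in any derivative; exchanging the order of
  differentiation transfers this to the inner direction.\<close>

lemma linear_second_frechet:
  fixes f :: "'a::real_normed_vector \<Rightarrow> real^'n::finite"
  assumes S: "open S" and f: "smooth_on S f" and x: "x \<in> S"
  shows "linear (\<lambda>u. frechet_derivative (\<lambda>x. frechet_derivative f (at x) v) (at x) u)"
    "linear (\<lambda>v. frechet_derivative (\<lambda>x. frechet_derivative f (at x) v) (at x) u)"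
proof -
  show *: "linear (\<lambda>u. frechet_derivative (\<lambda>x. frechet_derivative f (at x) v) (at x) u)" for v
    using frechet_derivative_linear[OF smooth_onD_differentiable[OF smooth_on_frechet[OF f] x]] by simp
  show "linear (\<lambda>v. frechet_derivative (\<lambda>x. frechet_derivative f (at x) v) (at x) u)"
    unfolding frechet_derivative_commute_vec[OF assms, of _ u] by (rule *)
qed

text \<open>Only one symmetric connection is compatible with a given Lagrangian, so pulling back one that
  is compatible in the target chart must give the one in the source chart.\<close>

lemma connection_transform:
  fixes \<tau> :: "real^'n \<Rightarrow> real^'n::finite" and L L' :: "(real^'n) \<times> (real^'n) \<Rightarrow> real"
  assumes S: "open S" and \<tau>: "smooth_on S \<tau>" and x: "x \<in> S" and inj: "inj (frechet_derivative \<tau> (at x))"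
    and W: "open W" and y0: "(x, y0) \<in> W"
    and L: "\<And>z. z \<in> W \<Longrightarrow> fst z \<in> S \<Longrightarrow> L z = L' (\<tau> (fst z), frechet_derivative \<tau> (at (fst z)) (snd z))"
    and dL: "\<And>y. (x, y) \<in> W \<Longrightarrow> L differentiable (at (x, y))"
    and dL': "\<And>y. (x, y) \<in> W \<Longrightarrow> L' differentiable (at (\<tau> x, frechet_derivative \<tau> (at x) y))"
    and P: "\<And>y. (x, y) \<in> W \<Longrightarrow> ((\<lambda>y. grady L (x, y)) has_derivative P y) (at y)"
    and surj: "\<And>y. (x, y) \<in> W \<Longrightarrow> surj (P y)"
    and G: "symmetric_conn G" and G': "symmetric_conn G'"
    and par: "\<And>y. (x, y) \<in> W \<Longrightarrow> parallel_at G L (x, y)"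
    and par': "\<And>y. (x, y) \<in> W \<Longrightarrow> parallel_at G' L' (\<tau> x, frechet_derivative \<tau> (at x) y)"
  shows "frechet_derivative \<tau> (at x) (conn G u v) =
    conn G' (frechet_derivative \<tau> (at x) u) (frechet_derivative \<tau> (at x) v)
    + frechet_derivative (\<lambda>x. frechet_derivative \<tau> (at x) v) (at x) u"
proof -
  define J where "J = frechet_derivative \<tau> (at x)"
  \<comment> \<open>The Hessian of the coordinate change, which is the inhomogeneous term of the
    transformation law.\<close>
  define D where "D u v = frechet_derivative (\<lambda>x. frechet_derivative \<tau> (at x) v) (at x) u" for u v
  have J: "linear J" unfolding J_def by (rule frechet_derivative_linear[OF smooth_onD_differentiable[OF \<tau> x]])
  obtain K where K: "linear K" "\<And>w. K (J w) = w" "\<And>w. J (K w) = w"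
    using linear_injective_isomorphism[OF J] inj unfolding J_def by metis
  have D_linear: "linear (\<lambda>u. D u v)" "linear (\<lambda>v. D u v)" for u v
    unfolding D_def by (rule linear_second_frechet[OF S \<tau> x])+
  have D_commute: "D u v = D v u" for u v
    unfolding D_def by (rule frechet_derivative_commute_vec[OF S \<tau> x])
  note bG = bilinear_conn[of G] and bG' = bilinear_conn[of G']
  \<comment> \<open>The pullback of \<open>G'\<close> minus \<open>G\<close>; once
    \<open>B = 0\<close> is known, applying \<open>J\<close> gives the claim.\<close>
  define B where "B u v = K (conn G' (J u) (J v) + D u v) - conn G u v" for u v
  have B: "bilinear B"
    unfolding bilinear_def B_def
    by (intro conjI allI linearI)
      (simp_all add: linear_add[OF J] linear_scale[OF J] linear_add[OF K(1)] linear_scale[OF K(1)]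
        linear_add[OF D_linear(1)] linear_add[OF D_linear(2)] linear_scale[OF D_linear(1)] linear_scale[OF D_linear(2)]
        bilinear_ladd[OF bG] bilinear_radd[OF bG] bilinear_lmul[OF bG] bilinear_rmul[OF bG]
        bilinear_ladd[OF bG'] bilinear_radd[OF bG'] bilinear_lmul[OF bG'] bilinear_rmul[OF bG'] algebra_simps)
  have B_commute: "B u v = B v u" for u v
    unfolding B_def conn_commute[OF G, of u v] conn_commute[OF G', of "J u" "J v"] D_commute[of u v] ..
  note oV = open_slice_y[OF W, of x]
  have oH: "open {x'. (x', y) \<in> W \<and> x' \<in> S}" for y
    using open_Int[OF open_slice_x[OF W, of y] S] by (simp add: Int_def)
  have "grady L (x, y) \<bullet> B u y = 0" if y: "(x, y) \<in> W" for y u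
  proof -
    let ?z = "(\<tau> x, J y)"
    let ?L = "frechet_derivative L (at (x, y))" and ?L' = "frechet_derivative L' (at ?z)"
    have d: "L differentiable (at (x, y))" by (rule dL[OF y])
    have d': "L' differentiable (at ?z)" using dL'[OF y] by (simp add: J_def)
    note l' = frechet_derivative_linear[OF d'] and l = frechet_derivative_linear[OF d]
    have hL': "(L' has_derivative ?L') (at ?z)" using d' frechet_derivative_works by blast
    have h\<tau>: "(\<tau> has_derivative J) (at x)" unfolding J_def by (rule smooth_on_has_derivative[OF \<tau> x])
    \<comment> \<open>With \<open>y\<close> fixed, moving \<open>x\<close> also moves the
      transformed fibre vector, because the Jacobian varies; this is how \<open>D u y\<close>
      enters.\<close>
    have x_dir: "?L (u, 0) = ?L' (J u, D u y)" for u
    proof -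
      have "((\<lambda>x. (\<tau> x, frechet_derivative \<tau> (at x) y)) has_derivative (\<lambda>u. (J u, D u y))) (at x)"
        unfolding D_def by (intro has_derivative_Pair h\<tau> smooth_on_has_derivative[OF smooth_on_frechet[OF \<tau>] x])
      moreover have "(L' has_derivative ?L') (at (\<tau> x, frechet_derivative \<tau> (at x) y))"
        using hL' by (simp add: J_def)
      ultimately have "((\<lambda>x. L' (\<tau> x, frechet_derivative \<tau> (at x) y)) has_derivative (\<lambda>u. ?L' (J u, D u y))) (at x)"
        by (rule has_derivative_compose)
      from has_derivative_unique_on_open[OF has_derivative_x_slice[OF d] this oH[of y]]
      have "(\<lambda>u. ?L (u, 0)) = (\<lambda>u. ?L' (J u, D u y))" using y x L by auto
      then show ?thesis by meson
    qed
    have y_dir: "?L (0, w) = ?L' (0, J w)" for w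
    proof -
      have "((\<lambda>y. (\<tau> x, J y)) has_derivative (\<lambda>w. (0, J w))) (at y)"
        by (intro has_derivative_Pair has_derivative_const linear_imp_has_derivative J)
      from has_derivative_compose[OF this hL']
      have "((\<lambda>y. L' (\<tau> x, J y)) has_derivative (\<lambda>w. ?L' (0, J w))) (at y)" .
      from has_derivative_unique_on_open[OF has_derivative_y_slice[OF d] this oV]
      have "(\<lambda>w. ?L (0, w)) = (\<lambda>w. ?L' (0, J w))" using y x L by (auto simp: J_def)
      then show ?thesis by meson
    qed
    have "?L (u, - conn G u y) = 0" using par[OF y] by (simp add: parallel_at_def)
    then have 1: "?L (u, 0) = ?L (0, conn G u y)"
      using frechet_split[OF d, of u "- conn G u y"] linear_neg[OF l, of "(0, conn G u y)"] by simp
    have "?L' (J u, - conn G' (J u) (J y)) = 0" using par'[OF y] by (simp add: parallel_at_def J_def)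
    then have 2: "?L' (J u, 0) = ?L' (0, conn G' (J u) (J y))"
      using frechet_split[OF d', of "J u" "- conn G' (J u) (J y)"] linear_neg[OF l', of "(0, conn G' (J u) (J y))"] by simp
    \<comment> \<open>The facts \<open>1\<close> and \<open>2\<close> trade base derivatives for
      fibre derivatives in the two charts, and \<open>x_dir\<close>, \<open>y_dir\<close> carry all
      terms to the target chart, where they cancel.\<close>
    have "grady L (x, y) \<bullet> B u y = ?L (0, K (conn G' (J u) (J y) + D u y)) - ?L (0, conn G u y)"
      unfolding frechet_y_grad[OF d] B_def by (simp add: inner_diff_right)
    also have "\<dots> = ?L' (0, conn G' (J u) (J y) + D u y) - ?L' (J u, D u y)"
      using 1 x_dir[of u] y_dir[of "K (conn G' (J u) (J y) + D u y)"] K(3) by simp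
    also have "\<dots> = 0"
      using frechet_split[OF d', of "J u" "D u y"] 2 linear_add[OF l', of "(0, conn G' (J u) (J y))" "(0, D u y)"]
      by simp
    finally show ?thesis .
  qed
  then have "B u v = 0"
    using y0 by (intro parallel_unique[OF oV _ B B_commute P surj]) auto
  then have "J (K (conn G' (J u) (J v) + D u v)) = J (conn G u v)" by (simp add: B_def)
  then have "J (conn G u v) = conn G' (J u) (J v) + D u v" unfolding K(3) by (rule sym)
  then show ?thesis unfolding J_def D_def .
qed


section \<open>The Levi-Civita connection and \<open>(\<alpha>, \<beta>)\<close>-metrics in one chart\<close>

lemma ab_quad_inner: "ab_quad a (x, y) = y \<bullet> (a x *v y)"
  by (simp add: ab_quad_def inner_vec_def matrix_vector_mult_def sum_distrib_left ac_simps)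

definition christoffel_first :: "(real^'n \<Rightarrow> real^'n^'n::finite) \<Rightarrow> real^'n \<Rightarrow> real^'n^'n^'n" where
  "christoffel_first a x = (\<chi> l i k. 1/2 * (pd i (\<lambda>x. a x $ l $ k) x + pd k (\<lambda>x. a x $ i $ l) x - pd l (\<lambda>x. a x $ i $ k) x))"

lemma pd_expand:
  fixes h :: "real^'n::finite \<Rightarrow> real"
  assumes "h differentiable (at x)" shows "frechet_derivative h (at x) u = (\<Sum>m\<in>UNIV. u $ m * pd m h x)"
  using linear_expand_axis[OF frechet_derivative_linear[OF assms], of u] by (simp add: pd_def)

locale pseudo_riemannian_chart =
  fixes U :: "(real^'n::finite) set" and a :: "real^'n \<Rightarrow> real^'n^'n"
  assumes open_U: "open U" and smooth_a: "smooth_on U a"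
    and sym_a: "x \<in> U \<Longrightarrow> transpose (a x) = a x" and inv_a: "x \<in> U \<Longrightarrow> invertible (a x)"
begin

lemma smooth_a_nth: "smooth_on U (\<lambda>x. a x $ i $ j)"
  by (intro smooth_on_vec_nth open_U smooth_a)

lemma a_nth_commute:
  assumes x: "x \<in> U" shows "a x $ i $ j = a x $ j $ i"
proof -
  have "transpose (a x) $ i $ j = a x $ i $ j" by (simp add: sym_a[OF x])
  then show ?thesis by (simp add: transpose_def)
qed

lemma pd_a_commute:
  assumes x: "x \<in> U" shows "pd m (\<lambda>x. a x $ i $ j) x = pd m (\<lambda>x. a x $ j $ i) x"
proof -
  have "frechet_derivative (\<lambda>x. a x $ i $ j) (at x) = frechet_derivative (\<lambda>x. a x $ j $ i) (at x)"
    by (rule frechet_derivative_transform_within_open[OF smooth_onD_differentiable[OF smooth_a_nth x] open_U x])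
      (rule a_nth_commute)
  then show ?thesis by (simp add: pd_def)
qed

lemma a_inner_commute:
  assumes x: "x \<in> U" shows "(a x *v v) \<bullet> w = v \<bullet> (a x *v w)"
proof -
  have "(a x *v v) \<bullet> w = (v v* a x) \<bullet> w"
    by (metis transpose_matrix_vector sym_a[OF x])
  then show ?thesis by (simp add: dot_lmul_matrix)
qed

lemma smooth_levi_civita: "smooth_on U (levi_civita a)"
proof (intro smooth_on_vec open_U)
  fix j i k
  have pd: "smooth_on U (pd i h)" if "smooth_on U h" for i and h :: "real^'n \<Rightarrow> real"
    using smooth_on_frechet[OF that] by (simp add: pd_def[abs_def])
  show "smooth_on U (\<lambda>x. levi_civita a x $ j $ i $ k)"
    unfolding levi_civita_def vec_lambda_beta
    by (intro smooth_on_mult smooth_on_const smooth_on_sum smooth_on_add smooth_on_diff open_U pd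
        smooth_a_nth smooth_on_matrix_inv inv_a)
qed

lemma symmetric_levi_civita: "x \<in> U \<Longrightarrow> symmetric_conn (levi_civita a x)"
  unfolding symmetric_conn_def levi_civita_def vec_lambda_beta
  by (intro allI arg_cong2[where f = "(*)"] refl sum.cong) (simp add: pd_a_commute)

text \<open>Lowering the index with \<open>a\<close> undoes the inverse matrix, so later
  contractions involve only first derivatives of the metric.\<close>

lemma a_conn_levi_civita:
  assumes x: "x \<in> U"
  shows "a x *v conn (levi_civita a x) u v = conn (christoffel_first a x) u v"
proof -
  have "conn (levi_civita a x) u v = matrix_inv (a x) *v conn (christoffel_first a x) u v"
  proof (rule vec_eq_iff[THEN iffD2], rule allI)
    fix k
    have lc: "levi_civita a x $ k $ i $ j = (\<Sum>l\<in>UNIV. matrix_inv (a x) $ k $ l * christoffel_first a x $ l $ i $ j)" for i j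
      by (simp add: levi_civita_def christoffel_first_def sum_distrib_left ac_simps)
    have "conn (levi_civita a x) u v $ k
        = (\<Sum>i\<in>UNIV. \<Sum>j\<in>UNIV. \<Sum>l\<in>UNIV. matrix_inv (a x) $ k $ l * christoffel_first a x $ l $ i $ j * u $ i * v $ j)"
      unfolding conn_def vec_lambda_beta unfolding lc by (simp add: sum_distrib_right)
    also have "\<dots> = (\<Sum>i\<in>UNIV. \<Sum>l\<in>UNIV. \<Sum>j\<in>UNIV. matrix_inv (a x) $ k $ l * christoffel_first a x $ l $ i $ j * u $ i * v $ j)"
      by (rule sum.cong[OF refl], rule sum.swap)
    also have "\<dots> = (\<Sum>l\<in>UNIV. \<Sum>i\<in>UNIV. \<Sum>j\<in>UNIV. matrix_inv (a x) $ k $ l * christoffel_first a x $ l $ i $ j * u $ i * v $ j)"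
      by (rule sum.swap)
    finally show "conn (levi_civita a x) u v $ k = (matrix_inv (a x) *v conn (christoffel_first a x) u v) $ k"
      by (simp add: conn_def matrix_vector_mult_def sum_distrib_left ac_simps)
  qed
  then show ?thesis
    by (simp add: matrix_vector_mul_assoc matrix_inv_right_left[OF inv_a[OF x]])
qed

lemma ab_quad_has_derivative:
  assumes x: "x \<in> U"
  shows "(ab_quad a has_derivative (\<lambda>h.
    (\<Sum>i\<in>UNIV. \<Sum>j\<in>UNIV. frechet_derivative (\<lambda>x. a x $ i $ j) (at x) (fst h) * y $ i * y $ j) + 2 * ((a x *v y) \<bullet> snd h))) (at (x, y))"
proof -
  have a: "((\<lambda>z. a (fst z) $ i $ j) has_derivative (\<lambda>h. frechet_derivative (\<lambda>x. a x $ i $ j) (at x) (fst h))) (at (x, y))" for i j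
  proof -
    have "((\<lambda>x. a x $ i $ j) has_derivative frechet_derivative (\<lambda>x. a x $ i $ j) (at x)) (at (fst (x, y)))"
      using smooth_on_has_derivative[OF smooth_a_nth x] by simp
    moreover have "(fst has_derivative fst) (at (x, y))"
      by (rule bounded_linear_imp_has_derivative[OF bounded_linear_fst])
    ultimately show ?thesis using has_derivative_compose[of fst] by blast
  qed
  have s: "((\<lambda>z. snd z $ i) has_derivative (\<lambda>h. snd h $ i)) (at (x, y))" for i
    by (rule bounded_linear_imp_has_derivative[OF bounded_linear_compose[OF bounded_linear_vec_nth bounded_linear_snd]])
  have "(ab_quad a has_derivative (\<lambda>h. \<Sum>i\<in>UNIV. \<Sum>j\<in>UNIV.
      a x $ i $ j * y $ i * snd h $ j + (a x $ i $ j * snd h $ i + frechet_derivative (\<lambda>x. a x $ i $ j) (at x) (fst h) * y $ i) * y $ j)) (at (x, y))"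
    unfolding ab_quad_def[abs_def]
    by (intro has_derivative_sum) (use has_derivative_mult[OF has_derivative_mult[OF a s] s] in simp)
  moreover have "(\<Sum>i\<in>UNIV. \<Sum>j\<in>UNIV.
      a x $ i $ j * y $ i * snd h $ j + (a x $ i $ j * snd h $ i + frechet_derivative (\<lambda>x. a x $ i $ j) (at x) (fst h) * y $ i) * y $ j)
      = (\<Sum>i\<in>UNIV. \<Sum>j\<in>UNIV. frechet_derivative (\<lambda>x. a x $ i $ j) (at x) (fst h) * y $ i * y $ j) + 2 * ((a x *v y) \<bullet> snd h)" for h :: "(real^'n)\<times>(real^'n)"
  proof -
    have "(\<Sum>i\<in>UNIV. \<Sum>j\<in>UNIV. a x $ i $ j * y $ i * snd h $ j) = y \<bullet> (a x *v snd h)"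
      by (simp add: inner_vec_def matrix_vector_mult_def sum_distrib_left ac_simps)
    moreover have "(\<Sum>i\<in>UNIV. \<Sum>j\<in>UNIV. a x $ i $ j * snd h $ i * y $ j) = snd h \<bullet> (a x *v y)"
      by (simp add: inner_vec_def matrix_vector_mult_def sum_distrib_left ac_simps)
    ultimately show ?thesis
      using a_inner_commute[OF x, of y "snd h"]
      by (simp add: sum.distrib distrib_right inner_commute)
  qed
  ultimately show ?thesis by simp
qed

lemma ab_quad_differentiable: "x \<in> U \<Longrightarrow> ab_quad a differentiable (at (x, y))"
  using ab_quad_has_derivative differentiable_def by blast

lemma frechet_ab_quad:
  "x \<in> U \<Longrightarrow> frechet_derivative (ab_quad a) (at (x, y)) h =
    (\<Sum>i\<in>UNIV. \<Sum>j\<in>UNIV. frechet_derivative (\<lambda>x. a x $ i $ j) (at x) (fst h) * y $ i * y $ j) + 2 * ((a x *v y) \<bullet> snd h)"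
  by (subst frechet_derivative_at[OF ab_quad_has_derivative, symmetric]) simp_all

text \<open>Metric compatibility, contracted twice with \<open>y\<close>. Of the three derivative
  terms in the Christoffel symbols the last two cancel in the sum, and the first reproduces the base
  derivative of \<open>ab_quad a\<close>.\<close>

lemma levi_civita_parallel_at:
  assumes x: "x \<in> U"
  shows "parallel_at (levi_civita a x) (ab_quad a) (x, y)"
  unfolding parallel_at_def
proof
  fix u
  let ?p = "\<lambda>m i j. pd m (\<lambda>x. a x $ i $ j) x"
  have fr: "frechet_derivative (\<lambda>x. a x $ i $ j) (at x) u = (\<Sum>m\<in>UNIV. u $ m * ?p m i j)" for i j
    by (rule pd_expand[OF smooth_onD_differentiable[OF smooth_a_nth x]])
  have "2 * ((a x *v y) \<bullet> conn (levi_civita a x) u y) = 2 * (y \<bullet> conn (christoffel_first a x) u y)"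
    by (simp add: a_inner_commute[OF x] a_conn_levi_civita[OF x])
  also have "\<dots> = (\<Sum>l\<in>UNIV. \<Sum>m\<in>UNIV. \<Sum>j\<in>UNIV. y $ l * ((?p m l j + ?p j m l - ?p l m j) * u $ m * y $ j))"
    unfolding inner_vec_def inner_real_def conn_def christoffel_first_def vec_lambda_beta sum_distrib_left
    by (intro sum.cong refl) (simp add: field_simps)
  also have "\<dots> = (\<Sum>l\<in>UNIV. \<Sum>m\<in>UNIV. \<Sum>j\<in>UNIV. u $ m * ?p m l j * y $ l * y $ j)
      + ((\<Sum>l\<in>UNIV. \<Sum>m\<in>UNIV. \<Sum>j\<in>UNIV. ?p j m l * y $ l * u $ m * y $ j)
       - (\<Sum>l\<in>UNIV. \<Sum>m\<in>UNIV. \<Sum>j\<in>UNIV. ?p l m j * y $ l * u $ m * y $ j))"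
    unfolding sum.distrib[symmetric] sum_subtractf[symmetric]
    by (intro sum.cong refl) (simp add: algebra_simps)
  \<comment> \<open>The swaps interchange the roles of \<open>l\<close> and \<open>j\<close>, after
    which this sum equals the subtracted one.\<close>
  also have "(\<Sum>l\<in>UNIV. \<Sum>m\<in>UNIV. \<Sum>j\<in>UNIV. ?p j m l * y $ l * u $ m * y $ j)
      = (\<Sum>m\<in>UNIV. \<Sum>l\<in>UNIV. \<Sum>j\<in>UNIV. ?p j m l * y $ l * u $ m * y $ j)"
    by (rule sum.swap)
  also have "\<dots> = (\<Sum>m\<in>UNIV. \<Sum>j\<in>UNIV. \<Sum>l\<in>UNIV. ?p j m l * y $ l * u $ m * y $ j)"
    by (rule sum.cong[OF refl], rule sum.swap)
  also have "\<dots> = (\<Sum>j\<in>UNIV. \<Sum>m\<in>UNIV. \<Sum>l\<in>UNIV. ?p j m l * y $ l * u $ m * y $ j)"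
    by (rule sum.swap)
  also have "\<dots> = (\<Sum>l\<in>UNIV. \<Sum>m\<in>UNIV. \<Sum>j\<in>UNIV. ?p l m j * y $ l * u $ m * y $ j)"
    by (intro sum.cong refl) simp
  also have "(\<Sum>l\<in>UNIV. \<Sum>m\<in>UNIV. \<Sum>j\<in>UNIV. u $ m * ?p m l j * y $ l * y $ j)
      = (\<Sum>l\<in>UNIV. \<Sum>j\<in>UNIV. \<Sum>m\<in>UNIV. u $ m * ?p m l j * y $ l * y $ j)"
    by (rule sum.cong[OF refl], rule sum.swap)
  also have "\<dots> = (\<Sum>i\<in>UNIV. \<Sum>j\<in>UNIV. frechet_derivative (\<lambda>x. a x $ i $ j) (at x) u * y $ i * y $ j)"
    by (simp add: fr sum_distrib_right)
  finally have "2 * ((a x *v y) \<bullet> conn (levi_civita a x) u y) = (\<Sum>i\<in>UNIV. \<Sum>j\<in>UNIV. frechet_derivative (\<lambda>x. a x $ i $ j) (at x) u * y $ i * y $ j)"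
    by simp
  then show "frechet_derivative (ab_quad a) (at (x, y)) (u, - conn (levi_civita a x) u (snd (x, y))) = 0"
    by (simp add: frechet_ab_quad[OF x])
qed

lemma grady_ab_quad: "x \<in> U \<Longrightarrow> grady (ab_quad a) (x, y) = 2 *\<^sub>R (a x *v y)"
proof -
  assume x: "x \<in> U"
  have z: "frechet_derivative (\<lambda>x. a x $ i $ j) (at x) 0 = 0" for i j
    by (rule linear_0[OF frechet_derivative_linear[OF smooth_onD_differentiable[OF smooth_a_nth x]]])
  show ?thesis
    by (simp add: grady_def pdy_def frechet_ab_quad[OF x] z vec_eq_iff inner_axis)
qed

lemma grady_ab_quad_derivative:
  assumes x: "x \<in> U"
  shows "((\<lambda>y. grady (ab_quad a) (x, y)) has_derivative (\<lambda>v. 2 *\<^sub>R (a x *v v))) (at y)"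
  unfolding grady_ab_quad[OF x]
  by (intro has_derivative_scaleR_right linear_imp_has_derivative matrix_vector_mul_linear)

lemma surj_a:
  assumes x: "x \<in> U" shows "surj (\<lambda>v. 2 *\<^sub>R (a x *v v))"
proof (rule surjI)
  fix w
  show "2 *\<^sub>R (a x *v ((1/2) *\<^sub>R (matrix_inv (a x) *v w))) = w"
    by (simp add: matrix_vector_mult_scaleR matrix_vector_mul_assoc matrix_inv_right_left[OF inv_a[OF x]])
qed

end


lemma conn_plus: "conn (G + T) u v = conn G u v + conn T u v"
  by (simp add: conn_def vec_eq_iff sum.distrib distrib_right)

text \<open>The sign is the derivative of the absolute value away from zero; it becomes the
  \<epsilon> of the Berwald equation.\<close>

lemma has_derivative_sqrt_abs:
  fixes q :: "'a::real_normed_vector \<Rightarrow> real"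
  assumes q: "(q has_derivative q') (at z)" and nz: "q z \<noteq> 0"
  shows "((\<lambda>z. sqrt \<bar>q z\<bar>) has_derivative (\<lambda>h. sgn (q z) * q' h / (2 * sqrt \<bar>q z\<bar>))) (at z)"
proof -
  have abs: "(abs has_real_derivative sgn (q z)) (at (q z))"
  proof (cases "q z > 0")
    case True
    show ?thesis
      by (rule has_field_derivative_transform_within_open[of "\<lambda>t. t" _ _ "{0<..}"]) (use True in auto)
  next
    case False
    show ?thesis
      by (rule has_field_derivative_transform_within_open[of "\<lambda>t. - t" _ _ "{..<0}"])
        (use False nz in \<open>auto intro!: derivative_eq_intros\<close>)
  qed
  have "((\<lambda>t. sqrt \<bar>t\<bar>) has_real_derivative sgn (q z) / (2 * sqrt \<bar>q z\<bar>)) (at (q z))"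
    using nz by (auto intro!: derivative_eq_intros abs simp: field_simps)
  from has_derivative_compose[OF q this[unfolded has_field_derivative_def]] show ?thesis
    by (simp add: field_simps)
qed

locale alpha_beta_chart = pseudo_riemannian_chart U a
  for U :: "(real^'n::finite) set" and a :: "real^'n \<Rightarrow> real^'n^'n" +
  fixes b :: "real^'n \<Rightarrow> real^'n"
  assumes smooth_b: "smooth_on U b"
begin

lemma ab_beta_has_derivative:
  assumes x: "x \<in> U"
  shows "(ab_beta b has_derivative (\<lambda>h.
    (\<Sum>j\<in>UNIV. frechet_derivative (\<lambda>x. b x $ j) (at x) (fst h) * y $ j) + b x \<bullet> snd h)) (at (x, y))"
proof -
  have b: "((\<lambda>z. b (fst z) $ j) has_derivative (\<lambda>h. frechet_derivative (\<lambda>x. b x $ j) (at x) (fst h))) (at (x, y))" for j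
  proof -
    have "((\<lambda>x. b x $ j) has_derivative frechet_derivative (\<lambda>x. b x $ j) (at x)) (at (fst (x, y)))"
      using smooth_on_has_derivative[OF smooth_on_vec_nth[OF open_U smooth_b] x] by simp
    moreover have "(fst has_derivative fst) (at (x, y))"
      by (rule bounded_linear_imp_has_derivative[OF bounded_linear_fst])
    ultimately show ?thesis using has_derivative_compose[of fst] by blast
  qed
  have s: "((\<lambda>z. snd z $ i) has_derivative (\<lambda>h. snd h $ i)) (at (x, y))" for i
    by (rule bounded_linear_imp_has_derivative[OF bounded_linear_compose[OF bounded_linear_vec_nth bounded_linear_snd]])
  have "(ab_beta b has_derivative (\<lambda>h. \<Sum>j\<in>UNIV.
      b x $ j * snd h $ j + frechet_derivative (\<lambda>x. b x $ j) (at x) (fst h) * y $ j)) (at (x, y))"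
    unfolding ab_beta_def[abs_def]
    by (intro has_derivative_sum) (use has_derivative_mult[OF b s] in simp)
  then show ?thesis by (simp add: sum.distrib inner_vec_def add.commute)
qed

text \<open>The left side is the horizontal derivative of \<beta> for the Levi-Civita connection;
  reordering the sums groups its two terms into a covariant derivative for each
  \<open>i\<close>.\<close>

lemma horizontal_beta:
  assumes x: "x \<in> U"
  shows "(\<Sum>j\<in>UNIV. frechet_derivative (\<lambda>x. b x $ j) (at x) u * y $ j) - b x \<bullet> conn (levi_civita a x) u y
    = (\<Sum>i\<in>UNIV. u $ i * (\<Sum>j\<in>UNIV. y $ j * cov_deriv a b i j x))"
proof -
  have "frechet_derivative (\<lambda>x. b x $ j) (at x) u = (\<Sum>i\<in>UNIV. u $ i * pd i (\<lambda>x. b x $ j) x)" for j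
    by (rule pd_expand[OF smooth_onD_differentiable[OF smooth_on_vec_nth[OF open_U smooth_b] x]])
  then have "(\<Sum>j\<in>UNIV. frechet_derivative (\<lambda>x. b x $ j) (at x) u * y $ j)
      = (\<Sum>j\<in>UNIV. \<Sum>i\<in>UNIV. u $ i * (y $ j * pd i (\<lambda>x. b x $ j) x))"
    by (simp add: sum_distrib_left ac_simps)
  also have "\<dots> = (\<Sum>i\<in>UNIV. \<Sum>j\<in>UNIV. u $ i * (y $ j * pd i (\<lambda>x. b x $ j) x))"
    by (rule sum.swap)
  finally have 1: "(\<Sum>j\<in>UNIV. frechet_derivative (\<lambda>x. b x $ j) (at x) u * y $ j)
      = (\<Sum>i\<in>UNIV. \<Sum>j\<in>UNIV. u $ i * (y $ j * pd i (\<lambda>x. b x $ j) x))" .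
  have "b x \<bullet> conn (levi_civita a x) u y
      = (\<Sum>l\<in>UNIV. \<Sum>i\<in>UNIV. \<Sum>j\<in>UNIV. u $ i * (y $ j * (levi_civita a x $ l $ i $ j * b x $ l)))"
    unfolding inner_vec_def inner_real_def conn_def vec_lambda_beta sum_distrib_left
    by (intro sum.cong refl) (simp add: ac_simps)
  also have "\<dots> = (\<Sum>i\<in>UNIV. \<Sum>l\<in>UNIV. \<Sum>j\<in>UNIV. u $ i * (y $ j * (levi_civita a x $ l $ i $ j * b x $ l)))"
    by (rule sum.swap)
  also have "\<dots> = (\<Sum>i\<in>UNIV. \<Sum>j\<in>UNIV. \<Sum>l\<in>UNIV. u $ i * (y $ j * (levi_civita a x $ l $ i $ j * b x $ l)))"
    by (rule sum.cong[OF refl], rule sum.swap)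
  finally have 2: "b x \<bullet> conn (levi_civita a x) u y
      = (\<Sum>i\<in>UNIV. \<Sum>j\<in>UNIV. \<Sum>l\<in>UNIV. u $ i * (y $ j * (levi_civita a x $ l $ i $ j * b x $ l)))" .
  show ?thesis
    unfolding 1 2 cov_deriv_def
    by (simp add: sum_subtractf right_diff_distrib sum_distrib_left)
qed

text \<open>\<open>\<alpha>\<close> is parallel for the Levi-Civita connection, so only the derivative of \<open>\<beta>\<close> contributes to the
  horizontal derivative of \<open>F\<close>.\<close>

lemma parallel_at_iff_berwald_equation:
  fixes f :: "(real^'n) \<times> (real^'n) \<Rightarrow> real" and \<phi> :: "real \<Rightarrow> real"
  assumes x: "x \<in> U" and q0: "ab_quad a (x, y) \<noteq> 0"
    and \<phi>: "(\<phi> has_real_derivative \<phi>') (at (ab_s a b (x, y)))" and \<phi>': "\<phi>' \<noteq> 0"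
    and W: "open W" "(x, y) \<in> W" and f: "\<And>z. z \<in> W \<Longrightarrow> f z = ab_alpha a z * \<phi> (ab_s a b z)" and f0: "f (x, y) \<noteq> 0"
  shows "parallel_at (levi_civita a x + T) (\<lambda>z. (f z)\<^sup>2) (x, y) \<longleftrightarrow>
    (\<forall>i. (\<Sum>j\<in>UNIV. y $ j * cov_deriv a b i j x) =
      (\<Sum>j\<in>UNIV. \<Sum>k\<in>UNIV. T $ j $ i $ k * y $ k *
        (b x $ j + sgn (ab_quad a (x, y)) / ab_alpha a (x, y) * (\<phi> (ab_s a b (x, y)) / \<phi>' - ab_s a b (x, y)) * ab_lower a (x, y) j)))"
proof -
  define z where "z = (x, y)"
  define q where "q = ab_quad a z"
  define \<alpha> where "\<alpha> = ab_alpha a z"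
  define s where "s = ab_s a b z"
  define q' where "q' = frechet_derivative (ab_quad a) (at z)"
  define \<beta>' where "\<beta>' h = (\<Sum>j\<in>UNIV. frechet_derivative (\<lambda>x. b x $ j) (at x) (fst h) * y $ j) + b x \<bullet> snd h" for h
  define \<alpha>' where "\<alpha>' h = sgn q * q' h / (2 * \<alpha>)" for h
  \<comment> \<open>The bracket of the Berwald equation; it is the fibre gradient of
    \<open>f\<close> at \<open>z\<close>, divided by \<open>\<phi>'\<close>.\<close>
  define V where "V = (\<chi> j. b x $ j + sgn q / \<alpha> * (\<phi> s / \<phi>' - s) * ab_lower a z j)"
  define C where "C i = (\<Sum>j\<in>UNIV. y $ j * cov_deriv a b i j x)" for i
  have \<alpha>0: "\<alpha> \<noteq> 0" using q0 by (simp add: \<alpha>_def ab_alpha_def z_def)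
  have dq: "(ab_quad a has_derivative q') (at z)"
    using ab_quad_differentiable[OF x] frechet_derivative_works unfolding q'_def z_def by blast
  have d\<alpha>: "(ab_alpha a has_derivative \<alpha>') (at z)"
    using has_derivative_sqrt_abs[OF dq] q0 by (simp add: ab_alpha_def[abs_def] \<alpha>'_def[abs_def] \<alpha>_def q_def z_def)
  have d\<beta>: "(ab_beta b has_derivative \<beta>') (at z)"
    unfolding \<beta>'_def[abs_def] z_def by (rule ab_beta_has_derivative[OF x])
  have s: "s = ab_beta b z / \<alpha>" by (simp add: s_def ab_s_def \<alpha>_def)
  have ds: "(ab_s a b has_derivative (\<lambda>h. (\<beta>' h * \<alpha> - ab_beta b z * \<alpha>' h) / (\<alpha> * \<alpha>))) (at z)"
    unfolding ab_s_def[abs_def] \<alpha>_def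
    by (rule has_derivative_divide'[OF d\<beta> d\<alpha>]) (use \<alpha>0 in \<open>simp add: \<alpha>_def\<close>)
  have "((\<lambda>z. \<phi> (ab_s a b z)) has_derivative (\<lambda>h. \<phi>' * ((\<beta>' h * \<alpha> - ab_beta b z * \<alpha>' h) / (\<alpha> * \<alpha>)))) (at z)"
    by (rule has_derivative_compose[OF ds]) (use \<phi> in \<open>simp add: has_field_derivative_def z_def\<close>)
  from has_derivative_mult[OF d\<alpha> this]
  have "((\<lambda>z. ab_alpha a z * \<phi> (ab_s a b z)) has_derivative
      (\<lambda>h. \<alpha> * (\<phi>' * ((\<beta>' h * \<alpha> - ab_beta b z * \<alpha>' h) / (\<alpha> * \<alpha>))) + \<alpha>' h * \<phi> s)) (at z)"
    by (simp add: \<alpha>_def s_def)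
  \<comment> \<open>Substitute \<open>\<beta> = s \<alpha>\<close> and factor out
    \<open>\<phi>'\<close>.\<close>
  also have "(\<lambda>h. \<alpha> * (\<phi>' * ((\<beta>' h * \<alpha> - ab_beta b z * \<alpha>' h) / (\<alpha> * \<alpha>))) + \<alpha>' h * \<phi> s)
      = (\<lambda>h. \<phi>' * (\<beta>' h + (\<phi> s / \<phi>' - s) * \<alpha>' h))"
    using \<alpha>0 \<phi>' by (simp add: fun_eq_iff s field_simps)
  finally have "(f has_derivative (\<lambda>h. \<phi>' * (\<beta>' h + (\<phi> s / \<phi>' - s) * \<alpha>' h))) (at z)"
    by (rule has_derivative_transform_within_open[OF _ W[folded z_def]]) (simp add: f)
  then have "((\<lambda>z. (f z)\<^sup>2) has_derivative (\<lambda>h. 2 * (\<phi>' * (\<beta>' h + (\<phi> s / \<phi>' - s) * \<alpha>' h)) * f z)) (at z)"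
    by (auto intro!: derivative_eq_intros)
  then have fr: "frechet_derivative (\<lambda>z. (f z)\<^sup>2) (at z) h = 2 * (\<phi>' * (\<beta>' h + (\<phi> s / \<phi>' - s) * \<alpha>' h)) * f z" for h
    by (subst frechet_derivative_at[symmetric]) auto
  have "frechet_derivative (\<lambda>z. (f z)\<^sup>2) (at z) (u, - conn (levi_civita a x + T) u y) = 0
      \<longleftrightarrow> (\<Sum>i\<in>UNIV. u $ i * C i) = conn T u y \<bullet> V" for u
  proof -
    let ?w = "conn T u y" and ?h = "(u, - conn (levi_civita a x + T) u y)"
    have "q' (u, - conn (levi_civita a x) u y) = 0"
      using levi_civita_parallel_at[OF x] by (simp add: parallel_at_def q'_def z_def)
    \<comment> \<open>The Levi-Civita part of the horizontal direction leaves \<open>q\<close>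
      stationary, so only the vertical shift by \<open>T\<close> contributes.\<close>
    then have "q' ?h = - 2 * ((a x *v y) \<bullet> ?w)"
      unfolding q'_def z_def frechet_ab_quad[OF x] by (simp add: conn_plus inner_diff_right algebra_simps)
    then have 1: "\<alpha>' ?h = - (sgn q / \<alpha> * ((a x *v y) \<bullet> ?w))"
      using \<alpha>0 by (simp add: \<alpha>'_def field_simps)
    have 2: "\<beta>' ?h = (\<Sum>i\<in>UNIV. u $ i * C i) - b x \<bullet> ?w"
      using horizontal_beta[OF x, of u y] by (simp add: \<beta>'_def C_def conn_plus inner_diff_right)
    have V: "V = b x + (sgn q / \<alpha> * (\<phi> s / \<phi>' - s)) *\<^sub>R (a x *v y)"
      by (simp add: V_def vec_eq_iff ab_lower_def z_def matrix_vector_mult_def)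
    \<comment> \<open>The common factor \<open>2 * \<phi>' * f z\<close> is nonzero and
      cancels.\<close>
    have "frechet_derivative (\<lambda>z. (f z)\<^sup>2) (at z) ?h = 0 \<longleftrightarrow> \<beta>' ?h + (\<phi> s / \<phi>' - s) * \<alpha>' ?h = 0"
      unfolding fr using f0 \<phi>' by (simp add: z_def)
    also have "\<beta>' ?h + (\<phi> s / \<phi>' - s) * \<alpha>' ?h = (\<Sum>i\<in>UNIV. u $ i * C i) - ?w \<bullet> V"
      unfolding 1 2 V by (simp add: inner_add_right inner_commute)
    finally show ?thesis by simp
  qed
  then have "parallel_at (levi_civita a x + T) (\<lambda>z. (f z)\<^sup>2) (x, y) \<longleftrightarrow> (\<forall>u. (\<Sum>i\<in>UNIV. u $ i * C i) = conn T u y \<bullet> V)"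
    by (simp add: parallel_at_def z_def)
  also have "\<dots> \<longleftrightarrow> (\<forall>i. C i = conn T (axis i 1) y \<bullet> V)"
  proof (intro iffI allI)
    fix i assume *: "\<forall>u. (\<Sum>i\<in>UNIV. u $ i * C i) = conn T u y \<bullet> V"
    have "(\<Sum>k\<in>UNIV. axis i 1 $ k * C k) = C i"
      by (simp add: axis_def if_distrib if_distribR cong: if_cong)
    from trans[OF sym[OF this] spec[OF *]] show "C i = conn T (axis i 1) y \<bullet> V" .
  next
    fix u assume *: "\<forall>i. C i = conn T (axis i 1) y \<bullet> V"
    have "linear (\<lambda>u. conn T u y \<bullet> V)"
      using bilinear_ladd[OF bilinear_conn[of T]] bilinear_lmul[OF bilinear_conn[of T]]
      by (intro linearI) (simp_all add: inner_add_left)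
    from linear_expand_axis[OF this, of u] * show "(\<Sum>i\<in>UNIV. u $ i * C i) = conn T u y \<bullet> V" by simp
  qed
  also have "(\<lambda>i. conn T (axis i 1) y \<bullet> V) = (\<lambda>i. \<Sum>j\<in>UNIV. \<Sum>k\<in>UNIV. T $ j $ i $ k * y $ k * V $ j)"
    by (simp add: fun_eq_iff inner_vec_def conn_axis sum_distrib_right)
  finally show ?thesis
    by (simp add: C_def V_def q_def \<alpha>_def s_def z_def fun_eq_iff)
qed

end


section \<open>Globalisation\<close>

text \<open>The last clause of \<open>torsion_free_affine_connection\<close>, isolated because
  tensoriality of a difference of connections rests on this clause alone.\<close>

definition transforms_as_connection ::
  "('a, 'n::finite) chart set \<Rightarrow> (('a, 'n) chart \<Rightarrow> real^'n \<Rightarrow> real^'n^'n^'n) \<Rightarrow> bool" where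
  "transforms_as_connection Atl \<Gamma> \<longleftrightarrow>
     (\<forall>c\<in>Atl. \<forall>d\<in>Atl. \<forall>p \<in> fst c \<inter> fst d. \<forall>l i k.
        let J = jacobian (transition c d) (at (snd c p)) in
        (\<Sum>j\<in>UNIV. J $ l $ j * \<Gamma> c (snd c p) $ j $ i $ k) =
          (\<Sum>m\<in>UNIV. \<Sum>n\<in>UNIV. \<Gamma> d (snd d p) $ l $ m $ n * J $ m $ i * J $ n $ k)
          + pd i (pd k (\<lambda>x. transition c d x $ l)) (snd c p))"

lemma torsion_free_affine_connection_iff:
  "torsion_free_affine_connection Atl \<Gamma> \<longleftrightarrow>
     (\<forall>c\<in>Atl. smooth_on (chart_image c) (\<Gamma> c)) \<and>
     (\<forall>c\<in>Atl. \<forall>x\<in>chart_image c. symmetric_conn (\<Gamma> c x)) \<and> transforms_as_connection Atl \<Gamma>"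
  unfolding torsion_free_affine_connection_def transforms_as_connection_def symmetric_conn_def ..

lemma jacobian_mult:
  fixes f :: "real^'m::finite \<Rightarrow> real^'n::finite"
  assumes "f differentiable (at x)"
  shows "jacobian f (at x) *v v = frechet_derivative f (at x) v"
  using frechet_derivative_at[OF iffD1[OF jacobian_works assms]] by (simp add: fun_eq_iff)

section \<open>Coordinate changes on the manifold and its tangent bundle\<close>

locale smooth_atlas =
  fixes M :: "'a topology" and Atl :: "('a, 'n::finite) chart set"
  assumes manifold: "smooth_manifold M Atl"
begin

lemma openin_dom: "c \<in> Atl \<Longrightarrow> openin M (fst c)"
  using manifold by (simp add: smooth_manifold_def)

lemma dom_subset: "c \<in> Atl \<Longrightarrow> fst c \<subseteq> topspace M"
  using openin_dom openin_subset by blast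

lemma homeomorphic_chart: "c \<in> Atl \<Longrightarrow> homeomorphic_map (subtopology M (fst c)) (top_of_set (chart_image c)) (snd c)"
  using manifold by (simp add: smooth_manifold_def)

lemma open_chart_image: "c \<in> Atl \<Longrightarrow> open (chart_image c)"
  using manifold by (simp add: smooth_manifold_def)

lemma inj_chart: "c \<in> Atl \<Longrightarrow> inj_on (snd c) (fst c)"
  using homeomorphic_imp_injective_map[OF homeomorphic_chart] topspace_subtopology_subset[OF dom_subset]
  by metis

lemma transition_apply: "c \<in> Atl \<Longrightarrow> p \<in> fst c \<Longrightarrow> transition c d (snd c p) = snd d p"
  by (simp add: transition_def inv_into_f_f[OF inj_chart])

lemma open_overlap:
  assumes "c \<in> Atl" "d \<in> Atl" shows "open (snd c ` (fst c \<inter> fst d))"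
proof -
  have "openin (subtopology M (fst c)) (fst c \<inter> fst d)"
    by (rule openin_subtopology_Int2[OF openin_dom[OF assms(2)]])
  with homeomorphic_imp_open_map[OF homeomorphic_chart[OF assms(1)]]
  have "openin (top_of_set (chart_image c)) (snd c ` (fst c \<inter> fst d))"
    unfolding open_map_def by blast
  then show ?thesis using openin_open_eq[OF open_chart_image[OF assms(1)]] by blast
qed

lemma smooth_transition: "c \<in> Atl \<Longrightarrow> d \<in> Atl \<Longrightarrow> smooth_on (snd c ` (fst c \<inter> fst d)) (transition c d)"
  using manifold by (simp add: smooth_manifold_def)

lemma transition_differentiable:
  "c \<in> Atl \<Longrightarrow> d \<in> Atl \<Longrightarrow> p \<in> fst c \<inter> fst d \<Longrightarrow> transition c d differentiable (at (snd c p))"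
  by (rule smooth_onD_differentiable[OF smooth_transition]) auto

text \<open>Chain rule: opposite transitions compose to the identity on the open overlap.\<close>

lemma frechet_transition_inverse:
  assumes c: "c \<in> Atl" and d: "d \<in> Atl" and p: "p \<in> fst c \<inter> fst d"
  shows "frechet_derivative (transition d c) (at (snd d p)) (frechet_derivative (transition c d) (at (snd c p)) v) = v"
proof -
  have dc: "p \<in> fst d \<inter> fst c" using p by blast
  have 1: "(transition c d has_derivative frechet_derivative (transition c d) (at (snd c p))) (at (snd c p))"
    using transition_differentiable[OF c d p] frechet_derivative_works by blast
  have "(transition d c has_derivative frechet_derivative (transition d c) (at (snd d p))) (at (transition c d (snd c p)))"
    using transition_differentiable[OF d c dc] frechet_derivative_works transition_apply[OF c] p by (metis IntD1)
  from has_derivative_compose[OF 1 this]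
  have "(\<lambda>v. frechet_derivative (transition d c) (at (snd d p)) (frechet_derivative (transition c d) (at (snd c p)) v)) = (\<lambda>v. v)"
    by (rule has_derivative_unique_on_open[OF _ has_derivative_ident open_overlap[OF c d]])
      (use p in \<open>auto simp: transition_apply[OF c] transition_apply[OF d]\<close>)
  then show ?thesis by meson
qed

lemma inj_frechet_transition:
  assumes "c \<in> Atl" "d \<in> Atl" "p \<in> fst c \<inter> fst d"
  shows "inj (frechet_derivative (transition c d) (at (snd c p)))"
  by (rule inj_on_inverseI[of _ "frechet_derivative (transition d c) (at (snd d p))"])
    (rule frechet_transition_inverse[OF assms])

definition change :: "('a, 'n) chart \<Rightarrow> ('a, 'n) chart \<Rightarrow> (real^'n) \<times> (real^'n) \<Rightarrow> (real^'n) \<times> (real^'n)" where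
  "change c d z = (transition c d (fst z), frechet_derivative (transition c d) (at (fst z)) (snd z))"

lemma tangent_coords_change:
  assumes c: "c \<in> Atl" and d: "d \<in> Atl" and w: "w \<in> tangent_bundle M Atl" "fst w \<in> fst c \<inter> fst d"
  shows "tangent_coords d w = change c d (tangent_coords c w)"
proof -
  have "snd w d = jacobian (transition c d) (at (snd c (fst w))) *v snd w c"
  proof -
    have "(fst w, snd w) \<in> tangent_bundle M Atl" using w(1) by simp
    then have "\<forall>c\<in>Atl. \<forall>d\<in>Atl. fst w \<in> fst c \<inter> fst d \<longrightarrow>
        snd w d = jacobian (transition c d) (at (snd c (fst w))) *v snd w c"
      unfolding tangent_bundle_def mem_Collect_eq prod.case by blast
    then show ?thesis using w(2) c d by blast
  qed
  then show ?thesis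
    using w transition_apply[OF c, of "fst w" d] jacobian_mult[OF transition_differentiable[OF c d w(2)]]
    by (simp add: tangent_coords_def change_def)
qed

text \<open>Smoothness of the transition gives continuity of its derivative for each fixed direction
  only, hence the expansion of the fibre vector over the axes.\<close>

lemma continuous_on_change:
  assumes c: "c \<in> Atl" and d: "d \<in> Atl"
  shows "continuous_on (snd c ` (fst c \<inter> fst d) \<times> UNIV) (change c d)"
proof -
  let ?S = "snd c ` (fst c \<inter> fst d)"
  have fst: "continuous_on (?S \<times> UNIV) (\<lambda>z::(real^'n)\<times>(real^'n). h (fst z))"
    if "continuous_on ?S h" for h :: "real^'n \<Rightarrow> real^'n"
    by (rule continuous_on_compose2[OF that continuous_on_fst[OF continuous_on_id]]) auto
  have "frechet_derivative (transition c d) (at (fst z)) (snd z) =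
      (\<Sum>i\<in>UNIV. snd z $ i *\<^sub>R frechet_derivative (transition c d) (at (fst z)) (axis i 1))"
    if "z \<in> ?S \<times> UNIV" for z
    by (rule linear_expand_axis[OF frechet_derivative_linear[OF smooth_onD_differentiable[OF smooth_transition[OF c d]]]])
      (use that in auto)
  moreover have "continuous_on (?S \<times> UNIV)
      (\<lambda>z::(real^'n)\<times>(real^'n). \<Sum>i\<in>UNIV. snd z $ i *\<^sub>R frechet_derivative (transition c d) (at (fst z)) (axis i 1))"
  proof (intro continuous_on_sum continuous_on_scaleR)
    fix i
    show "continuous_on (?S \<times> UNIV) (\<lambda>z::(real^'n)\<times>(real^'n). snd z $ i)"
      by (intro continuous_intros)
    show "continuous_on (?S \<times> UNIV)
        (\<lambda>z::(real^'n)\<times>(real^'n). frechet_derivative (transition c d) (at (fst z)) (axis i 1))"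
      by (rule fst[OF smooth_onD_continuous[OF smooth_on_frechet[OF smooth_transition[OF c d]]]])
  qed
  ultimately have "continuous_on (?S \<times> UNIV) (\<lambda>z. frechet_derivative (transition c d) (at (fst z)) (snd z))"
    by (simp cong: continuous_on_cong)
  then show ?thesis
    unfolding change_def[abs_def]
    by (intro continuous_on_Pair fst[OF smooth_onD_continuous[OF smooth_transition[OF c d]]])
qed

text \<open>Formulated for any invariant Lagrangian with nondegenerate fibre Hessian, as it serves
  twice: for \<open>ab_quad\<close> on the full tangent bundle and for \<open>F\<^sup>2\<close> on
  \<open>A\<close>. The law is \<open>connection_transform\<close> evaluated on pairs of axis
  vectors.\<close>

lemma transforms_as_connection_of_parallel:
  fixes W :: "('a, 'n) chart \<Rightarrow> ((real^'n) \<times> (real^'n)) set" and L :: "('a, 'n) chart \<Rightarrow> (real^'n) \<times> (real^'n) \<Rightarrow> real"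
  assumes W: "\<And>c. c \<in> Atl \<Longrightarrow> open (W c)" and proj: "\<And>c. c \<in> Atl \<Longrightarrow> fst ` W c = chart_image c"
    and change: "\<And>c d z. c \<in> Atl \<Longrightarrow> d \<in> Atl \<Longrightarrow> z \<in> W c \<Longrightarrow> fst z \<in> snd c ` (fst c \<inter> fst d) \<Longrightarrow>
      change c d z \<in> W d \<and> L c z = L d (change c d z)"
    and diff: "\<And>c z. c \<in> Atl \<Longrightarrow> z \<in> W c \<Longrightarrow> L c differentiable (at z)"
    and P: "\<And>c x y. c \<in> Atl \<Longrightarrow> (x, y) \<in> W c \<Longrightarrow> ((\<lambda>y. grady (L c) (x, y)) has_derivative P c (x, y)) (at y)"
    and surj: "\<And>c z. c \<in> Atl \<Longrightarrow> z \<in> W c \<Longrightarrow> surj (P c z)"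
    and sym: "\<And>c x. c \<in> Atl \<Longrightarrow> x \<in> chart_image c \<Longrightarrow> symmetric_conn (\<Gamma> c x)"
    and par: "\<And>c z. c \<in> Atl \<Longrightarrow> z \<in> W c \<Longrightarrow> parallel_at (\<Gamma> c (fst z)) (L c) z"
  shows "transforms_as_connection Atl \<Gamma>"
  unfolding transforms_as_connection_def Let_def
proof (intro ballI allI)
  fix c d p l i k assume c: "c \<in> Atl" and d: "d \<in> Atl" and p: "p \<in> fst c \<inter> fst d"
  let ?x = "snd c p" and ?\<tau> = "transition c d"
  let ?J = "jacobian ?\<tau> (at ?x)" and ?S = "snd c ` (fst c \<inter> fst d)"
  have x: "?x \<in> ?S" using p by blast
  have xc: "?x \<in> chart_image c" "snd d p \<in> chart_image d" using p by (auto simp: chart_image_def)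
  obtain y0 where y0: "(?x, y0) \<in> W c" using proj[OF c] xc(1) by force
  have \<tau>: "?\<tau> ?x = snd d p" using transition_apply[OF c] p by blast
  have W': "(snd d p, frechet_derivative ?\<tau> (at ?x) y) \<in> W d" if "(?x, y) \<in> W c" for y
    using change[OF c d that] x by (simp add: change_def \<tau>)
  have "frechet_derivative ?\<tau> (at ?x) (conn (\<Gamma> c ?x) u v) =
      conn (\<Gamma> d (snd d p)) (frechet_derivative ?\<tau> (at ?x) u) (frechet_derivative ?\<tau> (at ?x) v)
      + frechet_derivative (\<lambda>x. frechet_derivative ?\<tau> (at x) v) (at ?x) u" for u v
  proof (rule connection_transform[OF open_overlap[OF c d] smooth_transition[OF c d] x
        inj_frechet_transition[OF c d p] W[OF c] y0, where L = "L c" and L' = "L d" and P = "\<lambda>y. P c (?x, y)"])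
    show "L c z = L d (?\<tau> (fst z), frechet_derivative ?\<tau> (at (fst z)) (snd z))" if "z \<in> W c" "fst z \<in> ?S" for z
      using change[OF c d that] by (simp add: change_def)
    fix y assume y: "(?x, y) \<in> W c"
    show "L c differentiable (at (?x, y))" by (rule diff[OF c y])
    show "L d differentiable (at (?\<tau> ?x, frechet_derivative ?\<tau> (at ?x) y))"
      unfolding \<tau> by (rule diff[OF d W'[OF y]])
    show "((\<lambda>y. grady (L c) (?x, y)) has_derivative P c (?x, y)) (at y)" by (rule P[OF c y])
    show "surj (P c (?x, y))" by (rule surj[OF c y])
    show "parallel_at (\<Gamma> c ?x) (L c) (?x, y)" using par[OF c y] by simp
    show "parallel_at (\<Gamma> d (snd d p)) (L d) (?\<tau> ?x, frechet_derivative ?\<tau> (at ?x) y)"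
      using par[OF d W'[OF y]] by (simp add: \<tau>)
  qed (rule sym[OF c xc(1)] sym[OF d xc(2)])+
  from this[of "axis i 1" "axis k 1"]
  have "(?J *v conn (\<Gamma> c ?x) (axis i 1) (axis k 1)) $ l =
      conn (\<Gamma> d (snd d p)) (?J *v axis i 1) (?J *v axis k 1) $ l
      + frechet_derivative (\<lambda>x. frechet_derivative ?\<tau> (at x) (axis k 1)) (at ?x) (axis i 1) $ l"
    by (simp add: jacobian_mult[OF transition_differentiable[OF c d p]])
  moreover have "frechet_derivative (\<lambda>x. frechet_derivative ?\<tau> (at x) (axis k 1)) (at ?x) (axis i 1) $ l
      = pd i (pd k (\<lambda>x. ?\<tau> x $ l)) ?x"
    unfolding pd_def[abs_def]
    by (rule frechet_derivative_vec_nth2[OF open_overlap[OF c d] smooth_transition[OF c d] x, symmetric])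
  moreover have "(?J *v conn (\<Gamma> c ?x) (axis i 1) (axis k 1)) $ l = (\<Sum>j\<in>UNIV. ?J $ l $ j * \<Gamma> c ?x $ j $ i $ k)"
    by (simp add: matrix_vector_mult_def conn_axis_axis)
  moreover have "conn (\<Gamma> d (snd d p)) (?J *v axis i 1) (?J *v axis k 1) $ l
      = (\<Sum>m\<in>UNIV. \<Sum>n\<in>UNIV. \<Gamma> d (snd d p) $ l $ m $ n * ?J $ m $ i * ?J $ n $ k)"
    by (simp add: conn_def matrix_vector_mult_basis column_def)
  ultimately show "(\<Sum>j\<in>UNIV. ?J $ l $ j * \<Gamma> c ?x $ j $ i $ k) =
      (\<Sum>m\<in>UNIV. \<Sum>n\<in>UNIV. \<Gamma> d (snd d p) $ l $ m $ n * ?J $ m $ i * ?J $ n $ k)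
      + pd i (pd k (\<lambda>x. ?\<tau> x $ l)) ?x" by simp
qed

end

text \<open>The inhomogeneous second-derivative term is the same in the laws for
  \<open>\<Gamma>\<close> and for the sum, so subtraction removes it.\<close>

lemma transforms_as_connection_plus_tensor:
  assumes "transforms_as_connection Atl \<Gamma>"
  shows "transforms_as_connection Atl (\<lambda>c x. \<Gamma> c x + T c x) \<longleftrightarrow>
     (\<forall>c\<in>Atl. \<forall>d\<in>Atl. \<forall>p \<in> fst c \<inter> fst d. \<forall>l i k.
        let J = jacobian (transition c d) (at (snd c p)) in
        (\<Sum>j\<in>UNIV. J $ l $ j * T c (snd c p) $ j $ i $ k) =
          (\<Sum>m\<in>UNIV. \<Sum>n\<in>UNIV. T d (snd d p) $ l $ m $ n * J $ m $ i * J $ n $ k))"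
  unfolding transforms_as_connection_def Let_def
proof (intro ball_cong refl all_cong1)
  fix c d p l i k assume cd: "c \<in> Atl" "d \<in> Atl" "p \<in> fst c \<inter> fst d"
  let ?J = "jacobian (transition c d) (at (snd c p))"
  have "(\<Sum>j\<in>UNIV. ?J $ l $ j * (\<Gamma> c (snd c p) + T c (snd c p)) $ j $ i $ k) =
      (\<Sum>j\<in>UNIV. ?J $ l $ j * \<Gamma> c (snd c p) $ j $ i $ k) + (\<Sum>j\<in>UNIV. ?J $ l $ j * T c (snd c p) $ j $ i $ k)"
    by (simp add: distrib_left sum.distrib)
  moreover have "(\<Sum>m\<in>UNIV. \<Sum>n\<in>UNIV. (\<Gamma> d (snd d p) + T d (snd d p)) $ l $ m $ n * ?J $ m $ i * ?J $ n $ k) =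
      (\<Sum>m\<in>UNIV. \<Sum>n\<in>UNIV. \<Gamma> d (snd d p) $ l $ m $ n * ?J $ m $ i * ?J $ n $ k) +
      (\<Sum>m\<in>UNIV. \<Sum>n\<in>UNIV. T d (snd d p) $ l $ m $ n * ?J $ m $ i * ?J $ n $ k)"
    by (simp add: distrib_right sum.distrib)
  moreover have "(\<Sum>j\<in>UNIV. ?J $ l $ j * \<Gamma> c (snd c p) $ j $ i $ k) =
      (\<Sum>m\<in>UNIV. \<Sum>n\<in>UNIV. \<Gamma> d (snd d p) $ l $ m $ n * ?J $ m $ i * ?J $ n $ k)
      + pd i (pd k (\<lambda>x. transition c d x $ l)) (snd c p)"
    using assms cd unfolding transforms_as_connection_def Let_def by blast
  ultimately show "(\<Sum>j\<in>UNIV. ?J $ l $ j * (\<Gamma> c (snd c p) + T c (snd c p)) $ j $ i $ k) =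
      (\<Sum>m\<in>UNIV. \<Sum>n\<in>UNIV. (\<Gamma> d (snd d p) + T d (snd d p)) $ l $ m $ n * ?J $ m $ i * ?J $ n $ k)
      + pd i (pd k (\<lambda>x. transition c d x $ l)) (snd c p) \<longleftrightarrow>
      (\<Sum>j\<in>UNIV. ?J $ l $ j * T c (snd c p) $ j $ i $ k) =
      (\<Sum>m\<in>UNIV. \<Sum>n\<in>UNIV. T d (snd d p) $ l $ m $ n * ?J $ m $ i * ?J $ n $ k)"
    by linarith
qed

section \<open>An (\<alpha>, \<beta>)-metric on the whole manifold\<close>

locale alpha_beta_manifold = smooth_atlas M Atl
  for M :: "'a topology" and Atl :: "('a, 'n::finite) chart set" +
  fixes A :: "('a, 'n) tangent set" and F :: "('a, 'n) tangent \<Rightarrow> real"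
    and a :: "('a, 'n) chart \<Rightarrow> real^'n \<Rightarrow> real^'n^'n"
    and b :: "('a, 'n) chart \<Rightarrow> real^'n \<Rightarrow> real^'n"
    and D :: "real set" and \<phi> :: "real \<Rightarrow> real"
  assumes metric: "alpha_beta_metric M Atl A F a b D \<phi>"
    and crit: "(tangent_topology M Atl) interior_of (phi_crit_set Atl A a b \<phi>) = {}"
begin

abbreviation "coord_F \<equiv> coord_fun M Atl F"

lemma finsler: "finsler_metric M Atl A F" and conic: "conic_subbundle M Atl A"
  and riem: "pseudo_riemannian_metric Atl a" and form: "one_form Atl b"
  and open_D: "open D" and smooth_\<phi>: "smooth_on D \<phi>"
  using metric by (auto simp: alpha_beta_metric_def finsler_metric_def)

lemma open_A: "openin (tangent_topology M Atl) A"
  using conic by (simp add: conic_subbundle_def)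

lemma A_subset: "A \<subseteq> tangent_bundle M Atl"
  using open_A openin_tangent_topology[OF manifold] by blast

lemma open_coord_set: "c \<in> Atl \<Longrightarrow> open (coord_set c A)"
  using open_A openin_tangent_topology[OF manifold] by blast

lemma coord_setE:
  assumes "z \<in> coord_set c A"
  obtains w where "w \<in> A" "fst w \<in> fst c" "z = tangent_coords c w"
  using assms by (auto simp: coord_set_def)

lemma fst_coord_set: "c \<in> Atl \<Longrightarrow> fst ` coord_set c A = chart_image c"
proof -
  assume c: "c \<in> Atl"
  have "fst ` coord_set c A = snd c ` {p \<in> fst ` A. p \<in> fst c}"
    by (force simp: coord_set_def tangent_coords_def)
  also have "{p \<in> fst ` A. p \<in> fst c} = fst c"
    using conic dom_subset[OF c] by (auto simp: conic_subbundle_def)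
  finally show ?thesis by (simp add: chart_image_def)
qed

lemma coord_F_apply:
  assumes "c \<in> Atl" "w \<in> A" "fst w \<in> fst c"
  shows "coord_F c (tangent_coords c w) = F w"
proof -
  have "w \<in> {w \<in> tangent_bundle M Atl. fst w \<in> fst c}" using assms A_subset by blast
  then show ?thesis
    by (simp add: coord_fun_def inv_into_f_f[OF inj_on_tangent_coords[OF manifold assms(1)]])
qed

lemma coord_F_alpha_phi:
  assumes c: "c \<in> Atl" and z: "z \<in> coord_set c A"
  shows "ab_quad (a c) z \<noteq> 0" "ab_s (a c) (b c) z \<in> D"
    "coord_F c z = ab_alpha (a c) z * \<phi> (ab_s (a c) (b c) z)"
proof -
  obtain w where w: "w \<in> A" "fst w \<in> fst c" and z: "z = tangent_coords c w"
    using coord_setE[OF z] .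
  have *: "ab_alpha (a c) z \<noteq> 0 \<and> ab_s (a c) (b c) z \<in> D \<and> F w = ab_alpha (a c) z * \<phi> (ab_s (a c) (b c) z)"
    using metric c w unfolding alpha_beta_metric_def Let_def z by blast
  then show "ab_quad (a c) z \<noteq> 0" by (auto simp: ab_alpha_def)
  show "ab_s (a c) (b c) z \<in> D" "coord_F c z = ab_alpha (a c) z * \<phi> (ab_s (a c) (b c) z)"
    using * coord_F_apply[OF c w] by (simp_all add: z)
qed

lemma alpha_beta_chart_coord: "c \<in> Atl \<Longrightarrow> alpha_beta_chart (chart_image c) (a c) (b c)"
  using riem form open_chart_image[of c]
  unfolding alpha_beta_chart_def alpha_beta_chart_axioms_def pseudo_riemannian_chart_def
    pseudo_riemannian_metric_def one_form_def by blast

lemma finsler_chart_coord: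
  assumes c: "c \<in> Atl" shows "finsler_chart (coord_set c A) (coord_F c)"
proof
  show "open (coord_set c A)" by (rule open_coord_set[OF c])
  show "smooth_on (coord_set c A) (coord_F c)" "z \<in> coord_set c A \<Longrightarrow> invertible (fundamental_tensor (coord_F c) z)" for z
    using finsler c by (auto simp: finsler_metric_def)
  show "pos_homogeneous (coord_set c A) 1 (coord_F c)"
    unfolding pos_homogeneous_def
  proof (intro allI impI)
    fix x y and r :: real assume xy: "(x, y) \<in> coord_set c A" and r: "r > 0"
    obtain w where w: "w \<in> A" "fst w \<in> fst c" and z: "(x, y) = tangent_coords c w" using coord_setE[OF xy] .
    have s: "tangent_scale r w \<in> A" "F (tangent_scale r w) = r * F w" "fst (tangent_scale r w) \<in> fst c"
      using finsler conic w r by (auto simp: conic_subbundle_def finsler_metric_def tangent_scale_def)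
    have "(x, r *\<^sub>R y) = tangent_coords c (tangent_scale r w)"
      using z by (simp add: tangent_coords_def tangent_scale_def)
    then show "(x, r *\<^sub>R y) \<in> coord_set c A \<and> coord_F c (x, r *\<^sub>R y) = r ^ 1 * coord_F c (x, y)"
      using s coord_F_apply[OF c] w z by (auto simp: coord_set_def)
  qed
qed

text \<open>As \<alpha> does not vanish on \<open>A\<close>, the fibre vector is nonzero and
  \<open>f_nonzero\<close> applies.\<close>

lemma coord_F_nonzero:
  assumes c: "c \<in> Atl" and z: "z \<in> coord_set c A" shows "coord_F c z \<noteq> 0"
proof -
  interpret finsler_chart "coord_set c A" "coord_F c" by (rule finsler_chart_coord[OF c])
  have "snd z \<noteq> 0" using coord_F_alpha_phi(1)[OF c z] by (auto simp: ab_quad_def)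
  then show ?thesis using f_nonzero[of "fst z" "snd z"] z by simp
qed

lemma change_coord_set:
  assumes c: "c \<in> Atl" and d: "d \<in> Atl" and z: "z \<in> coord_set c A" and x: "fst z \<in> snd c ` (fst c \<inter> fst d)"
  obtains w where "w \<in> A" "fst w \<in> fst c \<inter> fst d" "z = tangent_coords c w" "change c d z = tangent_coords d w"
proof -
  obtain w where w: "w \<in> A" "fst w \<in> fst c" "z = tangent_coords c w" using coord_setE[OF z] .
  have "fst w \<in> fst c \<inter> fst d"
    using x w inj_chart[OF c] by (auto simp: tangent_coords_def inj_on_def)
  moreover have "w \<in> tangent_bundle M Atl" using w(1) A_subset by blast
  ultimately show thesis using that[of w] w tangent_coords_change[OF c d, of w] by simp
qed

text \<open>The Lagrangian is \<open>ab_quad\<close>: its invariance is the transformation law of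
  the metric, and its fibre Hessian \<open>2 a\<close> is nondegenerate.\<close>

lemma transforms_levi_civita: "transforms_as_connection Atl (\<lambda>c. levi_civita (a c))"
proof (rule transforms_as_connection_of_parallel[where W = "\<lambda>c. chart_image c \<times> UNIV" and L = "\<lambda>c. ab_quad (a c)"
      and P = "\<lambda>c z v. 2 *\<^sub>R (a c (fst z) *v v)"])
  fix c d and z :: "(real^'n) \<times> (real^'n)"
  assume c: "c \<in> Atl" and d: "d \<in> Atl" and x: "fst z \<in> snd c ` (fst c \<inter> fst d)"
  then obtain p where p: "p \<in> fst c \<inter> fst d" "fst z = snd c p" by blast
  let ?J = "jacobian (transition c d) (at (snd c p))"
  have z: "z = (snd c p, snd z)" using p(2) by (metis prod.collapse)
  have ch: "change c d z = (snd d p, ?J *v snd z)"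
    using p jacobian_mult[OF transition_differentiable[OF c d p(1)]] transition_apply[OF c] by (simp add: change_def)
  have "a c (snd c p) $ i $ j = (\<Sum>k\<in>UNIV. \<Sum>l\<in>UNIV. ?J $ k $ i * ?J $ l $ j * a d (snd d p) $ k $ l)" for i j
    using riem c d p(1) unfolding pseudo_riemannian_metric_def Let_def by blast
  \<comment> \<open>The tensor law in matrix form, so that the Jacobians can be moved onto the fibre
    vectors.\<close>
  moreover have "(transpose ?J ** (a d (snd d p) ** ?J)) $ i $ j = (\<Sum>k\<in>UNIV. \<Sum>l\<in>UNIV. ?J $ k $ i * ?J $ l $ j * a d (snd d p) $ k $ l)" for i j
    by (simp add: matrix_matrix_mult_def transpose_def sum_distrib_left ac_simps)
  ultimately have "a c (snd c p) = transpose ?J ** (a d (snd d p) ** ?J)"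
    by (simp add: vec_eq_iff)
  then have "ab_quad (a c) z = snd z \<bullet> (transpose ?J *v (a d (snd d p) *v (?J *v snd z)))"
    by (subst z) (simp add: ab_quad_inner matrix_vector_mul_assoc matrix_mul_assoc)
  also have "\<dots> = ab_quad (a d) (change c d z)"
    unfolding ch ab_quad_inner by (metis dot_lmul_matrix vector_transpose_matrix)
  finally show "change c d z \<in> chart_image d \<times> UNIV \<and> ab_quad (a c) z = ab_quad (a d) (change c d z)"
    using p by (simp add: ch chart_image_def)
next
  fix c assume c: "c \<in> Atl"
  interpret alpha_beta_chart "chart_image c" "a c" "b c" by (rule alpha_beta_chart_coord[OF c])
  show "open (chart_image c \<times> (UNIV :: (real^'n) set))" by (intro open_Times open_U open_UNIV)
  show "fst ` (chart_image c \<times> (UNIV :: (real^'n) set)) = chart_image c" by simp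
  show "symmetric_conn (levi_civita (a c) x)" if "x \<in> chart_image c" for x
    using that by (rule symmetric_levi_civita)
  fix z assume "z \<in> chart_image c \<times> (UNIV :: (real^'n) set)"
  then obtain x y where z: "z = (x, y)" and x: "x \<in> chart_image c" by auto
  show "ab_quad (a c) differentiable (at z)" unfolding z by (rule ab_quad_differentiable[OF x])
  show "surj (\<lambda>v. 2 *\<^sub>R (a c (fst z) *v v))" unfolding z using surj_a[OF x] by simp
  show "parallel_at (levi_civita (a c) (fst z)) (ab_quad (a c)) z"
    unfolding z using levi_civita_parallel_at[OF x] by simp
next
  fix c x y assume c: "c \<in> Atl" and "(x, y) \<in> chart_image c \<times> (UNIV :: (real^'n) set)"
  then have x: "x \<in> chart_image c" by simp
  interpret alpha_beta_chart "chart_image c" "a c" "b c" by (rule alpha_beta_chart_coord[OF c])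
  show "((\<lambda>y. grady (ab_quad (a c)) (x, y)) has_derivative (\<lambda>v. 2 *\<^sub>R (a c (fst (x, y)) *v v))) (at y)"
    using grady_ab_quad_derivative[OF x] by simp
qed

lemma transforms_of_parallel_F:
  assumes sym: "\<And>c x. c \<in> Atl \<Longrightarrow> x \<in> chart_image c \<Longrightarrow> symmetric_conn (\<Gamma> c x)"
    and par: "\<And>c z. c \<in> Atl \<Longrightarrow> z \<in> coord_set c A \<Longrightarrow> parallel_at (\<Gamma> c (fst z)) (\<lambda>z. (coord_F c z)\<^sup>2) z"
  shows "transforms_as_connection Atl \<Gamma>"
proof (rule transforms_as_connection_of_parallel[where W = "\<lambda>c. coord_set c A" and L = "\<lambda>c z. (coord_F c z)\<^sup>2"
      and P = "\<lambda>c z v. 2 *\<^sub>R (fundamental_tensor (coord_F c) z *v v)"])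
  fix c d z assume c: "c \<in> Atl" and d: "d \<in> Atl" and z: "z \<in> coord_set c A" and x: "fst z \<in> snd c ` (fst c \<inter> fst d)"
  obtain w where w: "w \<in> A" "fst w \<in> fst c \<inter> fst d" "z = tangent_coords c w" "change c d z = tangent_coords d w"
    using change_coord_set[OF c d z x] .
  then show "change c d z \<in> coord_set d A \<and> (coord_F c z)\<^sup>2 = (coord_F d (change c d z))\<^sup>2"
    using coord_F_apply[OF c] coord_F_apply[OF d] by (auto simp: coord_set_def)
next
  fix c assume c: "c \<in> Atl"
  interpret finsler_chart "coord_set c A" "coord_F c" by (rule finsler_chart_coord[OF c])
  show "open (coord_set c A)" by (rule open_W)
  show "fst ` coord_set c A = chart_image c" by (rule fst_coord_set[OF c])
  fix z assume z: "z \<in> coord_set c A"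
  show "(\<lambda>z. (coord_F c z)\<^sup>2) differentiable (at z)" using diff_L[OF z] by (simp add: L_def[abs_def])
  show "surj (\<lambda>v. 2 *\<^sub>R (fundamental_tensor (coord_F c) z *v v))" by (rule surj_g[OF z])
next
  fix c x y assume c: "c \<in> Atl" and z: "(x, y) \<in> coord_set c A"
  interpret finsler_chart "coord_set c A" "coord_F c" by (rule finsler_chart_coord[OF c])
  show "((\<lambda>y. grady (\<lambda>z. (coord_F c z)\<^sup>2) (x, y)) has_derivative (\<lambda>v. 2 *\<^sub>R (fundamental_tensor (coord_F c) (x, y) *v v))) (at y)"
    using grady_L_derivative[OF z] by (simp add: L_def[abs_def])
qed (rule sym par; assumption)+

text \<open>Openness has to be tested in every chart \<open>d\<close>; there the patch is the
  preimage of \<open>V\<close> under the continuous change of coordinates, cut down to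
  \<open>A\<close>.\<close>

lemma open_coord_patch:
  assumes c: "c \<in> Atl" and V: "open V" "V \<subseteq> coord_set c A"
  shows "openin (tangent_topology M Atl) {w \<in> A. fst w \<in> fst c \<and> tangent_coords c w \<in> V}"
  unfolding openin_tangent_topology[OF manifold]
proof (intro conjI ballI)
  let ?W = "{w \<in> A. fst w \<in> fst c \<and> tangent_coords c w \<in> V}"
  show "?W \<subseteq> tangent_bundle M Atl" using A_subset by blast
  fix d assume d: "d \<in> Atl"
  let ?S = "snd d ` (fst d \<inter> fst c) \<times> (UNIV :: (real^'n) set)"
  have "coord_set d ?W = coord_set d A \<inter> (?S \<inter> change d c -` V)"
  proof (intro equalityI subsetI)
    fix z assume "z \<in> coord_set d ?W"
    then obtain w where w: "w \<in> A" "fst w \<in> fst d \<inter> fst c" "tangent_coords c w \<in> V" and z: "z = tangent_coords d w"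
      unfolding coord_set_def by blast
    have "w \<in> tangent_bundle M Atl" using w(1) A_subset by blast
    then have "change d c z = tangent_coords c w"
      unfolding z by (rule tangent_coords_change[OF d c _ w(2), symmetric])
    then have "change d c z \<in> V" using w(3) by simp
    moreover have "z \<in> coord_set d A" using w z unfolding coord_set_def by blast
    moreover have "fst z \<in> snd d ` (fst d \<inter> fst c)" using w(2) z by (simp add: tangent_coords_def)
    ultimately show "z \<in> coord_set d A \<inter> (?S \<inter> change d c -` V)" by (simp add: mem_Times_iff)
  next
    fix z assume z: "z \<in> coord_set d A \<inter> (?S \<inter> change d c -` V)"
    then have "z \<in> coord_set d A" "fst z \<in> snd d ` (fst d \<inter> fst c)" by auto
    then obtain w where w: "w \<in> A" "fst w \<in> fst d \<inter> fst c" "z = tangent_coords d w" "change d c z = tangent_coords c w"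
      using change_coord_set[OF d c] by metis
    have "change d c z \<in> V" using z by blast
    then have "w \<in> {w \<in> ?W. fst w \<in> fst d}" using w by simp
    then show "z \<in> coord_set d ?W" using w(3) unfolding coord_set_def by blast
  qed
  moreover have "open (?S \<inter> change d c -` V)"
    by (rule continuous_open_preimage[OF continuous_on_change[OF d c] _ V(1)])
      (intro open_Times open_overlap d c open_UNIV)
  ultimately show "open (coord_set d ?W)" using open_coord_set[OF d] by (simp add: open_Int)
qed

text \<open>Turns the empty interior of the critical set into density within a chart: otherwise
  \<open>open_coord_patch\<close> would yield a nonempty open set of critical points.\<close>

lemma noncritical_dense:
  assumes c: "c \<in> Atl" and V: "open V" "V \<subseteq> coord_set c A" "V \<noteq> {}"
  obtains z where "z \<in> V" "deriv \<phi> (ab_s (a c) (b c) z) \<noteq> 0"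
proof (rule ccontr)
  assume "\<not> thesis"
  then have 0: "\<forall>z\<in>V. deriv \<phi> (ab_s (a c) (b c) z) = 0" using that by blast
  let ?W = "{w \<in> A. fst w \<in> fst c \<and> tangent_coords c w \<in> V}"
  have "?W \<subseteq> phi_crit_set Atl A a b \<phi>"
    using 0 c by (auto simp: phi_crit_set_def)
  then have "?W = {}"
    using interior_of_maximal[OF _ open_coord_patch[OF c V(1,2)]] crit by blast
  moreover obtain z where "z \<in> V" using V(3) by blast
  ultimately show False using V(2) coord_setE[of z c] by blast
qed

text \<open>The horizontal derivatives of \<open>F\<^sup>2\<close> are continuous, so it is enough to know that they vanish where
  \<open>\<phi>' \<noteq> 0\<close>.\<close>

lemma parallel_at_everywhere:
  assumes c: "c \<in> Atl" and G: "continuous_on (chart_image c) G"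
    and par: "\<And>z. z \<in> coord_set c A \<Longrightarrow> deriv \<phi> (ab_s (a c) (b c) z) \<noteq> 0 \<Longrightarrow> parallel_at (G (fst z)) (\<lambda>z. (coord_F c z)\<^sup>2) z"
    and z: "z \<in> coord_set c A"
  shows "parallel_at (G (fst z)) (\<lambda>z. (coord_F c z)\<^sup>2) z"
proof -
  interpret finsler_chart "coord_set c A" "coord_F c" by (rule finsler_chart_coord[OF c])
  have L: "(\<lambda>z. (coord_F c z)\<^sup>2) = L" by (simp add: L_def[abs_def])
  have "gradx L z \<bullet> u = grady L z \<bullet> conn (G (fst z)) u (snd z)" for u
  proof (rule ccontr)
    define E where "E z = gradx L z \<bullet> u - grady L z \<bullet> conn (G (fst z)) u (snd z)" for z
    assume "gradx L z \<bullet> u \<noteq> grady L z \<bullet> conn (G (fst z)) u (snd z)"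
    then have E: "E z \<noteq> 0" by (simp add: E_def)
    have "continuous_on (coord_set c A) (\<lambda>z. G (fst z))"
      by (rule continuous_on_compose2[OF G continuous_on_fst[OF continuous_on_id]]) (use fst_coord_set[OF c] in auto)
    then have cG: "continuous_on (coord_set c A) (\<lambda>z. G (fst z) $ k $ i $ j)" for k i j
      by (intro bounded_linear.continuous_on[OF bounded_linear_vec_nth])
    have cy: "continuous_on (coord_set c A) (\<lambda>z. snd z $ j)" for j by (intro continuous_intros)
    note cL = smooth_onD_continuous[OF smooth_on_pdx[OF smooth_L]] smooth_onD_continuous[OF smooth_on_pdy[OF smooth_L]]
    have "continuous_on (coord_set c A) E"
      unfolding E_def[abs_def] inner_vec_def inner_real_def gradx_def grady_def conn_def vec_lambda_beta
      by (intro continuous_on_diff continuous_on_sum continuous_on_mult continuous_on_const cG cy cL)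
    \<comment> \<open>The open set where \<open>E\<close> is nonzero contains \<open>z\<close>, so
      by density it contains a noncritical point, contradicting \<open>par\<close>.\<close>
    then have "open (coord_set c A \<inter> E -` (- {0}))"
      by (rule continuous_open_preimage[OF _ open_W]) auto
    then obtain z' where z': "z' \<in> coord_set c A \<inter> E -` (- {0})" "deriv \<phi> (ab_s (a c) (b c) z') \<noteq> 0"
      using noncritical_dense[OF c, of "coord_set c A \<inter> E -` (- {0})"] z E by blast
    then have "parallel_at (G (fst z')) L z'" using par[of z'] by (simp add: L)
    then show False using z'(1) by (auto simp: parallel_at_iff[OF diff_L] E_def)
  qed
  then show ?thesis by (simp add: L parallel_at_iff[OF diff_L[OF z]])
qed

lemma parallel_at_iff_equation:
  assumes c: "c \<in> Atl" and z: "z \<in> coord_set c A" and nz: "deriv \<phi> (ab_s (a c) (b c) z) \<noteq> 0"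
  shows "parallel_at (levi_civita (a c) (fst z) + T) (\<lambda>z. (coord_F c z)\<^sup>2) z \<longleftrightarrow>
    (\<forall>i. (\<Sum>j\<in>UNIV. snd z $ j * cov_deriv (a c) (b c) i j (fst z)) =
      (\<Sum>j\<in>UNIV. \<Sum>k\<in>UNIV. T $ j $ i $ k * snd z $ k *
        (b c (fst z) $ j + sgn (ab_quad (a c) z) / ab_alpha (a c) z *
          (\<phi> (ab_s (a c) (b c) z) / deriv \<phi> (ab_s (a c) (b c) z) - ab_s (a c) (b c) z) * ab_lower (a c) z j)))"
proof -
  interpret alpha_beta_chart "chart_image c" "a c" "b c" by (rule alpha_beta_chart_coord[OF c])
  obtain x y where xy: "z = (x, y)" by (cases z)
  have x: "x \<in> chart_image c" using fst_coord_set[OF c] z xy by force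
  have "\<phi> differentiable (at (ab_s (a c) (b c) z))"
    by (rule smooth_onD_differentiable[OF smooth_\<phi> coord_F_alpha_phi(2)[OF c z]])
  then have "(\<phi> has_real_derivative deriv \<phi> (ab_s (a c) (b c) z)) (at (ab_s (a c) (b c) z))"
    by (metis DERIV_deriv_iff_real_differentiable)
  from parallel_at_iff_berwald_equation[OF x coord_F_alpha_phi(1)[OF c z, unfolded xy] this[unfolded xy] nz[unfolded xy]
      open_coord_set[OF c] z[unfolded xy] coord_F_alpha_phi(3)[OF c] coord_F_nonzero[OF c z, unfolded xy]]
  show ?thesis by (simp add: xy)
qed

lemma affine_connection_of_berwald_tensor:
  assumes T: "berwald_tensor Atl A a b \<phi> T"
  shows "affine_connection_of M Atl A F (\<lambda>c x. levi_civita (a c) x + T c x)"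
proof -
  let ?G = "\<lambda>c x. levi_civita (a c) x + T c x"
  have T12: "tensor_1_2 Atl T" using T by (simp add: berwald_tensor_def)
  have symT: "symmetric_conn (T c x)" if "c \<in> Atl" "x \<in> chart_image c" for c x
    using T that by (simp add: berwald_tensor_def symmetric_conn_def)
  have smooth: "smooth_on (chart_image c) (?G c)" if c: "c \<in> Atl" for c
  proof -
    interpret alpha_beta_chart "chart_image c" "a c" "b c" by (rule alpha_beta_chart_coord[OF c])
    show ?thesis using T12 c by (intro smooth_on_add open_U smooth_levi_civita) (simp add: tensor_1_2_def)
  qed
  have sym: "symmetric_conn (?G c x)" if c: "c \<in> Atl" and x: "x \<in> chart_image c" for c x
  proof -
    interpret alpha_beta_chart "chart_image c" "a c" "b c" by (rule alpha_beta_chart_coord[OF c])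
    show ?thesis using symmetric_levi_civita[OF x] symT[OF c x] by (simp add: symmetric_conn_def)
  qed
  \<comment> \<open>The equation speaks only of points with \<open>\<phi>' \<noteq> 0\<close>; there
    it amounts to parallelism, which density extends to all of \<open>A\<close>.\<close>
  have par: "parallel_at (?G c (fst z)) (\<lambda>z. (coord_F c z)\<^sup>2) z" if c: "c \<in> Atl" and z: "z \<in> coord_set c A" for c z
  proof (rule parallel_at_everywhere[OF c smooth_onD_continuous[OF smooth[OF c]] _ z])
    fix z assume z: "z \<in> coord_set c A" and nz: "deriv \<phi> (ab_s (a c) (b c) z) \<noteq> 0"
    have "\<forall>i. (\<Sum>j\<in>UNIV. snd z $ j * cov_deriv (a c) (b c) i j (fst z)) =
      (\<Sum>j\<in>UNIV. \<Sum>k\<in>UNIV. T c (fst z) $ j $ i $ k * snd z $ k *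
        (b c (fst z) $ j + sgn (ab_quad (a c) z) / ab_alpha (a c) z *
          (\<phi> (ab_s (a c) (b c) z) / deriv \<phi> (ab_s (a c) (b c) z) - ab_s (a c) (b c) z) * ab_lower (a c) z j))"
      using T c z nz unfolding berwald_tensor_def Let_def ab_s_def by blast
    then show "parallel_at (?G c (fst z)) (\<lambda>z. (coord_F c z)\<^sup>2) z"
      using parallel_at_iff_equation[OF c z nz] by blast
  qed
  have "nonlinear_connection (coord_F c) k i z = (\<Sum>j\<in>UNIV. ?G c (fst z) $ k $ i $ j * snd z $ j)"
    if c: "c \<in> Atl" and z: "z \<in> coord_set c A" for c z k i
  proof -
    interpret finsler_chart "coord_set c A" "coord_F c" by (rule finsler_chart_coord[OF c])
    obtain x y where xy: "z = (x, y)" by (cases z)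
    have x: "x \<in> chart_image c" using fst_coord_set[OF c] z xy by force
    have "nonlinear_connection (coord_F c) k i (x, y) = (\<Sum>j\<in>UNIV. ?G c x $ k $ i $ j * y $ j)"
      by (rule nonlinear_connection_of_parallel_at[OF sym[OF c x]])
        (use par[OF c] z in \<open>auto simp: xy L_def[abs_def]\<close>)
    then show ?thesis by (simp add: xy)
  qed
  moreover have "transforms_as_connection Atl ?G"
    using T12 transforms_as_connection_plus_tensor[OF transforms_levi_civita] by (simp add: tensor_1_2_def)
  ultimately show ?thesis
    using smooth sym by (simp add: affine_connection_of_def torsion_free_affine_connection_iff)
qed

lemma berwald_tensor_exists:
  assumes "berwald_type M Atl A F"
  shows "\<exists>T. berwald_tensor Atl A a b \<phi> T"
proof -
  \<comment> \<open>Berwald type supplies coefficients for each chart separately; their symmetry,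
    smoothness and transformation law are derived below.\<close>
  obtain \<Gamma> where N: "nonlinear_connection (coord_F c) k i z = (\<Sum>j\<in>UNIV. \<Gamma> c (fst z) $ k $ i $ j * snd z $ j)"
    if "c \<in> Atl" "z \<in> coord_set c A" for c k i z
    using assms unfolding berwald_type_def by metis
  define T where "T c x = \<Gamma> c x - levi_civita (a c) x" for c x
  have \<Gamma>: "\<Gamma> = (\<lambda>c x. levi_civita (a c) x + T c x)" by (simp add: fun_eq_iff T_def)
  have sym: "symmetric_conn (\<Gamma> c x)" if c: "c \<in> Atl" and x: "x \<in> chart_image c" for c x
  proof -
    interpret finsler_chart "coord_set c A" "coord_F c" by (rule finsler_chart_coord[OF c])
    obtain y where y: "(x, y) \<in> coord_set c A" using fst_coord_set[OF c] x by force
    show ?thesis by (rule symmetric_conn_of_nonlinear_connection[OF _ y]) (use N[OF c] in auto)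
  qed
  have par: "parallel_at (\<Gamma> c (fst z)) (\<lambda>z. (coord_F c z)\<^sup>2) z" if c: "c \<in> Atl" and z: "z \<in> coord_set c A" for c z
  proof -
    interpret finsler_chart "coord_set c A" "coord_F c" by (rule finsler_chart_coord[OF c])
    have "parallel_at (\<Gamma> c (fst z)) L (fst z, snd z)"
      by (rule parallel_at_of_nonlinear_connection) (use N[OF c] z in auto)
    then show ?thesis by (simp add: L_def[abs_def])
  qed
  \<comment> \<open>The coefficients of different charts fit together because
    \<open>F\<^sup>2\<close> admits only one symmetric parallel connection.\<close>
  have "transforms_as_connection Atl \<Gamma>" by (rule transforms_of_parallel_F[OF sym par])
  moreover have "smooth_on (chart_image c) (T c)" if c: "c \<in> Atl" for c
  proof -
    interpret finsler_chart "coord_set c A" "coord_F c" by (rule finsler_chart_coord[OF c])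
    interpret alpha_beta_chart "chart_image c" "a c" "b c" by (rule alpha_beta_chart_coord[OF c])
    have "smooth_on (fst ` coord_set c A) (\<Gamma> c)"
      by (rule smooth_of_nonlinear_connection) (use N[OF c] in auto)
    then show ?thesis
      unfolding T_def[abs_def] fst_coord_set[OF c] by (intro smooth_on_diff open_U smooth_levi_civita)
  qed
  ultimately have "tensor_1_2 Atl T"
    using transforms_as_connection_plus_tensor[OF transforms_levi_civita, of T]
    unfolding \<Gamma>[symmetric] tensor_1_2_def by blast
  moreover have "T c x $ j $ i $ k = T c x $ j $ k $ i" if c: "c \<in> Atl" and x: "x \<in> chart_image c" for c x j i k
  proof -
    interpret alpha_beta_chart "chart_image c" "a c" "b c" by (rule alpha_beta_chart_coord[OF c])
    show ?thesis using symmetric_levi_civita[OF x] sym[OF c x] by (simp add: symmetric_conn_def T_def)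
  qed
  moreover have "(\<Sum>j\<in>UNIV. snd z $ j * cov_deriv (a c) (b c) i j (fst z)) =
      (\<Sum>j\<in>UNIV. \<Sum>k\<in>UNIV. T c (fst z) $ j $ i $ k * snd z $ k *
        (b c (fst z) $ j + sgn (ab_quad (a c) z) / ab_alpha (a c) z *
          (\<phi> (ab_s (a c) (b c) z) / deriv \<phi> (ab_s (a c) (b c) z) - ab_s (a c) (b c) z) * ab_lower (a c) z j))"
    if c: "c \<in> Atl" and z: "z \<in> coord_set c A" and nz: "deriv \<phi> (ab_s (a c) (b c) z) \<noteq> 0" for c z i
    using par[OF c z] parallel_at_iff_equation[OF c z nz, of "T c (fst z)"] by (simp add: T_def)
  ultimately have "berwald_tensor Atl A a b \<phi> T"
    unfolding berwald_tensor_def Let_def ab_s_def by blast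
  then show ?thesis by (rule exI[of _ T])
qed

end

theorem theorem5p2p4:
  fixes M :: "'a topology" and Atl :: "('a, 'n::finite) chart set"
    and A :: "('a, 'n) tangent set" and F :: "('a, 'n) tangent \<Rightarrow> real"
    and a :: "('a, 'n) chart \<Rightarrow> real^'n \<Rightarrow> real^'n^'n"
    and b :: "('a, 'n) chart \<Rightarrow> real^'n \<Rightarrow> real^'n"
    and D :: "real set" and \<phi> :: "real \<Rightarrow> real"
  assumes "smooth_manifold M Atl"
    and "alpha_beta_metric M Atl A F a b D \<phi>"
    and "(tangent_topology M Atl) interior_of (phi_crit_set Atl A a b \<phi>) = {}"
  shows "(berwald_type M Atl A F \<longleftrightarrow> (\<exists>T. berwald_tensor Atl A a b \<phi> T)) \<and>
    (\<forall>T. berwald_tensor Atl A a b \<phi> T \<longrightarrow>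
       affine_connection_of M Atl A F (\<lambda>c x. levi_civita (a c) x + T c x))"
proof -
  interpret alpha_beta_manifold M Atl A F a b D \<phi>
    by unfold_locales (use assms in auto)
  have "berwald_type M Atl A F" if "berwald_tensor Atl A a b \<phi> T" for T
    unfolding berwald_type_def
  proof
    fix c assume "c \<in> Atl"
    then show "\<exists>\<Gamma>. \<forall>z\<in>coord_set c A. \<forall>k i. nonlinear_connection (coord_F c) k i z =
        (\<Sum>j\<in>UNIV. \<Gamma> (fst z) $ k $ i $ j * snd z $ j)"
      using affine_connection_of_berwald_tensor[OF that]
      by (intro exI[of _ "\<lambda>x. levi_civita (a c) x + T c x"]) (simp add: affine_connection_of_def)
  qed
  then show ?thesis
    using berwald_tensor_exists affine_connection_of_berwald_tensor by blast
qed

end
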